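(* Let $p$ be a prime and let $n\ge 1$ be a positive integer. Then the group $\mathcal{L}_{n,p}=(\mathbb{Z}/p\mathbb{Z})^n\wr\mathbb{Z}$ is profinitely rigid.
   Context: For groups $G,H$, the wreath product $H\wr G$ is the semidirect product $\left(\bigoplus_G H\right)\rtimes G$, where $\bigoplus_G H$ is the direct sum (finitely supported functions $G\to H$) and $G$ acts by shifting the index: $g\cdot(h_a)_{a\in G}=(h_{g^{-1}a})_{a\in G}$. The profinite completion of a group $\Gamma$ is $\widehat{\Gamma}=\varprojlim_{N}\Gamma/N$, the inverse limit over all finite-index normal subgroups $N$ of $\Gamma$. A finitely generated residually finite group $\Gamma$ is called profinitely rigid if for every finitely generated residually finite group $\Delta$, an isomorphism $\widehat{\Gamma}\cong\widehat{\Delta}$ implies $\Gamma\cong\Delta$. (For finitely generated residually finite groups, $\widehat{\Gamma}\cong\widehat{\Delta}$ holds if and only if $\Gamma$ and $\Delta$ have the same set of isomorphism classes of finite quotients.) *)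

theory Defs
  imports "HOL-Algebra.Product_Groups" "HOL-Analysis.Function_Topology"
    "HOL-Computational_Algebra.Primes"
begin

text \<open>The left shift action of \<open>G\<close> on \<open>\<Oplus>\<^bsub>G\<^esub> H\<close>. As everywhere in the library's product and
  sum groups, families indexed by \<open>carrier G\<close> are extensional functions.\<close>

definition shift :: "('g, 'm) monoid_scheme \<Rightarrow> 'g \<Rightarrow> ('g \<Rightarrow> 'h) \<Rightarrow> ('g \<Rightarrow> 'h)" where
  "shift G g f = (\<lambda>a\<in>carrier G. f (inv\<^bsub>G\<^esub> g \<otimes>\<^bsub>G\<^esub> a))"

definition wreath_product ::
    "('h, 'k) monoid_scheme \<Rightarrow> ('g, 'm) monoid_scheme \<Rightarrow> (('g \<Rightarrow> 'h) \<times> 'g) monoid" where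
  "wreath_product H G =
     (let B = sum_group (carrier G) (\<lambda>_. H) in
       \<lparr>carrier = carrier B \<times> carrier G,
        monoid.mult = (\<lambda>(f, g) (f', g'). (f \<otimes>\<^bsub>B\<^esub> shift G g f', g \<otimes>\<^bsub>G\<^esub> g')),
        one = (\<one>\<^bsub>B\<^esub>, \<one>\<^bsub>G\<^esub>)\<rparr>)"

definition lamplighter :: "nat \<Rightarrow> nat \<Rightarrow> ((int \<Rightarrow> nat \<Rightarrow> int) \<times> int) monoid" where
  "lamplighter n p =
     wreath_product (product_group {..<n} (\<lambda>_. integer_mod_group p)) integer_group"

definition finite_index_normal :: "('a, 'm) monoid_scheme \<Rightarrow> 'a set set" where
  "finite_index_normal G = {N. N \<lhd> G \<and> finite (rcosets\<^bsub>G\<^esub> N)}"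

text \<open>The inverse limit of the finite quotients, inside their product. For \<open>N \<subseteq> M\<close> the transition
  map \<open>G Mod N \<rightarrow> G Mod M\<close> sends a coset \<open>C\<close> of \<open>N\<close> to the coset \<open>M C\<close> of \<open>M\<close>.\<close>

definition profinite_completion :: "('a, 'm) monoid_scheme \<Rightarrow> ('a set \<Rightarrow> 'a set) monoid" where
  "profinite_completion G =
     (product_group (finite_index_normal G) (\<lambda>N. G Mod N))
       \<lparr>carrier := {x \<in> \<Pi>\<^sub>E N\<in>finite_index_normal G. carrier (G Mod N).
          \<forall>N\<in>finite_index_normal G. \<forall>M\<in>finite_index_normal G.
            N \<subseteq> M \<longrightarrow> M <#>\<^bsub>G\<^esub> x N = x M}\<rparr>"

definition profinite_topology :: "('a, 'm) monoid_scheme \<Rightarrow> ('a set \<Rightarrow> 'a set) topology" where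
  "profinite_topology G =
     subtopology
       (product_topology (\<lambda>N. discrete_topology (carrier (G Mod N))) (finite_index_normal G))
       (carrier (profinite_completion G))"

text \<open>Isomorphism of profinite completions as profinite groups, i.e. by a group isomorphism that
  is also a homeomorphism.\<close>

definition profinite_completions_iso ::
    "('a, 'm) monoid_scheme \<Rightarrow> ('b, 'k) monoid_scheme \<Rightarrow> bool" where
  "profinite_completions_iso G H \<longleftrightarrow>
     (\<exists>\<phi> \<in> iso (profinite_completion G) (profinite_completion H).
        homeomorphic_map (profinite_topology G) (profinite_topology H) \<phi>)"

definition finitely_generated :: "('a, 'm) monoid_scheme \<Rightarrow> bool" where
  "finitely_generated G \<longleftrightarrow> (\<exists>S \<subseteq> carrier G. finite S \<and> generate G S = carrier G)"

definition residually_finite :: "('a, 'm) monoid_scheme \<Rightarrow> bool" where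
  "residually_finite G \<longleftrightarrow>
     (\<forall>g \<in> carrier G. g \<noteq> \<one>\<^bsub>G\<^esub> \<longrightarrow> (\<exists>N \<in> finite_index_normal G. g \<notin> N))"

text \<open>A definition cannot quantify over types, so the type of the elements of the competing groups
  \<open>\<Delta>\<close> is a parameter; a theorem with this parameter left as a free type variable ranges
  over the groups on every type.\<close>

definition profinitely_rigid :: "'d itself \<Rightarrow> ('a, 'm) monoid_scheme \<Rightarrow> bool" where
  "profinitely_rigid (_ :: 'd itself) \<Gamma> \<longleftrightarrow>
     group \<Gamma> \<and> finitely_generated \<Gamma> \<and> residually_finite \<Gamma> \<and>
     (\<forall>\<Delta> :: 'd monoid.
        group \<Delta> \<and> finitely_generated \<Delta> \<and> residually_finite \<Delta> \<and> profinite_completions_iso \<Gamma> \<Delta>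
          \<longrightarrow> \<Gamma> \<cong> \<Delta>)"

end

theory Submission
  imports Defs "HOL-Algebra.FiniteProduct" "HOL-Library.Poly_Mapping" "HOL-Number_Theory.Cong"
begin

text \<open>Let \<open>\<Gamma> = V \<rtimes> \<langle>t\<rangle>\<close> be the lamplighter group, so that \<open>V\<close> is a module over the Laurent polynomials
  \<open>F\<^sub>p[t, 1/t]\<close>, and let \<open>\<Delta>\<close> be a finitely generated residually finite group with the same
  profinite completion. Let \<open>A\<close> be the set of elements of \<open>\<Delta>\<close> that lie in the closure of \<open>V\<close>; it is an
  elementary abelian \<open>p\<close>-group by residual finiteness. The quotient \<open>\<Delta>/A\<close> embeds into the profinite
  integers, hence is finitely generated, torsion-free and abelian, and it has rank 1 because the
  quotients of \<open>\<Gamma>\<close> of exponent \<open>p + 1\<close> that are abelian are cyclic. So \<open>\<Delta> = A \<rtimes> \<int>\<close> with \<open>A\<close> a finitely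
  generated module over the Laurent polynomials. The module \<open>A\<close> is torsion-free: a torsion element
  would be centralized by a power of the generator of \<open>\<int>\<close>, and a computation in the quotients
  of \<open>\<Gamma>\<close> by \<open>(t^m - 1) V \<rtimes> \<langle>t^m\<rangle>\<close>, which are cofinal among the finite quotients, excludes this.
  As Laurent polynomials over a field are Euclidean, \<open>A\<close> is free of some rank \<open>r\<close>, so \<open>\<Delta>\<close> is the
  lamplighter group of rank \<open>r\<close>, and \<open>r\<close> is read off from the largest elementary abelian \<open>p\<close>-quotient.\<close>

section \<open>Modules over Euclidean rings, in multiplicative notation\<close>

text \<open>The obstacle is the torsion-freeness of \<open>A\<close>. At every finite level the
  image of \<open>V\<close> is finite, so all of its elements are torsion there, and no single level
  can exclude torsion. The proof therefore compares two levels: a relation modulo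
  \<open>t^(pM) - 1\<close> yields triviality modulo \<open>t^M - 1\<close>, the factor
  \<open>p\<close> being the price. Elements fixed by a power of the shift are the only case to
  exclude, because over a finite field the orbit of any torsion element is finite. The number
  \<open>p + 1\<close> is taken because it exceeds 1 and is coprime to \<open>p\<close>: in a
  quotient of that exponent the image of \<open>V\<close> vanishes. The isomorphism of completions
  enters only through multiplicative relations between the two groups, one for each finite quotient
  of \<Gamma>. Closures and limits thereby become statements about representatives at the cofinal
  levels \<open>K m\<close>. The scalars are Laurent polynomials with integer coefficients, measured
  only by the coefficients that \<open>p\<close> does not divide. One abstract Euclidean reduction
  then serves both for them and for the integers, the scalars of \<Delta>/A.\<close>

context group begin

lemma subgroup_nat_pow_closed:
  "subgroup H G \<Longrightarrow> x \<in> H \<Longrightarrow> x [^] (k::nat) \<in> H"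
  using subgroup_int_pow_closed[of H x "int k"] by (simp add: int_pow_int)

lemma finite_index_normalI:
  assumes f: "f \<in> hom G Q" and Q: "group Q" and fin: "finite (f ` carrier G)"
  shows "kernel G Q f \<in> finite_index_normal G"
proof -
  interpret h: group_hom G Q f using f Q by (simp add: group_hom_def group_hom_axioms_def is_group)
  let ?K = "kernel G Q f"
  have K: "?K \<lhd> G" by (rule h.normal_kernel)
  have "inj_on (\<lambda>X. the_elem (f ` X)) (carrier (G Mod ?K))" by (rule h.FactGroup_inj_on)
  moreover have "(\<lambda>X. the_elem (f ` X)) ` carrier (G Mod ?K) \<subseteq> f ` carrier G"
  proof clarify
    fix X assume "X \<in> carrier (G Mod ?K)"
    then obtain g where g: "g \<in> carrier G" "X = ?K #> g" by (auto simp: carrier_FactGroup)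
    have "f ` X = {f g}"
    proof
      show "f ` X \<subseteq> {f g}" using g by (auto simp: r_coset_def kernel_def)
      have "g \<in> X" using g K rcos_self normal_imp_subgroup by blast
      then show "{f g} \<subseteq> f ` X" by auto
    qed
    then show "the_elem (f ` X) \<in> f ` carrier G" using g by auto
  qed
  ultimately have "finite (carrier (G Mod ?K))" using fin by (meson finite_subset inj_on_finite)
  then show ?thesis using K by (simp add: finite_index_normal_def FactGroup_def)
qed

end

text \<open>By commutativity every element is a product of powers of the generators, and the
  exponents matter only modulo \<open>q\<close>, so there are at most as many elements as functions
  from \<open>F\<close> to residues. Finiteness yields finite quotients; the bound on the
  cardinality decides the rank at the end.\<close>

lemma (in comm_group) finite_generated_exponent:
  assumes F: "finite F" "F \<subseteq> carrier G" and gen: "generate G F = carrier G"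
    and q: "0 < q" and exp: "\<And>x. x \<in> carrier G \<Longrightarrow> x [^] (q::nat) = \<one>"
  shows "finite (carrier G) \<and> card (carrier G) \<le> q ^ card F"
proof -
  define e where "e c = (\<Otimes>x\<in>F. x [^] (c x :: int))" for c
  have powmod: "x [^] (k mod int q) = x [^] k" if "x \<in> carrier G" for x and k :: int
  proof -
    have "x [^] k = x [^] (int q * (k div int q) + k mod int q)" by simp
    also have "\<dots> = (x [^] int q) [^] (k div int q) \<otimes> x [^] (k mod int q)"
      using that by (metis int_pow_mult int_pow_pow)
    also have "x [^] int q = \<one>" using exp that by (simp add: int_pow_int)
    finally show ?thesis using that by simp
  qed
  have sub: "x \<in> e ` UNIV" if "x \<in> generate G F" for x
    using that
  proof induction
    case one
    have "\<one> = e (\<lambda>_. 0)" by (simp add: e_def)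
    then show ?case by (metis rangeI)
  next
    case (incl h)
    have "e (\<lambda>x. if h = x then 1 else 0) = (\<Otimes>x\<in>F. if h = x then x else \<one>)"
      unfolding e_def by (rule finprod_cong') (use F in auto)
    also have "\<dots> = h" using incl F by (intro finprod_singleton) auto
    finally show ?case by (metis rangeI)
  next
    case (inv h)
    have "e (\<lambda>x. if h = x then -1 else 0) = (\<Otimes>x\<in>F. if h = x then inv x else \<one>)"
      unfolding e_def by (rule finprod_cong') (use F in \<open>auto simp: int_pow_neg\<close>)
    also have "\<dots> = inv h" using inv F by (intro finprod_singleton[of h F "m_inv G"]) auto
    finally show ?case by (metis rangeI)
  next
    case (eng h1 h2)
    then obtain c d where "h1 = e c" "h2 = e d" by auto
    then have "h1 \<otimes> h2 = (\<Otimes>x\<in>F. x [^] c x \<otimes> x [^] d x)"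
      unfolding e_def using F by (subst finprod_multf) auto
    also have "\<dots> = e (\<lambda>x. c x + d x)"
      unfolding e_def by (rule finprod_cong') (use F in \<open>auto simp: int_pow_mult\<close>)
    finally show ?case by (metis rangeI)
  qed
  have "carrier G \<subseteq> e ` (F \<rightarrow>\<^sub>E {0..<int q})"
  proof
    fix x assume "x \<in> carrier G"
    then obtain c where c: "x = e c" using sub gen by blast
    also have "\<dots> = e (\<lambda>x\<in>F. c x mod int q)"
      unfolding e_def by (rule finprod_cong') (use F powmod in \<open>auto simp: subset_iff\<close>)
    finally show "x \<in> e ` (F \<rightarrow>\<^sub>E {0..<int q})" using q by force
  qed
  moreover have "finite (F \<rightarrow>\<^sub>E {0..<int q})" using F by (intro finite_PiE) auto
  moreover have "card (F \<rightarrow>\<^sub>E {0..<int q}) = q ^ card F"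
    using F by (simp add: card_PiE)
  ultimately show ?thesis
    by (metis card_image_le card_mono finite_imageI finite_subset le_trans)
qed

locale group_module = comm_group M for M (structure) +
  fixes smul :: "'r::comm_ring_1 \<Rightarrow> 'a \<Rightarrow> 'a"
  assumes smul_closed [simp, intro]: "x \<in> carrier M \<Longrightarrow> smul f x \<in> carrier M"
    and smul_mult: "x \<in> carrier M \<Longrightarrow> y \<in> carrier M \<Longrightarrow> smul f (x \<otimes> y) = smul f x \<otimes> smul f y"
    and smul_add: "x \<in> carrier M \<Longrightarrow> smul (f + g) x = smul f x \<otimes> smul g x"
    and smul_smul: "x \<in> carrier M \<Longrightarrow> smul (f * g) x = smul f (smul g x)"
    and smul_one [simp]: "x \<in> carrier M \<Longrightarrow> smul 1 x = x"
begin

lemma smul_0 [simp]: "x \<in> carrier M \<Longrightarrow> smul 0 x = \<one>"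
  using smul_add[of x 0 0] by (metis add.right_neutral r_cancel_one' smul_closed)

lemma smul_neutral [simp]: "smul f \<one> = \<one>"
  using smul_mult[of \<one> \<one> f] by (metis one_closed r_cancel_one' smul_closed l_one)

lemma smul_uminus: "x \<in> carrier M \<Longrightarrow> smul (- f) x = inv (smul f x)"
  using smul_add[of x "- f" f] by (metis add.left_inverse inv_equality smul_0 smul_closed)

lemma smul_inv: "x \<in> carrier M \<Longrightarrow> smul f (inv x) = inv (smul f x)"
  using smul_mult[of "inv x" x f] by (metis inv_closed inv_equality l_inv smul_closed smul_neutral)

lemma smul_diff: "x \<in> carrier M \<Longrightarrow> smul (f - g) x = smul f x \<otimes> inv (smul g x)"
  using smul_add[of x f "- g"] by (simp add: smul_uminus)

lemma smul_left_commute: "x \<in> carrier M \<Longrightarrow> smul f (smul g x) = smul g (smul f x)"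
  by (metis mult.commute smul_smul)

definition lincomb :: "'i set \<Rightarrow> ('i \<Rightarrow> 'r) \<Rightarrow> ('i \<Rightarrow> 'a) \<Rightarrow> 'a" where
  "lincomb I f x = (\<Otimes>i\<in>I. smul (f i) (x i))"

definition lin_span :: "'i set \<Rightarrow> ('i \<Rightarrow> 'a) \<Rightarrow> 'a set" where
  "lin_span I x = range (\<lambda>f. lincomb I f x)"

lemma lincomb_in_lin_span: "lincomb I f x \<in> lin_span I x"
  by (simp add: lin_span_def)

lemma lincomb_closed [simp, intro]:
  "x \<in> I \<rightarrow> carrier M \<Longrightarrow> lincomb I f x \<in> carrier M"
  unfolding lincomb_def by (intro finprod_closed) auto

lemma lincomb_cong:
  assumes "x \<in> I \<rightarrow> carrier M" "\<And>i. i \<in> I \<Longrightarrow> f i = g i" "\<And>i. i \<in> I \<Longrightarrow> x i = y i"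
  shows "lincomb I f x = lincomb I g y"
  unfolding lincomb_def by (intro finprod_cong') (use assms in \<open>auto simp: Pi_iff\<close>)

lemma lincomb_add:
  "x \<in> I \<rightarrow> carrier M \<Longrightarrow> lincomb I (\<lambda>i. f i + g i) x = lincomb I f x \<otimes> lincomb I g x"
  unfolding lincomb_def
  by (subst finprod_multf[symmetric], force, force, rule finprod_cong')
    (auto simp: smul_add Pi_iff)

lemma lincomb_zero [simp]: "x \<in> I \<rightarrow> carrier M \<Longrightarrow> lincomb I (\<lambda>_. 0) x = \<one>"
  unfolding lincomb_def by (intro finprod_one_eqI) (auto simp: Pi_iff)

lemma smul_finprod:
  assumes "x \<in> I \<rightarrow> carrier M"
  shows "smul g (\<Otimes>i\<in>I. x i) = (\<Otimes>i\<in>I. smul g (x i))"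
proof (cases "finite I")
  case True
  then show ?thesis using assms
  proof (induction I rule: finite_induct)
    case (insert i I)
    then have "x \<in> I \<rightarrow> carrier M" "x i \<in> carrier M" by auto
    with insert show ?case by (simp add: smul_mult Pi_iff)
  qed simp
qed simp

lemma lincomb_smul:
  "x \<in> I \<rightarrow> carrier M \<Longrightarrow> lincomb I (\<lambda>i. g * f i) x = smul g (lincomb I f x)"
  unfolding lincomb_def
  by (subst smul_finprod) (auto intro!: finprod_cong' simp: smul_smul Pi_iff)

lemma lincomb_uminus:
  "x \<in> I \<rightarrow> carrier M \<Longrightarrow> lincomb I (\<lambda>i. - f i) x = inv (lincomb I f x)"
  using lincomb_smul[of x I "-1" f] by (simp add: smul_uminus)

lemma lincomb_diff:
  "x \<in> I \<rightarrow> carrier M \<Longrightarrow> lincomb I (\<lambda>i. f i - g i) x = lincomb I f x \<otimes> inv (lincomb I g x)"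
  using lincomb_add[of x I f "\<lambda>i. - g i"] by (simp add: lincomb_uminus)

lemma lincomb_delta:
  assumes "x \<in> I \<rightarrow> carrier M" "finite I" "i \<in> I"
  shows "lincomb I (\<lambda>j. if i = j then 1 else 0) x = x i"
proof -
  have "lincomb I (\<lambda>j. if i = j then 1 else 0) x = (\<Otimes>j\<in>I. if i = j then x j else \<one>)"
    unfolding lincomb_def by (rule finprod_cong') (use assms in \<open>auto simp: Pi_iff\<close>)
  also have "\<dots> = x i" using assms by (intro finprod_singleton) auto
  finally show ?thesis .
qed

lemma lincomb_remove:
  assumes "x \<in> I \<rightarrow> carrier M" "finite I" "i \<in> I"
  shows "lincomb I f x = smul (f i) (x i) \<otimes> lincomb (I - {i}) f x"
proof -
  have "I = insert i (I - {i})" using assms by auto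
  then have "lincomb I f x = lincomb (insert i (I - {i})) f x" by simp
  also have "\<dots> = smul (f i) (x i) \<otimes> lincomb (I - {i}) f x"
    unfolding lincomb_def using assms by (intro finprod_insert) auto
  finally show ?thesis .
qed

lemma lin_span_closed: "x \<in> I \<rightarrow> carrier M \<Longrightarrow> lin_span I x \<subseteq> carrier M"
  by (auto simp: lin_span_def)

lemma lin_span_subgroup:
  assumes "x \<in> I \<rightarrow> carrier M"
  shows "subgroup (lin_span I x) M"
proof
  show "lin_span I x \<subseteq> carrier M" using assms by (rule lin_span_closed)
  show "\<one> \<in> lin_span I x" by (metis lincomb_zero[OF assms] lincomb_in_lin_span)
next
  fix a b assume "a \<in> lin_span I x" "b \<in> lin_span I x"
  then show "a \<otimes> b \<in> lin_span I x"
    by (auto simp: lin_span_def lincomb_add[OF assms, symmetric])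
next
  fix a assume "a \<in> lin_span I x"
  then show "inv a \<in> lin_span I x"
    by (auto simp: lin_span_def lincomb_uminus[OF assms, symmetric])
qed

lemma lin_span_smul:
  "x \<in> I \<rightarrow> carrier M \<Longrightarrow> a \<in> lin_span I x \<Longrightarrow> smul g a \<in> lin_span I x"
  by (auto simp: lin_span_def lincomb_smul[symmetric])

lemma lin_span_incl:
  "x \<in> I \<rightarrow> carrier M \<Longrightarrow> finite I \<Longrightarrow> i \<in> I \<Longrightarrow> x i \<in> lin_span I x"
  by (metis lincomb_delta lincomb_in_lin_span)

text \<open>An elementary operation on the family is undone by the opposite operation on the
  coefficients. This performs one division step of the Euclidean algorithm on the coefficients
  without changing the value of the combination.\<close>

lemma lincomb_transvection:
  assumes x: "x \<in> I \<rightarrow> carrier M" and I: "finite I" "i \<in> I" "j \<in> I" "i \<noteq> j"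
  shows "lincomb I f x = lincomb I (f(j := f j - q * f i)) (x(i := x i \<otimes> smul q (x j)))"
    (is "_ = lincomb I ?f ?x")
proof -
  let ?J = "I - {i} - {j}"
  have c: "x i \<in> carrier M" "x j \<in> carrier M" using x I by auto
  have x': "?x \<in> I \<rightarrow> carrier M" using x I by (auto simp: Pi_iff)
  have J: "lincomb ?J ?f ?x = lincomb ?J f x"
    by (rule lincomb_cong[symmetric]) (use x in auto)
  have Jc: "lincomb ?J f x \<in> carrier M" using x by auto
  have "lincomb I f x = smul (f i) (x i) \<otimes> (smul (f j) (x j) \<otimes> lincomb ?J f x)"
    using x I by (subst lincomb_remove[of _ _ i], simp_all) (subst lincomb_remove[of _ _ j], auto)
  moreover have "lincomb I ?f ?x = smul (f i) (x i \<otimes> smul q (x j)) \<otimes>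
      (smul (f j - q * f i) (x j) \<otimes> lincomb ?J f x)"
    using x x' I by (subst lincomb_remove[of _ _ i], simp_all)
      (subst lincomb_remove[of _ _ j], auto simp: J[simplified] Pi_iff)
  moreover have "smul (f j - q * f i) (x j) = smul (f j) (x j) \<otimes> inv (smul (f i) (smul q (x j)))"
    using c by (simp add: smul_diff smul_smul mult.commute[of q])
  moreover have "a \<otimes> b \<otimes> (d \<otimes> inv b \<otimes> e) = a \<otimes> (d \<otimes> e)"
    if "a \<in> carrier M" "b \<in> carrier M" "d \<in> carrier M" "e \<in> carrier M" for a b d e
  proof -
    have "a \<otimes> b \<otimes> (d \<otimes> inv b \<otimes> e) = a \<otimes> (d \<otimes> e) \<otimes> (b \<otimes> inv b)"
      using that by (simp add: m_ac)
    then show ?thesis using that by simp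
  qed
  ultimately show ?thesis using c Jc by (simp add: smul_mult)
qed

lemma lin_span_transvection:
  assumes x: "x \<in> I \<rightarrow> carrier M" and I: "finite I" "i \<in> I" "j \<in> I" "i \<noteq> j"
  shows "lin_span I (x(i := x i \<otimes> smul q (x j))) = lin_span I x"
proof -
  let ?x = "x(i := x i \<otimes> smul q (x j))"
  have "lincomb I f ?x \<in> lin_span I x" for f
  proof -
    let ?g = "f(j := f j + q * f i)"
    have "lincomb I ?g x = lincomb I (?g(j := ?g j - q * ?g i)) ?x"
      by (rule lincomb_transvection[OF assms])
    also have "?g(j := ?g j - q * ?g i) = f" using I by auto
    finally show ?thesis by (metis lincomb_in_lin_span)
  qed
  moreover have "lincomb I f x \<in> lin_span I ?x" for f
    unfolding lincomb_transvection[OF assms, of f q] by (rule lincomb_in_lin_span)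
  ultimately show ?thesis unfolding lin_span_def by blast
qed

end

text \<open>A scalar of size 0 need not be zero, it only has to act trivially; for integer Laurent
  polynomials these are the multiples of \<open>p\<close>. Division is asked for only as a single
  decrease of the larger scalar, which for Laurent polynomials is the cancellation of one leading
  term.\<close>

locale torsion_free_module = group_module M smul for M (structure) and smul :: "'r::comm_ring_1 \<Rightarrow> 'a \<Rightarrow> 'a" +
  fixes sz :: "'r \<Rightarrow> nat"
  assumes sz_0: "sz f = 0 \<Longrightarrow> x \<in> carrier M \<Longrightarrow> smul f x = \<one>"
    and sz_reduce: "0 < sz f \<Longrightarrow> sz f \<le> sz g \<Longrightarrow> \<exists>q. sz (g - q * f) < sz g"
    and torsion_free: "smul f x = \<one> \<Longrightarrow> x \<in> carrier M \<Longrightarrow> 0 < sz f \<Longrightarrow> x = \<one>"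
begin

text \<open>Scalars of size 0 act trivially, so a relation can force no more than size 0 on its
  coefficients.\<close>

definition independent :: "'i set \<Rightarrow> ('i \<Rightarrow> 'a) \<Rightarrow> bool" where
  "independent I x \<longleftrightarrow> (\<forall>f. lincomb I f x = \<one> \<longrightarrow> (\<forall>i\<in>I. sz (f i) = 0))"

text \<open>Euclidean reduction of a nontrivial relation by transvections of the family, until only one
  coefficient of the relation survives; then torsion-freeness kills a member of the family.\<close>

lemma relation_drops_generator:
  assumes "finite I" "x \<in> I \<rightarrow> carrier M" "lincomb I f x = \<one>" "i0 \<in> I" "0 < sz (f i0)"
  shows "\<exists>i\<in>I. \<exists>y \<in> I \<rightarrow> carrier M. lin_span (I - {i}) y = lin_span I x"
  using assms(2-)
proof (induction "\<Sum>i\<in>I. sz (f i)" arbitrary: f x i0 rule: less_induct)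
  case less
  show ?case
  proof (cases "\<exists>j\<in>I - {i0}. 0 < sz (f j)")
    case True
    then obtain j0 where j0: "j0 \<in> I" "j0 \<noteq> i0" "0 < sz (f j0)" by auto
    then obtain i j where ij: "i \<in> I" "j \<in> I" "i \<noteq> j" "0 < sz (f i)" "sz (f i) \<le> sz (f j)"
      using less.prems by (metis nat_le_linear)
    then obtain q where q: "sz (f j - q * f i) < sz (f j)" using sz_reduce by blast
    let ?f = "f(j := f j - q * f i)" and ?x = "x(i := x i \<otimes> smul q (x j))"
    have xc: "?x \<in> I \<rightarrow> carrier M"
      using less.prems(1) ij(1,2) by (auto simp: Pi_iff)
    have "(\<Sum>i\<in>I. sz (?f i)) < (\<Sum>i\<in>I. sz (f i))"
      by (rule sum_strict_mono_ex1) (use \<open>finite I\<close> q ij in auto)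
    moreover have "lincomb I ?f ?x = \<one>"
      using lincomb_transvection[of x I i j f q] less.prems ij \<open>finite I\<close> by auto
    moreover have "0 < sz (?f i)" using ij by simp
    ultimately have "\<exists>i\<in>I. \<exists>y \<in> I \<rightarrow> carrier M. lin_span (I - {i}) y = lin_span I ?x"
      using less.hyps[of ?f ?x i] xc ij by blast
    then show ?thesis
      using lin_span_transvection[of x I i j q] less.prems ij \<open>finite I\<close> by auto
  next
    case False
    have c: "x i0 \<in> carrier M" "x \<in> I \<rightarrow> carrier M" using less.prems by auto
    have "lincomb (I - {i0}) f x = \<one>" unfolding lincomb_def
      by (rule finprod_one_eqI) (use False c sz_0 in auto)
    then have "smul (f i0) (x i0) = \<one>"
      using lincomb_remove[of x I i0 f] less.prems c \<open>finite I\<close> by auto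
    then have "x i0 = \<one>" using torsion_free c less.prems by blast
    then have "lincomb I g x = lincomb (I - {i0}) g x" for g
      using lincomb_remove[of x I i0 g] lincomb_closed[of x "I - {i0}" g] less.prems c \<open>finite I\<close>
      by (auto simp: Pi_iff)
    then show ?thesis using less.prems by (auto simp: lin_span_def)
  qed
qed

text \<open>A dependent family can be replaced by one with fewer members and the same span; this
  stops at an independent family.\<close>

lemma exists_basis:
  assumes "finite I" "x \<in> I \<rightarrow> carrier M"
  obtains J y where "J \<subseteq> I" "y \<in> J \<rightarrow> carrier M" "lin_span J y = lin_span I x" "independent J y"
proof -
  have "\<exists>J y. J \<subseteq> I \<and> y \<in> J \<rightarrow> carrier M \<and> lin_span J y = lin_span I x \<and> independent J y"
    using assms
  proof (induction "card I" arbitrary: I x rule: less_induct)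
    case less
    show ?case
    proof (cases "independent I x")
      case False
      then obtain f i0 where f: "lincomb I f x = \<one>" "i0 \<in> I" "0 < sz (f i0)"
        unfolding independent_def by auto
      obtain i y where iy: "i \<in> I" "y \<in> I \<rightarrow> carrier M" "lin_span (I - {i}) y = lin_span I x"
        using relation_drops_generator[OF less.prems f] by blast
      moreover have "card (I - {i}) < card I" using less.prems iy by (meson card_Diff1_less)
      ultimately show ?thesis using less.hyps[of "I - {i}" y] less.prems
        by (metis Diff_subset Pi_anti_mono finite_Diff in_mono order_trans)
    qed (use less.prems in blast)
  qed
  then show thesis using that by blast
qed

end

section \<open>Laurent polynomials acting on an abelian group\<close>

lemma (in group) subgroup_comm_group:
  assumes "subgroup H G" "\<And>x y. x \<in> H \<Longrightarrow> y \<in> H \<Longrightarrow> x \<otimes> y = y \<otimes> x"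
  shows "comm_group (G\<lparr>carrier := H\<rparr>)"
  using assms by (intro group.group_comm_groupI subgroup.subgroup_is_group) (auto simp: is_group)

lemma (in comm_group) subgroup_finprod_closed:
  assumes "subgroup H G" "\<And>i. i \<in> I \<Longrightarrow> f i \<in> H"
  shows "(\<Otimes>i\<in>I. f i) \<in> H"
proof (cases "finite I")
  case True
  then show ?thesis using assms(2)
  proof (induction I rule: finite_induct)
    case (insert i I)
    then have "f \<in> I \<rightarrow> carrier G" "f i \<in> carrier G" using subgroup.subset[OF assms(1)] by blast+
    then show ?case using insert assms(1) by (simp add: subgroup.m_closed)
  qed (use assms(1) in \<open>simp add: subgroup.one_closed\<close>)
qed (use assms(1) in \<open>simp add: subgroup.one_closed\<close>)

locale laurent_action = comm_group M for M (structure) +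
  fixes \<tau> :: "int \<Rightarrow> 'a \<Rightarrow> 'a"
  assumes act_closed [simp, intro]: "x \<in> carrier M \<Longrightarrow> \<tau> k x \<in> carrier M"
    and act_mult: "x \<in> carrier M \<Longrightarrow> y \<in> carrier M \<Longrightarrow> \<tau> k (x \<otimes> y) = \<tau> k x \<otimes> \<tau> k y"
    and act_add: "x \<in> carrier M \<Longrightarrow> \<tau> (j + k) x = \<tau> j (\<tau> k x)"
    and act_0 [simp]: "x \<in> carrier M \<Longrightarrow> \<tau> 0 x = x"
begin

lemma act_group_hom: "group_hom M M (\<tau> k)"
  by (simp add: group_hom_def group_hom_axioms_def is_group hom_def act_mult Pi_iff)

lemma act_one [simp]: "\<tau> k \<one> = \<one>"
  using group_hom.hom_one[OF act_group_hom] .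

lemma act_commute: "x \<in> carrier M \<Longrightarrow> \<tau> j (\<tau> k x) = \<tau> k (\<tau> j x)"
  by (metis act_add add.commute)

lemma act_int_pow: "x \<in> carrier M \<Longrightarrow> \<tau> k (x [^] (c::int)) = \<tau> k x [^] c"
  using group_hom.hom_int_pow[OF act_group_hom] .

text \<open>Integer coefficients stand for their residues: once the group has exponent
  \<open>p\<close>, multiples of \<open>p\<close> act trivially.\<close>

definition laurent_smul :: "(int \<Rightarrow>\<^sub>0 int) \<Rightarrow> 'a \<Rightarrow> 'a" where
  "laurent_smul F x = (\<Otimes>k\<in>Poly_Mapping.keys F. \<tau> k x [^] Poly_Mapping.lookup F k)"

lemma laurent_smul_superset:
  assumes "finite K" "Poly_Mapping.keys F \<subseteq> K" "x \<in> carrier M"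
  shows "laurent_smul F x = (\<Otimes>k\<in>K. \<tau> k x [^] Poly_Mapping.lookup F k)"
  unfolding laurent_smul_def
  by (rule finprod_mono_neutral_cong_left) (use assms in \<open>auto simp: in_keys_iff\<close>)

lemma laurent_smul_closed: "x \<in> carrier M \<Longrightarrow> laurent_smul F x \<in> carrier M"
  unfolding laurent_smul_def by (intro finprod_closed) auto

lemma laurent_smul_add:
  assumes x: "x \<in> carrier M"
  shows "laurent_smul (F + G) x = laurent_smul F x \<otimes> laurent_smul G x"
proof -
  let ?K = "Poly_Mapping.keys F \<union> Poly_Mapping.keys G"
  have "laurent_smul (F + G) x = (\<Otimes>k\<in>?K. \<tau> k x [^] Poly_Mapping.lookup (F + G) k)"
    using x keys_add[of F G] by (intro laurent_smul_superset) auto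
  also have "\<dots> = (\<Otimes>k\<in>?K. \<tau> k x [^] Poly_Mapping.lookup F k \<otimes> \<tau> k x [^] Poly_Mapping.lookup G k)"
    by (rule finprod_cong') (use x in \<open>auto simp: lookup_add int_pow_mult\<close>)
  also have "\<dots> = (\<Otimes>k\<in>?K. \<tau> k x [^] Poly_Mapping.lookup F k) \<otimes> (\<Otimes>k\<in>?K. \<tau> k x [^] Poly_Mapping.lookup G k)"
    using x by (intro finprod_multf) auto
  finally show ?thesis using x by (simp add: laurent_smul_superset[of ?K])
qed

lemma laurent_smul_mult:
  assumes x: "x \<in> carrier M" "y \<in> carrier M"
  shows "laurent_smul F (x \<otimes> y) = laurent_smul F x \<otimes> laurent_smul F y"
proof -
  have "laurent_smul F (x \<otimes> y) = (\<Otimes>k\<in>Poly_Mapping.keys F. \<tau> k x [^] Poly_Mapping.lookup F k \<otimes> \<tau> k y [^] Poly_Mapping.lookup F k)"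
    unfolding laurent_smul_def
    by (rule finprod_cong') (use x in \<open>auto simp: act_mult int_pow_distrib\<close>)
  also have "\<dots> = laurent_smul F x \<otimes> laurent_smul F y"
    unfolding laurent_smul_def using x by (intro finprod_multf) auto
  finally show ?thesis .
qed

lemma laurent_smul_single:
  "x \<in> carrier M \<Longrightarrow> laurent_smul (Poly_Mapping.single k c) x = \<tau> k x [^] c"
  using laurent_smul_superset[of "{k}" "Poly_Mapping.single k c" x] by auto

lemma laurent_smul_single_mult:
  assumes x: "x \<in> carrier M"
  shows "laurent_smul (Poly_Mapping.single k c * G) x = \<tau> k (laurent_smul G x) [^] c"
proof (induction G rule: update_induct)
  case const
  then show ?case using x by (simp add: laurent_smul_def)
next
  case (update G j d)
  have e: "Poly_Mapping.update j d G = Poly_Mapping.single j d + G"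
    by (rule poly_mapping_eqI) (use update in \<open>auto simp: lookup_update lookup_add lookup_single in_keys_iff\<close>)
  have "laurent_smul (Poly_Mapping.single k c * Poly_Mapping.single j d) x = (\<tau> k (\<tau> j x [^] d)) [^] c"
    using x by (simp add: mult_single laurent_smul_single act_add act_int_pow int_pow_pow mult.commute
        act_commute[of x j k])
  then show ?case unfolding e
    using x update by (simp add: distrib_left laurent_smul_add laurent_smul_single laurent_smul_closed
        act_mult int_pow_distrib)
qed

lemma laurent_smul_smul:
  assumes x: "x \<in> carrier M"
  shows "laurent_smul (F * G) x = laurent_smul F (laurent_smul G x)"
proof (induction F rule: update_induct)
  case const
  then show ?case using x by (simp add: laurent_smul_def)
next
  case (update F j d)
  have e: "Poly_Mapping.update j d F = Poly_Mapping.single j d + F"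
    by (rule poly_mapping_eqI) (use update in \<open>auto simp: lookup_update lookup_add lookup_single in_keys_iff\<close>)
  then show ?case
    using x update by (simp add: distrib_right laurent_smul_add laurent_smul_single laurent_smul_closed
        laurent_smul_single_mult)
qed

sublocale group_module M laurent_smul
proof unfold_locales
  show "laurent_smul 1 x = x" if "x \<in> carrier M" for x
    using laurent_smul_single[of x 0 1] that by simp
qed (simp_all add: laurent_smul_closed laurent_smul_mult laurent_smul_add laurent_smul_smul)

end

text \<open>This is the degree modulo \<open>p\<close> up to monomial factors, raised by 1: a
  monomial with coefficient prime to \<open>p\<close> acts invertibly in exponent \<open>p\<close>
  and gets width 1, so that width 0 is left for the polynomials vanishing modulo
  \<open>p\<close>.\<close>

definition laurent_width :: "nat \<Rightarrow> (int \<Rightarrow>\<^sub>0 int) \<Rightarrow> nat" where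
  "laurent_width p F = (let T = {k. \<not> int p dvd Poly_Mapping.lookup F k} in
     if T = {} then 0 else nat (Max T - Min T) + 1)"

lemma finite_not_dvd_lookup: "finite {k. \<not> int p dvd Poly_Mapping.lookup F k}"
  by (rule finite_subset[of _ "Poly_Mapping.keys F"]) (auto simp: in_keys_iff)

lemma laurent_width_eq_0_iff: "laurent_width p F = 0 \<longleftrightarrow> (\<forall>k. int p dvd Poly_Mapping.lookup F k)"
  by (auto simp: laurent_width_def Let_def)

lemma laurent_width_pos_iff: "0 < laurent_width p F \<longleftrightarrow> {k. \<not> int p dvd Poly_Mapping.lookup F k} \<noteq> {}"
  using laurent_width_eq_0_iff[of p F] by auto

lemma laurent_width_le:
  assumes "\<And>k. \<not> int p dvd Poly_Mapping.lookup F k \<Longrightarrow> a \<le> k \<and> k < b"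
  shows "int (laurent_width p F) \<le> max 0 (b - a)"
proof (cases "{k. \<not> int p dvd Poly_Mapping.lookup F k} = {}")
  case False
  let ?T = "{k. \<not> int p dvd Poly_Mapping.lookup F k}"
  have "Max ?T \<in> ?T" "Min ?T \<in> ?T"
    using False by (intro Max_in Min_in finite_not_dvd_lookup; simp)+
  then have "Max ?T < b" "a \<le> Min ?T" "Min ?T \<le> Max ?T"
    using assms by (auto intro: Min_le finite_not_dvd_lookup)
  then show ?thesis using False by (auto simp: laurent_width_def Let_def)
qed (simp add: laurent_width_def)

lemma lookup_single_mult: "Poly_Mapping.lookup (Poly_Mapping.single d c * F) k = c * Poly_Mapping.lookup F (k - d)" for F :: "int \<Rightarrow>\<^sub>0 int"
proof (induction F rule: update_induct)
  case const
  then show ?case by simp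
next
  case (update F j e)
  have e: "Poly_Mapping.update j e F = Poly_Mapping.single j e + F"
    by (rule poly_mapping_eqI) (use update in \<open>auto simp: lookup_update lookup_add lookup_single in_keys_iff\<close>)
  show ?case unfolding e using update
    by (auto simp: distrib_left mult_single lookup_add lookup_single when_def)
qed

text \<open>One step of long division modulo \<open>p\<close>: a monomial multiple of
  \<open>f\<close> has its top exponent moved onto that of \<open>g\<close>, and an inverse modulo
  \<open>p\<close> of the leading coefficient cancels the top term. As \<open>f\<close> is no wider
  than \<open>g\<close>, nothing appears below the lowest exponent of \<open>g\<close>.\<close>

lemma laurent_width_reduce:
  assumes p: "Factorial_Ring.prime p" and f: "0 < laurent_width p f"
    and fg: "laurent_width p f \<le> laurent_width p g"
  shows "\<exists>q. laurent_width p (g - q * f) < laurent_width p g"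
proof -
  let ?T = "\<lambda>f. {k. \<not> int p dvd Poly_Mapping.lookup f k}"
  have ne: "?T f \<noteq> {}" "?T g \<noteq> {}" using f fg laurent_width_pos_iff[of p] by (metis order_less_le_trans)+
  note fin = finite_not_dvd_lookup[of p]
  define a b where "a = Max (?T f)" and "b = Max (?T g)"
  have ab: "a \<in> ?T f" "b \<in> ?T g" unfolding a_def b_def using Max_in[OF fin ne(1)] Max_in[OF fin ne(2)] by auto
  have "coprime (Poly_Mapping.lookup f a) (int p)"
    using ab p by (metis coprime_commute mem_Collect_eq prime_imp_coprime prime_int_nat_transfer nat_int prime_nat_int_transfer)
  then obtain u where u: "[Poly_Mapping.lookup f a * u = 1] (mod int p)" using cong_solve_coprime_int by blast
  define q where "q = Poly_Mapping.single (b - a) (Poly_Mapping.lookup g b * u)"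
  have lk: "Poly_Mapping.lookup (g - q * f) k = Poly_Mapping.lookup g k - Poly_Mapping.lookup g b * u * Poly_Mapping.lookup f (k - (b - a))" for k
    by (simp add: lookup_minus q_def lookup_single_mult)
  have wf: "int (laurent_width p f) = a - Min (?T f) + 1"
    using ne fin Min_le_iff[of "?T f"] ab by (auto simp: laurent_width_def Let_def a_def intro!: Min_le)
  have wg: "int (laurent_width p g) = b - Min (?T g) + 1"
    using ne fin Min_le_iff[of "?T g"] ab by (auto simp: laurent_width_def Let_def b_def intro!: Min_le)
  have "Min (?T g) \<le> k \<and> k < b" if k: "\<not> int p dvd Poly_Mapping.lookup (g - q * f) k" for k
  proof -
    have or: "\<not> int p dvd Poly_Mapping.lookup g k \<or> \<not> int p dvd Poly_Mapping.lookup f (k - (b - a))"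
      using k unfolding lk by auto
    have g: "Min (?T g) \<le> k" "k \<le> b" if "\<not> int p dvd Poly_Mapping.lookup g k"
      using that fin by (auto simp: b_def intro: Min_le Max_ge)
    have f: "Min (?T f) \<le> k - (b - a)" "k - (b - a) \<le> a" if "\<not> int p dvd Poly_Mapping.lookup f (k - (b - a))"
      using Min_le[OF fin, of "k - (b - a)" f] Max_ge[OF fin, of "k - (b - a)" f] that
      by (simp_all add: a_def)
    have "k \<noteq> b"
    proof
      assume "k = b"
      then have "Poly_Mapping.lookup (g - q * f) k = Poly_Mapping.lookup g b * (1 - Poly_Mapping.lookup f a * u)"
        unfolding lk by (simp add: algebra_simps)
      moreover have "int p dvd 1 - Poly_Mapping.lookup f a * u"
        using u by (simp add: cong_iff_dvd_diff dvd_diff_commute)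
      ultimately show False using k by simp
    qed
    then show ?thesis using or f g wf wg fg by linarith
  qed
  then have "int (laurent_width p (g - q * f)) \<le> max 0 (b - Min (?T g))"
    by (rule laurent_width_le)
  moreover have "Min (?T g) \<le> b" using ab fin by (auto intro: Min_le)
  ultimately show ?thesis using wg by (intro exI[of _ q]) linarith
qed

text \<open>Torsion-freeness is required only against the polynomials \<open>t^m - 1\<close>, the
  form in which it is verified both for the lamplighter group and for its competitor. The general
  case follows below.\<close>

locale aperiodic_laurent_action = laurent_action +
  fixes p :: nat
  assumes p: "Factorial_Ring.prime p"
    and exponent: "x \<in> carrier M \<Longrightarrow> x [^] p = \<one>"
    and aperiodic: "x \<in> carrier M \<Longrightarrow> 0 < m \<Longrightarrow> \<tau> m x = x \<Longrightarrow> x = \<one>"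
begin

lemma int_pow_dvd: "x \<in> carrier M \<Longrightarrow> int p dvd c \<Longrightarrow> x [^] c = \<one>"
  by (elim dvdE) (simp add: int_pow_pow[symmetric] int_pow_int exponent)

lemma laurent_smul_width_0: "laurent_width p F = 0 \<Longrightarrow> x \<in> carrier M \<Longrightarrow> laurent_smul F x = \<one>"
  unfolding laurent_smul_def laurent_width_eq_0_iff by (intro finprod_one_eqI) (simp add: int_pow_dvd)

text \<open>A relation makes the forward orbit of \<open>x\<close> stay in a finite subgroup, hence periodic.\<close>

lemma laurent_torsion_free:
  assumes F: "laurent_smul F x = \<one>" "0 < laurent_width p F" and x: "x \<in> carrier M"
  shows "x = \<one>"
proof -
  let ?T = "{k. \<not> int p dvd Poly_Mapping.lookup F k}"
  have T: "finite ?T" "?T \<noteq> {}"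
    using F finite_not_dvd_lookup laurent_width_pos_iff by blast+
  define l d where "l = Min ?T" and "d = Max ?T"
  have dT: "d \<in> ?T" "l \<le> d" unfolding l_def d_def using T Max_in[OF T] by auto
  let ?S = "(\<lambda>j. \<tau> j x) ` {l..<d}"
  define U where "U = generate M ?S"
  have Sc: "?S \<subseteq> carrier M" using x by auto
  have U: "subgroup U M" unfolding U_def by (rule generate_is_subgroup[OF Sc])
  interpret U: subgroup U M by (rule U)
  have gen: "\<tau> j x \<in> U" if "l \<le> j" "j < d" for j
    unfolding U_def using that by (intro generate.incl) auto
  have "laurent_smul F x = (\<Otimes>k\<in>?T. \<tau> k x [^] Poly_Mapping.lookup F k)"
    unfolding laurent_smul_def
    by (rule finprod_mono_neutral_cong_right) (use x in \<open>auto simp: in_keys_iff int_pow_dvd\<close>)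
  also have "\<dots> = (\<Otimes>k\<in>insert d (?T - {d}). \<tau> k x [^] Poly_Mapping.lookup F k)"
    using dT by (simp add: insert_absorb)
  also have "\<dots> = \<tau> d x [^] Poly_Mapping.lookup F d \<otimes> (\<Otimes>k\<in>?T - {d}. \<tau> k x [^] Poly_Mapping.lookup F k)" (is "_ = ?a \<otimes> ?b")
    by (rule finprod_insert) (use T x in auto)
  finally have ab: "?a \<otimes> ?b = \<one>" using F by simp
  have "?T - {d} \<subseteq> {l..<d}"
  proof
    fix k assume "k \<in> ?T - {d}"
    then have "l \<le> k" "k \<le> d" "k \<noteq> d" using T unfolding l_def d_def by auto
    then show "k \<in> {l..<d}" by simp
  qed
  then have "?b \<in> U"
    by (intro subgroup_finprod_closed[OF U] subgroup_int_pow_closed[OF U] gen) auto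
  moreover have "?a = inv ?b" using ab x by (intro inv_equality[symmetric]) auto
  ultimately have aU: "?a \<in> U" by simp
  \<comment> \<open>The relation only shows that a power of \<open>\<tau> d x\<close> lies in
    \<open>U\<close>. Its exponent is invertible modulo \<open>p\<close>, so a further power
    recovers \<open>\<tau> d x\<close> itself.\<close>
  have "coprime (Poly_Mapping.lookup F d) (int p)"
    using dT p by (metis coprime_commute mem_Collect_eq prime_imp_coprime prime_nat_int_transfer)
  then obtain u where u: "[Poly_Mapping.lookup F d * u = 1] (mod int p)" using cong_solve_coprime_int by blast
  then obtain w where w: "Poly_Mapping.lookup F d * u = 1 + int p * w"
    by (metis cong_iff_lin cong_sym)
  have "?a [^] u = \<tau> d x [^] (1 + int p * w)" using x by (simp add: int_pow_pow w)
  also have "\<dots> = \<tau> d x" using x by (subst int_pow_mult) (auto simp: int_pow_dvd)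
  finally have tU: "\<tau> d x \<in> U" using subgroup_int_pow_closed[OF U aU] by metis
  \<comment> \<open>The shift sends each generator of \<open>U\<close> to the next one; only the
    last leaves the list, and it goes to \<open>\<tau> d x\<close>, which has just been placed in
    \<open>U\<close>.\<close>
  have step: "\<tau> 1 y \<in> U" if "y \<in> U" for y
  proof -
    interpret h: group_hom M M "\<tau> 1" by (rule act_group_hom)
    have "\<tau> 1 ` U = generate M (\<tau> 1 ` ?S)" unfolding U_def by (rule h.generate_img[OF Sc, symmetric])
    also have "\<dots> \<subseteq> U"
    proof (rule generate_subgroup_incl[OF _ U])
      show "\<tau> 1 ` ?S \<subseteq> U"
      proof clarify
        fix j assume j: "j \<in> {l..<d}"
        have "\<tau> 1 (\<tau> j x) = \<tau> (1 + j) x" using x by (simp add: act_add)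
        then show "\<tau> 1 (\<tau> j x) \<in> U" using gen[of "1 + j"] tU j
          by (cases "1 + j = d") auto
      qed
    qed
    finally show ?thesis using that by blast
  qed
  have orb: "\<tau> (d + int n) x \<in> U" for n
  proof (induction n)
    case (Suc n)
    have "\<tau> (d + int (Suc n)) x = \<tau> 1 (\<tau> (d + int n) x)"
      using x by (subst act_add[symmetric]) (auto simp: algebra_simps)
    then show ?case using step Suc by simp
  qed (use tU in simp)
  interpret UG: comm_group "M\<lparr>carrier := U\<rparr>"
    by (rule subgroup_comm_group[OF U]) (simp add: m_comm)
  have SU: "?S \<subseteq> U" using gen by auto
  have "finite (carrier (M\<lparr>carrier := U\<rparr>))"
  proof (rule conjunct1[OF UG.finite_generated_exponent[of ?S p]])
    show "generate (M\<lparr>carrier := U\<rparr>) ?S = carrier (M\<lparr>carrier := U\<rparr>)"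
      using generate_consistent[OF SU U] U_def by simp
    show "y [^]\<^bsub>M\<lparr>carrier := U\<rparr>\<^esub> p = \<one>\<^bsub>M\<lparr>carrier := U\<rparr>\<^esub>" if "y \<in> carrier (M\<lparr>carrier := U\<rparr>)" for y
      using that exponent U.mem_carrier by (simp add: nat_pow_consistent[symmetric])
  qed (use gen p prime_gt_0_nat in auto)
  then have "finite ((\<lambda>n. \<tau> (d + int n) x) ` UNIV)"
    using orb by (auto intro: finite_subset[of _ U])
  then have "\<not> inj (\<lambda>n. \<tau> (d + int n) x)" using finite_imageD by blast
  then obtain i j where ij: "i < j" "\<tau> (d + int i) x = \<tau> (d + int j) x"
    unfolding inj_on_def by (metis linorder_neqE_nat)
  have "\<tau> (int j - int i) x = \<tau> (- d - int i) (\<tau> (d + int j) x)"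
    using x by (simp add: act_add[symmetric])
  also have "\<dots> = \<tau> (- d - int i) (\<tau> (d + int i) x)" using ij by simp
  also have "\<dots> = x" using x by (simp add: act_add[symmetric])
  finally show ?thesis using aperiodic[OF x, of "int j - int i"] ij by simp
qed

sublocale torsion_free_module M laurent_smul "laurent_width p"
  by unfold_locales (use laurent_smul_width_0 laurent_width_reduce[OF p] laurent_torsion_free in auto)

end

section \<open>Groups resembling a lamplighter group\<close>

lemma (in group) l_inv_cancel [simp]:
  "x \<in> carrier G \<Longrightarrow> y \<in> carrier G \<Longrightarrow> inv x \<otimes> (x \<otimes> y) = y"
  by (simp add: m_assoc[symmetric])

lemma (in group) r_inv_cancel [simp]:
  "x \<in> carrier G \<Longrightarrow> y \<in> carrier G \<Longrightarrow> x \<otimes> (inv x \<otimes> y) = y"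
  by (simp add: m_assoc[symmetric])

text \<open>These properties hold for the lamplighter group and will be established for the
  competing group. Conversely \<open>iso_lamplighter\<close> shows that they force the group to be a
  lamplighter group of some rank.\<close>

locale lamplighter_like = group G for G (structure) +
  fixes p :: nat and V :: "'a set" and s :: 'a
  assumes p: "Factorial_Ring.prime p"
    and V_normal: "V \<lhd> G"
    and V_comm: "v \<in> V \<Longrightarrow> w \<in> V \<Longrightarrow> v \<otimes> w = w \<otimes> v"
    and V_exponent: "v \<in> V \<Longrightarrow> v [^] p = \<one>"
    and s_closed [simp, intro]: "s \<in> carrier G"
    and decompose: "g \<in> carrier G \<Longrightarrow> \<exists>v\<in>V. \<exists>k::int. g = v \<otimes> s [^] k"
    and s_pow_in_V: "s [^] (k::int) \<in> V \<Longrightarrow> k = 0"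
    and V_aperiodic: "v \<in> V \<Longrightarrow> 0 < m \<Longrightarrow> s [^] (m::int) \<otimes> v = v \<otimes> s [^] m \<Longrightarrow> v = \<one>"
    and fin_gen: "finitely_generated G"
begin

definition act :: "int \<Rightarrow> 'a \<Rightarrow> 'a" where
  "act k v = s [^] k \<otimes> v \<otimes> inv (s [^] k)"

lemma V_subgroup: "subgroup V G"
  using V_normal by (rule normal_imp_subgroup)

lemma V_closed [simp, intro]: "v \<in> V \<Longrightarrow> v \<in> carrier G"
  by (rule subgroup.mem_carrier[OF V_subgroup])

lemma act_in_V: "v \<in> V \<Longrightarrow> act k v \<in> V"
  unfolding act_def using normal.inv_op_closed2[OF V_normal, of "s [^] k" v] by auto

lemma act_carrier [simp]: "v \<in> carrier G \<Longrightarrow> act k v \<in> carrier G"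
  by (simp add: act_def)

lemma act_mult_carrier:
  assumes "v \<in> carrier G" "w \<in> carrier G"
  shows "act k (v \<otimes> w) = act k v \<otimes> act k w"
  unfolding act_def using assms by (simp add: m_assoc)

lemma act_one [simp]: "act k \<one> = \<one>"
  by (simp add: act_def)

lemma act_add_carrier: "v \<in> carrier G \<Longrightarrow> act (j + k) v = act j (act k v)"
  by (simp add: act_def int_pow_mult inv_mult_group m_assoc)

sublocale M: comm_group "G\<lparr>carrier := V\<rparr>"
  by (rule subgroup_comm_group) (use V_subgroup V_comm in auto)

lemma M_nat_pow [simp]: "v [^]\<^bsub>G\<lparr>carrier := V\<rparr>\<^esub> (k::nat) = v [^] k"
  using nat_pow_consistent by metis

lemma M_int_pow [simp]: "v \<in> V \<Longrightarrow> v [^]\<^bsub>G\<lparr>carrier := V\<rparr>\<^esub> (k::int) = v [^] k"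
  using int_pow_consistent[OF V_subgroup] by metis

lemma M_inv [simp]: "v \<in> V \<Longrightarrow> inv\<^bsub>G\<lparr>carrier := V\<rparr>\<^esub> v = inv v"
  using m_inv_consistent[OF V_subgroup] by metis

lemma V_inv [simp, intro]: "v \<in> V \<Longrightarrow> inv v \<in> V"
  using subgroup.m_inv_closed[OF V_subgroup] .

lemma V_mult [simp, intro]: "v \<in> V \<Longrightarrow> w \<in> V \<Longrightarrow> v \<otimes> w \<in> V"
  using subgroup.m_closed[OF V_subgroup] .

lemma V_one [simp, intro]: "\<one> \<in> V"
  using subgroup.one_closed[OF V_subgroup] .

lemma act_eq_self_iff: "v \<in> carrier G \<Longrightarrow> act k v = v \<longleftrightarrow> s [^] k \<otimes> v = v \<otimes> s [^] k"
  unfolding act_def by (metis int_pow_closed inv_solve_right' m_closed s_closed)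

sublocale M: aperiodic_laurent_action "G\<lparr>carrier := V\<rparr>" act p
proof unfold_locales
  show "act 0 x = x" if "x \<in> carrier (G\<lparr>carrier := V\<rparr>)" for x
    using that by (simp add: act_def)
  show "x = \<one>\<^bsub>G\<lparr>carrier := V\<rparr>\<^esub>"
    if "x \<in> carrier (G\<lparr>carrier := V\<rparr>)" "0 < m" "act m x = x" for x m
    using that V_aperiodic[of x m] by (simp add: act_eq_self_iff)
qed (use p V_exponent in \<open>auto simp: act_in_V act_mult_carrier act_add_carrier\<close>)

abbreviation "smul \<equiv> M.laurent_smul"

lemma smul_in_V [simp, intro]: "v \<in> V \<Longrightarrow> smul f v \<in> V"
  using M.smul_closed by simp

lemma twisted_mult:
  assumes "v \<in> carrier G" "w \<in> carrier G"
  shows "(v \<otimes> s [^] (j::int)) \<otimes> (w \<otimes> s [^] (k::int)) = (v \<otimes> act j w) \<otimes> s [^] (j + k)"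
  using assms by (simp add: act_def int_pow_mult m_assoc)

lemma twisted_inv:
  assumes "v \<in> carrier G"
  shows "inv (v \<otimes> s [^] (j::int)) = act (- j) (inv v) \<otimes> s [^] (- j)"
proof (rule inv_equality)
  show "act (- j) (inv v) \<otimes> s [^] (- j) \<otimes> (v \<otimes> s [^] j) = \<one>"
    using assms by (subst twisted_mult) (auto simp: act_mult_carrier[symmetric])
qed (use assms in auto)

lemma decompose_unique:
  assumes "v \<in> V" "w \<in> V" "v \<otimes> s [^] (j::int) = w \<otimes> s [^] (k::int)"
  shows "v = w \<and> j = k"
proof -
  have "s [^] (j - k) = inv v \<otimes> (v \<otimes> s [^] j) \<otimes> inv (s [^] k)"
    using assms(1) by (simp add: int_pow_diff m_assoc[symmetric])
  also have "\<dots> = inv v \<otimes> w \<otimes> (s [^] k \<otimes> inv (s [^] k))"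
    unfolding assms(3) using assms(1,2) by (simp add: m_assoc)
  also have "\<dots> \<in> V" using assms by simp
  finally have "j = k" using s_pow_in_V by fastforce
  then show ?thesis using assms by simp
qed

text \<open>Closure under products holds because \<open>s\<close> acts on \<open>W\<close>. It is
  applied with \<open>m = 1\<close> to the span of the generators, and with general \<open>m\<close>
  to obtain the subgroups \<open>K m\<close>.\<close>

lemma twisted_subgroup:
  assumes W: "subgroup W (G\<lparr>carrier := V\<rparr>)" "\<And>k w. w \<in> W \<Longrightarrow> act k w \<in> W"
  shows "subgroup {w \<otimes> s [^] (m * k :: int) |w k. w \<in> W} G" (is "subgroup ?K G")
proof
  have WV: "W \<subseteq> V" using subgroup.subset[OF W(1)] by simp
  show "?K \<subseteq> carrier G" using WV by (auto simp: subset_iff)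
  have "\<one> = \<one> \<otimes> s [^] (m * 0)" by simp
  moreover have "\<one> \<in> W" using subgroup.one_closed[OF W(1)] by simp
  ultimately show "\<one> \<in> ?K" by blast
  show "x \<otimes> y \<in> ?K" if xy: "x \<in> ?K" "y \<in> ?K" for x y
  proof -
    obtain w k w' k' where *: "x = w \<otimes> s [^] (m * k)" "w \<in> W" "y = w' \<otimes> s [^] (m * k')" "w' \<in> W"
      using xy by blast
    have "x \<otimes> y = (w \<otimes> act (m * k) w') \<otimes> s [^] (m * (k + k'))"
      using * WV by (simp add: subset_iff twisted_mult distrib_left)
    moreover have "w \<otimes> act (m * k) w' \<in> W" using subgroup.m_closed[OF W(1)] W(2) * by simp
    ultimately show ?thesis by blast
  qed
  show "inv x \<in> ?K" if x: "x \<in> ?K" for x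
  proof -
    obtain w k where *: "x = w \<otimes> s [^] (m * k)" "w \<in> W" using x by blast
    have "inv x = act (- (m * k)) (inv w) \<otimes> s [^] (m * (- k))"
      using * WV by (simp add: subset_iff twisted_inv)
    moreover have "inv w \<in> W" using subgroup.m_inv_closed[OF W(1)] * WV by (metis M_inv subsetD)
    ultimately show ?thesis using W(2) by blast
  qed
qed

lemma act_conv_smul: "v \<in> V \<Longrightarrow> act k v = smul (Poly_Mapping.single k 1) v"
  by (simp add: M.laurent_smul_single act_in_V)

text \<open>Write each generator of the group as an element of \<open>V\<close> times a power of
  \<open>s\<close>. The module spanned by these elements of \<open>V\<close>, together with the
  powers of \<open>s\<close>, is a subgroup containing all generators; uniqueness of the
  decomposition then makes the module all of \<open>V\<close>.\<close>

lemma module_generators: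
  obtains I :: "'a set" and x where "finite I" "x \<in> I \<rightarrow> V" "M.lin_span I x = V"
proof -
  obtain S where S: "S \<subseteq> carrier G" "finite S" "generate G S = carrier G"
    using fin_gen unfolding finitely_generated_def by blast
  then have "\<forall>g\<in>S. \<exists>v k. v \<in> V \<and> g = v \<otimes> s [^] (k::int)" using decompose by blast
  then obtain x k where x: "\<And>g. g \<in> S \<Longrightarrow> x g \<in> V" "\<And>g. g \<in> S \<Longrightarrow> g = x g \<otimes> s [^] (k g :: int)"
    by metis
  let ?W = "M.lin_span S x"
  have xV: "x \<in> S \<rightarrow> carrier (G\<lparr>carrier := V\<rparr>)" using x by simp
  have W: "subgroup ?W (G\<lparr>carrier := V\<rparr>)" using xV by (rule M.lin_span_subgroup)
  have WV: "?W \<subseteq> V" using subgroup.subset[OF W] by simp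
  let ?T = "{w \<otimes> s [^] (1 * k :: int) |w k. w \<in> ?W}"
  have "subgroup ?T G"
  proof (rule twisted_subgroup[OF W])
    fix k w assume w: "w \<in> ?W"
    show "act k w \<in> ?W"
      unfolding act_conv_smul[OF subsetD[OF WV w]] using xV w by (rule M.lin_span_smul)
  qed
  moreover have "S \<subseteq> ?T"
  proof
    fix g assume g: "g \<in> S"
    then have "x g \<in> ?W" using M.lin_span_incl[OF xV S(2)] by blast
    moreover have "g = x g \<otimes> s [^] (1 * k g)" using x g by simp
    ultimately show "g \<in> ?T" by blast
  qed
  ultimately have T: "carrier G \<subseteq> ?T" using generate_subgroup_incl[of S ?T] S(3) by simp
  have "V \<subseteq> ?W"
  proof
    fix v assume v: "v \<in> V"
    then obtain w k where wk: "v = w \<otimes> s [^] (1 * k :: int)" "w \<in> ?W" using T by blast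
    then have "v \<otimes> s [^] (0::int) = w \<otimes> s [^] k" using v by simp
    then show "v \<in> ?W" using decompose_unique[OF v subsetD[OF WV wk(2)], of 0 k] wk(2) by blast
  qed
  then show thesis using that[of S x] S x WV by blast
qed

text \<open>The basis is reindexed by an initial segment of the natural numbers, to match the
  coordinates of a lamplighter group.\<close>

lemma module_basis:
  obtains r :: nat and y where "y \<in> {..<r} \<rightarrow> V" "M.lin_span {..<r} y = V" "M.independent {..<r} y"
proof -
  obtain I :: "'a set" and x where I: "finite I" "x \<in> I \<rightarrow> V" "M.lin_span I x = V"
    by (rule module_generators)
  obtain J y where J: "J \<subseteq> I" "y \<in> J \<rightarrow> V" "M.lin_span J y = V" "M.independent J y"
    by (rule M.exists_basis[of I x]) (use I in auto)
  then have "finite J" using I finite_subset by blast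
  then obtain b where b: "bij_betw b {..<card J} J" using ex_bij_betw_nat_finite lessThan_atLeast0 by metis
  have inj: "inj_on b {..<card J}" and img: "b ` {..<card J} = J" using b by (auto simp: bij_betw_def)
  have reindex: "M.lincomb J f y = M.lincomb {..<card J} (f \<circ> b) (y \<circ> b)" for f
    unfolding M.lincomb_def
    using M.finprod_reindex[of "\<lambda>i. smul (f i) (y i)" b "{..<card J}"] J inj img by (auto simp: Pi_iff)
  have reindex': "M.lincomb {..<card J} g (y \<circ> b) = M.lincomb J (g \<circ> inv_into {..<card J} b) y" for g
    unfolding reindex using J img inj by (intro M.lincomb_cong) (auto simp: Pi_iff)
  have "M.lin_span {..<card J} (y \<circ> b) = M.lin_span J y"
  proof
    show "M.lin_span {..<card J} (y \<circ> b) \<subseteq> M.lin_span J y"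
      unfolding M.lin_span_def[of "{..<card J}"] reindex' by (auto intro: M.lincomb_in_lin_span)
    show "M.lin_span J y \<subseteq> M.lin_span {..<card J} (y \<circ> b)"
      unfolding M.lin_span_def[of J] reindex by (auto intro: M.lincomb_in_lin_span)
  qed
  moreover have "M.independent {..<card J} (y \<circ> b)"
    unfolding M.independent_def
  proof (intro allI impI ballI)
    fix g i assume g: "M.lincomb {..<card J} g (y \<circ> b) = \<one>\<^bsub>G\<lparr>carrier := V\<rparr>\<^esub>" and i: "i \<in> {..<card J}"
    then have "laurent_width p ((g \<circ> inv_into {..<card J} b) (b i)) = 0"
      using J(4) img unfolding reindex' M.independent_def by blast
    then show "laurent_width p (g i) = 0" using i inj by simp
  qed
  moreover have "y \<circ> b \<in> {..<card J} \<rightarrow> V" using J img by (auto simp: Pi_iff)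
  ultimately show thesis using that[of "y \<circ> b" "card J"] J by simp
qed

section \<open>The normal subgroups \<open>K m\<close> and their cofinality\<close>

abbreviation sh :: "int \<Rightarrow> int \<Rightarrow>\<^sub>0 int" where
  "sh m \<equiv> Poly_Mapping.single m 1 - 1"

definition W :: "int \<Rightarrow> 'a set" where
  "W m = smul (sh m) ` V"

text \<open>This is the normal closure of \<open>s^m\<close>: the commutators of \<open>s^m\<close>
  with \<open>V\<close> are exactly the elements of \<open>W m\<close>.\<close>

definition K :: "int \<Rightarrow> 'a set" where
  "K m = {w \<otimes> s [^] (m * k) |w k. w \<in> W m}"

lemma W_subset: "W m \<subseteq> V" by (auto simp: W_def)

lemma W_subgroup: "subgroup (W m) (G\<lparr>carrier := V\<rparr>)"
proof -
  interpret h: group_hom "G\<lparr>carrier := V\<rparr>" "G\<lparr>carrier := V\<rparr>" "smul (sh m)"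
    by (simp add: group_hom_def group_hom_axioms_def M.is_group hom_def M.smul_mult[simplified] Pi_iff)
  show ?thesis unfolding W_def using h.img_is_subgroup by simp
qed

lemma W_smul: "w \<in> W m \<Longrightarrow> smul f w \<in> W m"
  unfolding W_def using M.smul_left_commute by (auto intro!: image_eqI[of _ _ "smul f _"])

lemma W_dvdI: "sh m dvd f \<Longrightarrow> v \<in> V \<Longrightarrow> smul f v \<in> W m"
  unfolding W_def by (elim dvdE) (simp add: M.laurent_smul_smul)

end

lemma single_power: "Poly_Mapping.single (m::int) (1::int) ^ k = Poly_Mapping.single (int k * m) 1"
  by (induction k) (auto simp: mult_single algebra_simps)

text \<open>For a nonnegative quotient \<open>k / m\<close> this is the geometric factorization; a
  negative one is reduced to it by the unit \<open>t^k\<close>.\<close>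

lemma single_minus_one_dvd:
  assumes "m dvd k"
  shows "Poly_Mapping.single m (1::int) - 1 dvd Poly_Mapping.single (k::int) 1 - 1"
proof -
  have nat: "Poly_Mapping.single m (1::int) - 1 dvd Poly_Mapping.single (int j * m) 1 - 1" for j
    unfolding single_power[symmetric] by (metis dvd_triv_left power_diff_1_eq)
  obtain c where c: "k = m * c" using assms by blast
  show ?thesis
  proof (cases "0 \<le> c")
    case True
    then show ?thesis using nat[of "nat c"] c by (simp add: mult.commute)
  next
    case False
    have "Poly_Mapping.single k (1::int) * (Poly_Mapping.single (- k) 1 - 1) = - (Poly_Mapping.single k 1 - 1)"
      by (simp add: right_diff_distrib mult_single)
    moreover have "Poly_Mapping.single m (1::int) - 1 dvd Poly_Mapping.single (- k) 1 - 1"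
      using nat[of "nat (- c)"] c False by (simp add: mult.commute)
    ultimately show ?thesis by (metis dvd_minus_iff dvd_mult)
  qed
qed

lemma (in group_hom) subgroup_vimage:
  "subgroup U H \<Longrightarrow> subgroup {x \<in> carrier G. h x \<in> U} G"
  by (rule subgroup.intro) (auto simp: subgroup_def)

context lamplighter_like begin

lemma act_W: "w \<in> W m \<Longrightarrow> act k w \<in> W m"
  using W_subset W_smul act_conv_smul by (metis subsetD)

lemma W_mult: "v \<in> W m \<Longrightarrow> w \<in> W m \<Longrightarrow> v \<otimes> w \<in> W m"
  using subgroup.m_closed[OF W_subgroup] by simp

lemma W_inv: "w \<in> W m \<Longrightarrow> inv w \<in> W m"
  using subgroup.m_inv_closed[OF W_subgroup, of w m] subsetD[OF W_subset, of w m] by simp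

lemma smul_sh: "v \<in> V \<Longrightarrow> smul (sh k) v = act k v \<otimes> inv v"
  by (simp add: M.smul_diff act_conv_smul)

lemma act_diff_in_W:
  assumes "v \<in> V" "m dvd k"
  shows "act k v \<otimes> inv v \<in> W m"
  using W_dvdI[OF single_minus_one_dvd[OF assms(2)] assms(1)] assms(1) by (simp add: smul_sh)

lemma K_subgroup: "subgroup (K m) G"
  unfolding K_def using W_subgroup act_W by (rule twisted_subgroup)

lemma mem_K_iff:
  assumes "v \<in> V"
  shows "v \<otimes> s [^] (j::int) \<in> K m \<longleftrightarrow> v \<in> W m \<and> m dvd j"
proof
  assume "v \<otimes> s [^] j \<in> K m"
  then obtain w k where wk: "v \<otimes> s [^] j = w \<otimes> s [^] (m * k)" "w \<in> W m" unfolding K_def by blast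
  then show "v \<in> W m \<and> m dvd j"
    using decompose_unique[OF assms subsetD[OF W_subset wk(2)] wk(1)] by simp
next
  assume "v \<in> W m \<and> m dvd j"
  then show "v \<otimes> s [^] j \<in> K m" unfolding K_def by (auto elim!: dvdE)
qed

lemma W_subset_K: "W m \<subseteq> K m"
proof
  fix w assume "w \<in> W m"
  then show "w \<in> K m" using mem_K_iff[of w 0 m] subsetD[OF W_subset, of w m] by simp
qed

lemma V_Int_K: "v \<in> V \<Longrightarrow> v \<in> K m \<longleftrightarrow> v \<in> W m"
  using mem_K_iff[of v 0 m] by simp

lemma K_antimono:
  assumes "m dvd k"
  shows "K k \<subseteq> K m"
proof
  fix g assume "g \<in> K k"
  then obtain w c where g: "g = w \<otimes> s [^] (k * c)" "w \<in> W k" unfolding K_def by blast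
  then obtain v where v: "v \<in> V" "w = smul (sh k) v" unfolding W_def by blast
  have "w \<in> W m" unfolding v by (rule W_dvdI[OF single_minus_one_dvd[OF assms] v(1)])
  then show "g \<in> K m" using g assms mem_K_iff[of w "k * c" m] subsetD[OF W_subset] by auto
qed

text \<open>Conjugation by \<open>v s^j\<close> moves the \<open>V\<close>-part \<open>w\<close> of
  \<open>w s^(mk)\<close> to its translate and adds \<open>(t^(mk) - 1)\<close> applied to the
  inverse of \<open>v\<close>, which lies in \<open>W m\<close>.\<close>

lemma K_normal: "K m \<lhd> G"
proof (rule normal_invI[OF K_subgroup])
  fix x h assume x: "x \<in> carrier G" and h: "h \<in> K m"
  obtain v j where v: "x = v \<otimes> s [^] (j::int)" "v \<in> V" using decompose[OF x] by blast
  obtain w k where w: "h = w \<otimes> s [^] (m * k)" "w \<in> W m" using h unfolding K_def by blast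
  have wV: "w \<in> V" using w W_subset by blast
  have "x \<otimes> h \<otimes> inv x = (v \<otimes> act j w \<otimes> act (j + m * k) (act (- j) (inv v))) \<otimes> s [^] (m * k)"
    using v wV w by (simp add: twisted_mult twisted_inv)
  also have "act (j + m * k) (act (- j) (inv v)) = act (m * k) (inv v)"
    using v act_add_carrier[of "inv v" "j + m * k" "- j"] by simp
  also have "v \<otimes> act j w \<otimes> act (m * k) (inv v) = act j w \<otimes> (act (m * k) (inv v) \<otimes> inv (inv v))"
    using v wV V_comm[of v "act j w"] V_comm[of v "act (m * k) (inv v)"]
    by (simp add: act_in_V m_assoc)
  finally have "x \<otimes> h \<otimes> inv x = act j w \<otimes> (act (m * k) (inv v) \<otimes> inv (inv v)) \<otimes> s [^] (m * k)" .
  moreover have "act j w \<otimes> (act (m * k) (inv v) \<otimes> inv (inv v)) \<in> W m"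
    using w v by (intro W_mult act_W act_diff_in_W) auto
  ultimately show "x \<otimes> h \<otimes> inv x \<in> K m" unfolding K_def by blast
qed

text \<open>Modulo \<open>W m\<close> the shift has period \<open>m\<close>, so the quotient is
  generated as an abelian group by \<open>m\<close> translates of each of the finitely many module
  generators. Exponent \<open>p\<close> then makes it finite.\<close>

lemma finite_V_mod_W:
  assumes m: "0 < m"
  shows "finite (rcosets\<^bsub>G\<lparr>carrier := V\<rparr>\<^esub> (W m))"
proof -
  let ?M = "G\<lparr>carrier := V\<rparr>" and ?\<pi> = "\<lambda>v. W m #>\<^bsub>G\<lparr>carrier := V\<rparr>\<^esub> v"
  have normal: "W m \<lhd> ?M" using M.subgroup_imp_normal[OF W_subgroup] .
  interpret Q: comm_group "?M Mod W m" by (rule M.abelian_FactGroup[OF W_subgroup])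
  interpret \<pi>: group_hom ?M "?M Mod W m" ?\<pi>
    using normal.r_coset_hom_Mod[OF normal] by (simp add: group_hom_def group_hom_axioms_def M.is_group Q.is_group)
  obtain I :: "'a set" and x where I: "finite I" "x \<in> I \<rightarrow> V" "M.lin_span I x = V"
    by (rule module_generators)
  let ?F = "(\<lambda>(i, j). ?\<pi> (act j (x i))) ` (I \<times> {0..<m})"
  let ?U = "{v \<in> carrier ?M. ?\<pi> v \<in> generate (?M Mod W m) ?F}"
  have F: "?F \<subseteq> carrier (?M Mod W m)" using I by (auto simp: carrier_FactGroup act_in_V Pi_iff)
  have U: "subgroup ?U ?M" by (rule \<pi>.subgroup_vimage[OF Q.generate_is_subgroup[OF F]])
  have act_U: "act j (x i) \<in> ?U" if i: "i \<in> I" for i j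
  proof -
    have xi: "x i \<in> V" using I i by auto
    let ?r = "act (j mod m) (x i)"
    have "act j (x i) = act (m * (j div m)) ?r"
      using xi act_add_carrier[of "x i" "m * (j div m)" "j mod m"] by simp
    then have "act j (x i) \<otimes> inv ?r \<in> W m"
      using act_diff_in_W[of ?r m "m * (j div m)"] act_in_V[OF xi] by simp
    then have "(act j (x i) \<otimes> inv ?r) \<otimes>\<^bsub>?M\<^esub> ?r \<in> ?\<pi> ?r" by (auto simp: r_coset_def)
    then have "act j (x i) \<in> ?\<pi> ?r" using act_in_V[OF xi] xi by (simp add: m_assoc)
    then have "?\<pi> (act j (x i)) = ?\<pi> ?r"
      using M.repr_independence[of "act j (x i)" "W m" ?r] W_subgroup act_in_V[OF xi] by simp
    moreover have "?\<pi> ?r \<in> ?F" using i m by (intro image_eqI[of _ _ "(i, j mod m)"]) auto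
    ultimately have "?\<pi> (act j (x i)) \<in> generate (?M Mod W m) ?F" by (metis generate.incl)
    then show ?thesis using act_in_V[OF xi] by simp
  qed
  have smul_U: "smul f (x i) \<in> ?U" if "i \<in> I" for f i
    unfolding M.laurent_smul_def
    by (intro M.subgroup_finprod_closed[OF U] M.subgroup_int_pow_closed[OF U] act_U that)
  have lin_U: "M.lincomb I f x \<in> ?U" for f
    unfolding M.lincomb_def by (intro M.subgroup_finprod_closed[OF U] smul_U)
  have "finite (carrier (?M Mod W m))"
  proof (rule conjunct1[OF Q.finite_generated_exponent[OF _ F]])
    show "finite ?F" using I by simp
    show "generate (?M Mod W m) ?F = carrier (?M Mod W m)"
    proof
      show "generate (?M Mod W m) ?F \<subseteq> carrier (?M Mod W m)" by (rule Q.generate_incl[OF F])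
      show "carrier (?M Mod W m) \<subseteq> generate (?M Mod W m) ?F"
      proof
        fix X assume "X \<in> carrier (?M Mod W m)"
        then obtain v where v: "v \<in> V" "X = ?\<pi> v" by (auto simp: carrier_FactGroup)
        then obtain f where "v = M.lincomb I f x" using I(3) unfolding M.lin_span_def by auto
        then show "X \<in> generate (?M Mod W m) ?F" using lin_U[of f] v by simp
      qed
    qed
    show "0 < p" using p prime_gt_0_nat by blast
    show "X [^]\<^bsub>?M Mod W m\<^esub> p = \<one>\<^bsub>?M Mod W m\<^esub>" if X: "X \<in> carrier (?M Mod W m)" for X
    proof -
      obtain v where v: "v \<in> V" "X = ?\<pi> v" using X by (auto simp: carrier_FactGroup)
      then have "X [^]\<^bsub>?M Mod W m\<^esub> p = ?\<pi> (v [^]\<^bsub>?M\<^esub> p)" using \<pi>.hom_nat_pow[of v p] by simp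
      also have "\<dots> = ?\<pi> \<one>\<^bsub>?M\<^esub>" using v V_exponent by simp
      finally show ?thesis using \<pi>.hom_one by simp
    qed
  qed
  then show ?thesis by (simp add: FactGroup_def)
qed

text \<open>A coset of \<open>K m\<close> is determined by a coset of \<open>W m\<close> in
  \<open>V\<close> and a residue modulo \<open>m\<close>; the map \<open>?f\<close> chooses a
  representative of the former.\<close>

lemma K_finite_index:
  assumes m: "0 < m"
  shows "K m \<in> finite_index_normal G"
proof -
  let ?M = "G\<lparr>carrier := V\<rparr>"
  let ?f = "\<lambda>(X, i). K m #> ((SOME u. u \<in> X) \<otimes> s [^] (i::int))"
  have "rcosets (K m) \<subseteq> ?f ` ((rcosets\<^bsub>?M\<^esub> (W m)) \<times> {0..<m})"
  proof
    fix C assume "C \<in> rcosets (K m)"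
    then obtain g where g: "g \<in> carrier G" "C = K m #> g" by (auto simp: RCOSETS_def)
    then obtain v j where v: "v \<in> V" "g = v \<otimes> s [^] (j::int)" using decompose by blast
    define X where "X = W m #>\<^bsub>?M\<^esub> v"
    define u where "u = (SOME u. u \<in> X)"
    have X: "X \<in> rcosets\<^bsub>?M\<^esub> (W m)" unfolding X_def using v by (auto simp: RCOSETS_def)
    have "v \<in> X" unfolding X_def using M.rcos_self[OF _ W_subgroup, of v] v by simp
    then have "u \<in> X" unfolding u_def by (rule someI)
    then obtain w where w: "w \<in> W m" "u = w \<otimes> v" unfolding X_def by (auto simp: r_coset_def)
    have wV: "w \<in> V" and uV: "u \<in> V" using w v W_subset by auto
    let ?i = "j mod m" and ?q = "m * (j div m)"
    \<comment> \<open>Chosen such that \<open>?w s^?q\<close> times \<open>u s^?i\<close> equals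
      \<open>g\<close>. It lies in \<open>W m\<close> because \<open>s^?q\<close> acts trivially
      modulo \<open>W m\<close>.\<close>
    let ?w = "inv w \<otimes> inv (act ?q u \<otimes> inv u)"
    have wW: "?w \<in> W m" using w uV by (intro W_mult W_inv act_diff_in_W) auto
    have "inv w \<otimes> inv (a \<otimes> inv u) \<otimes> a = inv w \<otimes> u" if "a \<in> V" for a
      using wV uV that by (simp add: inv_mult_group m_assoc)
    then have "?w \<otimes> act ?q u = inv w \<otimes> u" using act_in_V[OF uV] by blast
    then have "?w \<otimes> act ?q u = v" using w wV v by simp
    then have "(?w \<otimes> s [^] ?q) \<otimes> (u \<otimes> s [^] ?i) = g"
      using wV uV v act_in_V[OF uV] by (subst twisted_mult) auto
    moreover have "?w \<otimes> s [^] ?q \<in> K m" using wW unfolding K_def by blast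
    ultimately have "g \<in> K m #> (u \<otimes> s [^] ?i)" by (force simp: r_coset_def)
    then have "C = K m #> (u \<otimes> s [^] ?i)"
      using repr_independence[OF _ _ K_subgroup] uV g by simp
    then have "C = ?f (X, ?i)" by (simp add: u_def)
    then show "C \<in> ?f ` ((rcosets\<^bsub>?M\<^esub> (W m)) \<times> {0..<m})" using X m by (intro image_eqI[of _ _ "(X, ?i)"]) auto
  qed
  moreover have "finite (?f ` ((rcosets\<^bsub>?M\<^esub> (W m)) \<times> {0..<m}))"
    using finite_V_mod_W[OF m] by simp
  ultimately show ?thesis using K_normal by (auto simp: finite_index_normal_def intro: finite_subset)
qed

text \<open>By the pigeonhole principle two powers of \<open>s\<close> share a coset, so some
  \<open>s^m\<close> with \<open>m > 0\<close> lies in \<open>N\<close>. Normality adds the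
  commutators of \<open>s^m\<close> with \<open>V\<close>, that is, \<open>W m\<close>.\<close>

lemma K_cofinal:
  assumes N: "N \<in> finite_index_normal G"
  obtains m where "0 < m" "K m \<subseteq> N"
proof -
  have nor: "N \<lhd> G" and fin: "finite (rcosets N)" using N by (auto simp: finite_index_normal_def)
  have sub: "subgroup N G" using nor by (rule normal_imp_subgroup)
  have "range (\<lambda>i::nat. N #> (s [^] i)) \<subseteq> rcosets N"
    using rcosetsI subgroup.subset[OF sub] by auto
  then have "\<not> inj (\<lambda>i::nat. N #> (s [^] i))" using fin finite_imageD finite_subset by blast
  then obtain i j :: nat where ij: "i < j" "N #> (s [^] i) = N #> (s [^] j)"
    unfolding inj_on_def by (metis linorder_neqE_nat)
  then have "s [^] j \<in> N #> (s [^] i)" using repr_independenceD[OF sub] by simp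
  then obtain n where n: "n \<in> N" "s [^] j = n \<otimes> s [^] i" by (auto simp: r_coset_def)
  have nc: "n \<in> carrier G" using n subgroup.mem_carrier[OF sub] by blast
  have "s [^] (int j - int i) = n"
    using n nc by (simp add: int_pow_diff int_pow_int m_assoc)
  define m where "m = int j - int i"
  have m: "0 < m" "s [^] m \<in> N" unfolding m_def using ij \<open>s [^] (int j - int i) = n\<close> n by auto
  have "W m \<subseteq> N"
  proof
    fix w assume "w \<in> W m"
    then obtain v where v: "v \<in> V" "w = smul (sh m) v" unfolding W_def by blast
    have "w = s [^] m \<otimes> (v \<otimes> inv (s [^] m) \<otimes> inv v)"
      using v by (simp add: smul_sh act_def m_assoc)
    moreover have "v \<otimes> inv (s [^] m) \<otimes> inv v \<in> N"
      using v m subgroup.m_inv_closed[OF sub] by (intro normal.inv_op_closed2[OF nor]) auto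
    ultimately show "w \<in> N" using m subgroup.m_closed[OF sub] by simp
  qed
  moreover have "s [^] (m * k) \<in> N" for k
    using subgroup_int_pow_closed[OF sub m(2), of k] by (simp add: int_pow_pow)
  ultimately have "K m \<subseteq> N" unfolding K_def using subgroup.m_closed[OF sub] by blast
  then show thesis using that m by blast
qed

text \<open>With \<open>t\<close> the shift, \<open>(t^M - 1) v = (t^(pM) - 1) w\<close> gives \<open>v = (1 + t^M + \<dots> + t^((p-1)M)) w\<close> by
  torsion-freeness, and this factor is \<open>p = 0\<close> modulo \<open>t^M - 1\<close>.\<close>

lemma centralizing_mod_K:
  assumes v: "v \<in> V" and M: "0 < M" "c dvd M" and u: "int p * M dvd u * w - 1"
    and W: "smul (sh (c * u)) v \<in> W (int p * M)"
  shows "v \<in> W M"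
proof -
  let ?P = "W (int p * M)" and ?t = "\<lambda>k. Poly_Mapping.single k 1 :: int \<Rightarrow>\<^sub>0 int"
  have vc: "v \<in> carrier (G\<lparr>carrier := V\<rparr>)" using v by simp
  have mulW: "smul (f * g) v \<in> ?P" if "smul g v \<in> ?P" for f g
    using W_smul[OF that, of f] M.smul_smul[OF vc, of f g] by simp
  \<comment> \<open>As \<open>w\<close> inverts \<open>u\<close> modulo \<open>p M\<close>, the
    exponent \<open>c u\<close> can be replaced by \<open>c\<close>: pass to the multiple
    \<open>c u w\<close>, then subtract \<open>t^c\<close> times \<open>t^(c(uw - 1)) - 1\<close>,
    which is a multiple of \<open>t^(pM) - 1\<close>. Afterwards \<open>c dvd M\<close> leads on to
    \<open>t^M - 1\<close>.\<close>
  have "smul (sh (c * (u * w))) v \<in> ?P"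
  proof -
    have "sh (c * u) dvd sh (c * (u * w))" by (rule single_minus_one_dvd) simp
    then obtain f where "sh (c * (u * w)) = f * sh (c * u)" by (metis dvd_def mult.commute)
    then show ?thesis using mulW[OF W] by simp
  qed
  moreover have "smul (sh (c * (u * w)) - sh c) v \<in> ?P"
  proof -
    have "sh (c * (u * w)) - sh c = ?t c * sh (c * (u * w - 1))"
      by (simp add: right_diff_distrib mult_single)
    moreover have "smul (sh (c * (u * w - 1))) v \<in> ?P"
      using u by (intro W_dvdI[OF single_minus_one_dvd v]) simp
    ultimately show ?thesis using mulW by simp
  qed
  ultimately have "smul (sh (c * (u * w)) - (sh (c * (u * w)) - sh c)) v \<in> ?P"
    using W_mult W_inv v unfolding M.smul_diff[OF vc] by simp
  then have "smul (sh c) v \<in> ?P" by simp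
  moreover obtain f where "sh M = f * sh c"
    using single_minus_one_dvd[OF M(2)] by (metis dvd_def mult.commute)
  ultimately have "smul (sh M) v \<in> ?P" using mulW by simp
  then obtain x where x: "x \<in> V" "smul (sh M) v = smul (sh (int p * M)) x" unfolding W_def by blast
  define Q where "Q = (\<Sum>j<p. ?t (int j * M))"
  have shp: "sh (int p * M) = sh M * Q"
    unfolding Q_def single_power[symmetric] by (rule power_diff_1_eq)
  have xc: "x \<in> carrier (G\<lparr>carrier := V\<rparr>)" using x by simp
  let ?y = "v \<otimes> inv (smul Q x)"
  have yV: "?y \<in> V" using v x by simp
  have "smul (sh M) ?y = smul (sh M) v \<otimes> inv (smul (sh M) (smul Q x))"
    using M.smul_mult[of v "inv (smul Q x)" "sh M"] M.smul_inv[of "smul Q x" "sh M"] v x by simp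
  also have "\<dots> = \<one>" using x shp M.smul_smul[OF xc, of "sh M" Q] by simp
  finally have "act M ?y \<otimes> inv ?y = \<one>" using yV by (simp add: smul_sh)
  then have "act M ?y = ?y" using yV by (metis V_closed act_carrier inv_equality inv_inv inv_closed)
  then have "?y = \<one>" using V_aperiodic[OF yV M(1)] act_eq_self_iff[of ?y M] yV by blast
  then have vQ: "v = smul Q x" using v x by (metis V_closed inv_closed inv_equality inv_inv smul_in_V)
  have "sh M dvd Q - of_nat p"
  proof -
    have "Q - of_nat p = (\<Sum>j<p. sh (int j * M))" unfolding Q_def by (simp add: sum_subtractf)
    then show ?thesis by (simp add: dvd_sum single_minus_one_dvd)
  qed
  then have "smul (Q - of_nat p) x \<in> W M" using x by (intro W_dvdI)
  moreover have "smul (of_nat p) x = \<one>"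
  proof -
    have "smul (Poly_Mapping.single 0 (int p)) x = \<one>"
      using M.laurent_smul_single[OF xc, of 0 "int p"] x V_exponent act_in_V
      by (simp add: act_def int_pow_int)
    then show ?thesis by (simp add: single_of_nat[symmetric] del: single_of_nat)
  qed
  ultimately show ?thesis using vQ x by (simp add: M.smul_diff)
qed

end

section \<open>The lamplighter group\<close>

locale concrete_lamplighter =
  fixes n p :: nat
  assumes p_prime: "Factorial_Ring.prime p"
begin

abbreviation "L \<equiv> lamplighter n p"

text \<open>Rows are extensional, so the neutral row is \<open>undefined\<close> from index
  \<open>n\<close> on rather than 0.\<close>

definition zero_row :: "nat \<Rightarrow> int" where "zero_row = (\<lambda>i\<in>{..<n}. 0)"

lemma zero_row_apply [simp]: "i < n \<Longrightarrow> zero_row i = 0"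
  by (simp add: zero_row_def)

lemma zero_row_PiE [simp]: "zero_row \<in> {..<n} \<rightarrow>\<^sub>E UNIV"
  by (simp add: zero_row_def)

lemma p_pos [simp]: "0 < p" using p_prime prime_gt_0_nat by blast

definition rows :: "(int \<Rightarrow> nat \<Rightarrow> int) set" where
  "rows = {h. (\<forall>j. h j \<in> {..<n} \<rightarrow>\<^sub>E {0..<int p}) \<and> finite {j. h j \<noteq> zero_row}}"

lemma carrier_L: "carrier L = rows \<times> UNIV"
  using p_pos
  by (auto simp: lamplighter_def wreath_product_def Let_def carrier_sum_group rows_def PiE_iff
      carrier_integer_mod_group zero_row_def simp del: p_pos)

lemma mult_L: "(h, k) \<otimes>\<^bsub>L\<^esub> (h', k') = (\<lambda>j. \<lambda>i\<in>{..<n}. (h j i + h' (j - k) i) mod int p, k + k')"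
  by (simp add: lamplighter_def wreath_product_def Let_def shift_def restrict_UNIV)

lemma one_L: "\<one>\<^bsub>L\<^esub> = (\<lambda>j. zero_row, 0)"
  by (simp add: lamplighter_def wreath_product_def Let_def zero_row_def restrict_UNIV)

lemma row_eqI:
  assumes "f \<in> {..<n} \<rightarrow>\<^sub>E A" "g \<in> {..<n} \<rightarrow>\<^sub>E B" "\<And>i. i < n \<Longrightarrow> f i = g i"
  shows "f = g"
  using assms by (intro PiE_ext) auto

lemma rows_range: "h \<in> rows \<Longrightarrow> i < n \<Longrightarrow> 0 \<le> h j i \<and> h j i < int p"
  by (fastforce simp: rows_def PiE_iff)

lemma rows_mod [simp]: "h \<in> rows \<Longrightarrow> i < n \<Longrightarrow> h j i mod int p = h j i"
  using rows_range by simp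

lemma rows_finite: "h \<in> rows \<Longrightarrow> finite {j. h j \<noteq> zero_row}"
  by (simp add: rows_def)

lemma rows_eqI:
  assumes "h \<in> rows" "h' \<in> rows" "\<And>j i. i < n \<Longrightarrow> h j i = h' j i"
  shows "h = h'"
proof
  fix j show "h j = h' j" using assms by (intro row_eqI[of _ "{0..<int p}" _ "{0..<int p}"]) (auto simp: rows_def)
qed

lemma rowsI:
  assumes "finite A" "\<And>j i. i < n \<Longrightarrow> \<not> int p dvd f j i \<Longrightarrow> j \<in> A"
  shows "(\<lambda>j. \<lambda>i\<in>{..<n}. f j i mod int p) \<in> rows"
proof -
  have "j \<in> A" if "(\<lambda>i\<in>{..<n}. f j i mod int p) \<noteq> zero_row" for j
  proof (rule ccontr)
    assume "j \<notin> A"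
    then have "(\<lambda>i\<in>{..<n}. f j i mod int p) = zero_row"
      unfolding zero_row_def using assms(2)[of _ j] by (intro restrict_ext dvd_imp_mod_0) auto
    then show False using that by blast
  qed
  then have "{j. (\<lambda>i\<in>{..<n}. f j i mod int p) \<noteq> zero_row} \<subseteq> A" by blast
  then show ?thesis using assms(1) finite_subset by (auto simp: rows_def)
qed

lemma mult_rows:
  assumes "h \<in> rows" "h' \<in> rows"
  shows "(\<lambda>j. \<lambda>i\<in>{..<n}. (h j i + h' (j - k) i) mod int p) \<in> rows"
proof (rule rowsI)
  let ?A = "{j. h j \<noteq> zero_row}" and ?B = "{j. h' j \<noteq> zero_row}"
  show "finite (?A \<union> (\<lambda>j. j + k) ` ?B)" using assms rows_finite by blast
  show "j \<in> ?A \<union> (\<lambda>j. j + k) ` ?B" if "i < n" "\<not> int p dvd h j i + h' (j - k) i" for i j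
  proof (rule ccontr)
    assume "j \<notin> ?A \<union> (\<lambda>j. j + k) ` ?B"
    then have "h j = zero_row" "h' (j - k) = zero_row" by (auto simp: image_iff)
    then show False using that by simp
  qed
qed

lemma zero_rows: "(\<lambda>j. zero_row) \<in> rows" by (auto simp: rows_def zero_row_def)

lemma zero_add_rows:
  assumes "h \<in> rows"
  shows "(\<lambda>j. \<lambda>i\<in>{..<n}. (zero_row i + h j i) mod int p) = h"
    and "(\<lambda>j. \<lambda>i\<in>{..<n}. (h j i + zero_row i) mod int p) = h"
  using mult_rows[OF zero_rows assms, of 0] mult_rows[OF assms zero_rows] assms
  by (auto intro!: rows_eqI)

lemma shift_rows:
  assumes "h \<in> rows"
  shows "(\<lambda>j. h (j - k)) \<in> rows"
proof -
  have "{j. h (j - k) \<noteq> zero_row} = (\<lambda>j. j + k) ` {j. h j \<noteq> zero_row}" by (force simp: image_iff)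
  then show ?thesis using assms rows_finite[OF assms] by (simp add: rows_def)
qed

lemma L_group: "group L"
proof (rule groupI)
  fix x y assume "x \<in> carrier L" "y \<in> carrier L"
  then show "x \<otimes>\<^bsub>L\<^esub> y \<in> carrier L" by (cases x; cases y) (simp add: carrier_L mult_L mult_rows)
next
  show "\<one>\<^bsub>L\<^esub> \<in> carrier L" by (simp add: carrier_L one_L zero_rows)
next
  fix x y z assume "x \<in> carrier L" "y \<in> carrier L" "z \<in> carrier L"
  then show "x \<otimes>\<^bsub>L\<^esub> y \<otimes>\<^bsub>L\<^esub> z = x \<otimes>\<^bsub>L\<^esub> (y \<otimes>\<^bsub>L\<^esub> z)"
    by (cases x; cases y; cases z)
      (auto simp: mult_L mod_add_left_eq mod_add_right_eq algebra_simps intro!: ext)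
next
  fix x assume "x \<in> carrier L"
  then show "\<one>\<^bsub>L\<^esub> \<otimes>\<^bsub>L\<^esub> x = x"
    by (cases x) (simp add: mult_L one_L carrier_L zero_add_rows)
next
  fix x assume x: "x \<in> carrier L"
  obtain h k where hk: "x = (h, k)" "h \<in> rows" using x by (cases x) (auto simp: carrier_L)
  let ?g = "\<lambda>j. \<lambda>i\<in>{..<n}. (- h (j + k) i) mod int p"
  have g: "?g \<in> rows"
  proof (rule rowsI)
    show "finite ((\<lambda>j. j - k) ` {j. h j \<noteq> zero_row})" using hk rows_finite by blast
    show "j \<in> (\<lambda>j. j - k) ` {j. h j \<noteq> zero_row}" if "i < n" "\<not> int p dvd - h (j + k) i" for i j
      using that by (intro image_eqI[of _ _ "j + k"]) auto
  qed
  have "(?g, - k) \<otimes>\<^bsub>L\<^esub> x = \<one>\<^bsub>L\<^esub>"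
    unfolding hk mult_L one_L zero_row_def by (auto simp: mod_add_left_eq intro!: ext)
  then show "\<exists>y\<in>carrier L. y \<otimes>\<^bsub>L\<^esub> x = \<one>\<^bsub>L\<^esub>" using g by (auto simp: carrier_L)
qed

sublocale L: group L by (rule L_group)

abbreviation "t \<equiv> ((\<lambda>j. zero_row, 1) :: (int \<Rightarrow> nat \<Rightarrow> int) \<times> int)"

lemma t_closed: "t \<in> carrier L" by (simp add: carrier_L zero_rows)

lemma t_pow: "t [^]\<^bsub>L\<^esub> (k::int) = (\<lambda>j. zero_row, k)"
proof -
  let ?f = "\<lambda>k::int. (\<lambda>j::int. zero_row, k)"
  have "?f \<in> hom integer_group L"
    using zero_add_rows(1)[OF zero_rows] by (simp add: hom_def carrier_L zero_rows mult_L)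
  then have "?f (1 [^]\<^bsub>integer_group\<^esub> k) = ?f 1 [^]\<^bsub>L\<^esub> k"
    using hom_int_pow[of ?f integer_group L 1 k] L_group by simp
  then show ?thesis by simp
qed

lemma t_pow_conj:
  assumes "h \<in> rows"
  shows "t [^]\<^bsub>L\<^esub> (k::int) \<otimes>\<^bsub>L\<^esub> (h, 0) = (\<lambda>j. h (j - k), k)"
    and "(h, 0) \<otimes>\<^bsub>L\<^esub> t [^]\<^bsub>L\<^esub> (k::int) = (h, k)"
  unfolding t_pow mult_L using zero_add_rows[OF shift_rows[OF assms]] zero_add_rows[OF assms] by simp_all

definition base :: "((int \<Rightarrow> nat \<Rightarrow> int) \<times> int) set" where "base = rows \<times> {0}"

lemma base_normal: "base \<lhd> L"
proof -
  have "snd \<in> hom L integer_group"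
    by (auto simp: hom_def carrier_L mult_L)
  then interpret h: group_hom L integer_group snd
    by (simp add: group_hom_def group_hom_axioms_def L_group)
  have "base = kernel L integer_group snd" by (auto simp: base_def kernel_def carrier_L)
  then show ?thesis using h.normal_kernel by simp
qed

lemma base_pow:
  "h \<in> rows \<Longrightarrow> (h, 0) [^]\<^bsub>L\<^esub> (m::nat) = (\<lambda>j. \<lambda>i\<in>{..<n}. (int m * h j i) mod int p, 0)"
proof (induction m)
  case (Suc m)
  then show ?case by (auto simp: mult_L mod_add_left_eq mod_add_right_eq algebra_simps intro!: ext)
qed (auto simp: one_L zero_row_def)

text \<open>A nonzero row of an \<open>m\<close>-periodic element would recur at infinitely many
  positions, against finite support.\<close>

lemma base_aperiodic:
  assumes h: "h \<in> rows" and m: "0 < m" "t [^]\<^bsub>L\<^esub> (m::int) \<otimes>\<^bsub>L\<^esub> (h, 0) = (h, 0) \<otimes>\<^bsub>L\<^esub> t [^]\<^bsub>L\<^esub> m"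
  shows "h = (\<lambda>j. zero_row)"
proof (rule ccontr)
  assume "h \<noteq> (\<lambda>j. zero_row)"
  then obtain j0 where j0: "h j0 \<noteq> zero_row" by auto
  have per: "h (j - m) = h j" for j using m(2) unfolding t_pow_conj[OF h] by (metis Pair_inject)
  have "h (j0 + m * int i) = h j0" for i
  proof (induction i)
    case (Suc i)
    then show ?case using per[of "j0 + m * int (Suc i)"] by (simp add: algebra_simps)
  qed simp
  then have "range (\<lambda>i. j0 + m * int i) \<subseteq> {j. h j \<noteq> zero_row}" using j0 by auto
  then have "finite (range (\<lambda>i. j0 + m * int i))" using rows_finite[OF h] finite_subset by blast
  moreover have "inj (\<lambda>i. j0 + m * int i)" using m by (auto simp: inj_on_def)
  ultimately show False using finite_imageD by blast
qed

definition delta :: "int \<Rightarrow> nat \<Rightarrow> int \<Rightarrow> int \<Rightarrow> nat \<Rightarrow> int" where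
  "delta j i c = (\<lambda>j'. \<lambda>i'\<in>{..<n}. (if j' = j \<and> i' = i then c else 0) mod int p)"

lemma delta_rows: "delta j i c \<in> rows"
  unfolding delta_def by (rule rowsI[of "{j}"]) (auto split: if_splits)

text \<open>The number of these generators, at most \<open>n + 1\<close>, later bounds the rank of
  elementary abelian quotients.\<close>

definition gens :: "((int \<Rightarrow> nat \<Rightarrow> int) \<times> int) set" where
  "gens = insert t ((\<lambda>i. (delta 0 i 1, 0)) ` {..<n})"

lemma card_gens: "finite gens" "card gens \<le> Suc n"
proof -
  show "finite gens" by (simp add: gens_def)
  have "card ((\<lambda>i. (delta 0 i 1, 0::int)) ` {..<n}) \<le> n" using card_image_le[of "{..<n}"] by simp
  then show "card gens \<le> Suc n" by (simp add: gens_def card_insert_if)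
qed

lemma gens_closed: "gens \<subseteq> carrier L"
  by (auto simp: gens_def t_closed carrier_L delta_rows zero_rows)

text \<open>Powers of the given generators and conjugation by powers of \<open>t\<close> produce
  every family with a single nonzero entry. A general family is then stripped of one nonzero entry
  at a time.\<close>

lemma generate_gens: "generate L gens = carrier L"
proof
  show "generate L gens \<subseteq> carrier L" by (rule L.generate_incl[OF gens_closed])
  let ?U = "generate L gens"
  have U: "subgroup ?U L" by (rule L.generate_is_subgroup[OF gens_closed])
  have "t \<in> ?U" by (rule generate.incl) (simp add: gens_def)
  then have tU: "t [^]\<^bsub>L\<^esub> (k::int) \<in> ?U" for k by (rule L.subgroup_int_pow_closed[OF U])
  have dU: "(delta j i c, 0) \<in> ?U" if i: "i < n" and c: "0 \<le> c" for j i c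
  proof -
    have "(delta 0 i 1, 0) \<in> ?U" by (rule generate.incl) (use i in \<open>auto simp: gens_def\<close>)
    then have "(delta 0 i 1, 0) [^]\<^bsub>L\<^esub> (nat c) \<in> ?U" by (rule L.subgroup_nat_pow_closed[OF U])
    moreover have "(delta 0 i 1, 0) [^]\<^bsub>L\<^esub> (nat c) = (delta 0 i c, 0)"
      unfolding base_pow[OF delta_rows] using c by (auto simp: delta_def mod_mult_right_eq intro!: ext)
    ultimately have d0: "(delta 0 i c, 0) \<in> ?U" by simp
    have dc: "(delta j i c, 0) \<in> carrier L" by (simp add: carrier_L delta_rows)
    have e: "t [^]\<^bsub>L\<^esub> j \<otimes>\<^bsub>L\<^esub> (delta 0 i c, 0) = (delta j i c, 0) \<otimes>\<^bsub>L\<^esub> t [^]\<^bsub>L\<^esub> j"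
      unfolding t_pow_conj[OF delta_rows] by (auto simp: delta_def intro!: ext)
    have "(delta j i c, 0) = t [^]\<^bsub>L\<^esub> j \<otimes>\<^bsub>L\<^esub> (delta 0 i c, 0) \<otimes>\<^bsub>L\<^esub> inv\<^bsub>L\<^esub> (t [^]\<^bsub>L\<^esub> j)"
      unfolding e using t_closed dc by (simp add: L.m_assoc)
    then show ?thesis
      using subgroup.m_closed[OF U subgroup.m_closed[OF U tU d0] subgroup.m_inv_closed[OF U tU], of j j] by simp
  qed
  have hU: "(h, 0) \<in> ?U" if "h \<in> rows" for h
    using that
  proof (induction "card {(j, i). i < n \<and> h j i \<noteq> 0}" arbitrary: h rule: less_induct)
    case less
    let ?S = "\<lambda>h. {(j, i). i < n \<and> h j i \<noteq> (0::int)}"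
    show ?case
    proof (cases "?S h = {}")
      case True
      then have "h = (\<lambda>j. zero_row)" using less.prems zero_rows by (intro rows_eqI) auto
      then show ?thesis using subgroup.one_closed[OF U] by (simp add: one_L)
    next
      case False
      then obtain j i where ji: "i < n" "h j i \<noteq> 0" by auto
      let ?h = "\<lambda>j'. \<lambda>i'\<in>{..<n}. (if j' = j \<and> i' = i then 0 else h j' i') mod int p"
      have h': "?h \<in> rows"
        by (rule rowsI[OF rows_finite[OF less.prems]]) (auto split: if_splits)
      have fin: "finite (?S h)"
        by (rule finite_subset[of _ "{j. h j \<noteq> zero_row} \<times> {..<n}"])
          (use rows_finite[OF less.prems] in auto)
      have "?S ?h \<subset> ?S h" using ji less.prems by auto
      then have a: "(?h, 0) \<in> ?U" using less.hyps[of ?h] h' psubset_card_mono[OF fin] by blast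
      have b: "(delta j i (h j i), 0) \<in> ?U" using dU ji rows_range[OF less.prems] by blast
      have e: "(delta j i (h j i), 0) \<otimes>\<^bsub>L\<^esub> (?h, 0) = (h, 0)"
        unfolding mult_L using less.prems
        by (auto simp: delta_def intro!: rows_eqI mult_rows[OF delta_rows h', of j i "h j i" 0, unfolded delta_def, simplified])
      show ?thesis using subgroup.m_closed[OF U b a] unfolding e .
    qed
  qed
  show "carrier L \<subseteq> ?U"
  proof clarify
    fix h k assume "(h, k) \<in> carrier L"
    then have h: "h \<in> rows" by (simp add: carrier_L)
    show "(h, k) \<in> ?U"
      using subgroup.m_closed[OF U hU[OF h] tU[of k]] unfolding t_pow_conj[OF h] .
  qed
qed

lemma L_finitely_generated: "finitely_generated L"
  using gens_closed card_gens generate_gens unfolding finitely_generated_def by blast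

sublocale lamplighter_like L p base t
proof (intro lamplighter_like.intro L_group lamplighter_like_axioms.intro)
  show "v \<otimes>\<^bsub>L\<^esub> w = w \<otimes>\<^bsub>L\<^esub> v" if "v \<in> base" "w \<in> base" for v w
    using that by (auto simp: base_def mult_L add.commute)
  show "v [^]\<^bsub>L\<^esub> p = \<one>\<^bsub>L\<^esub>" if "v \<in> base" for v
    using that by (auto simp: base_def base_pow one_L zero_row_def)
  show "\<exists>v\<in>base. \<exists>k::int. g = v \<otimes>\<^bsub>L\<^esub> t [^]\<^bsub>L\<^esub> k" if "g \<in> carrier L" for g
    using that by (auto simp: carrier_L base_def t_pow_conj)
  show "k = 0" if "t [^]\<^bsub>L\<^esub> (k::int) \<in> base" for k
    using that by (simp add: t_pow base_def)
  show "v = \<one>\<^bsub>L\<^esub>" if "v \<in> base" "0 < m" "t [^]\<^bsub>L\<^esub> (m::int) \<otimes>\<^bsub>L\<^esub> v = v \<otimes>\<^bsub>L\<^esub> t [^]\<^bsub>L\<^esub> m" for v m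
    using that base_aperiodic by (auto simp: base_def one_L)
qed (use p_prime base_normal t_closed L_finitely_generated in auto)

lemma mem_W_base:
  assumes "(h, k) \<in> W m"
  obtains g where "g \<in> rows" "\<And>j i. i < n \<Longrightarrow> h j i = (g (j - m) i - g j i) mod int p"
proof -
  obtain v where v: "v \<in> base" "(h, k) = smul (sh m) v" using assms unfolding W_def by blast
  define g where "g = fst v"
  have vg: "v = (g, 0)" "g \<in> rows" using v(1) by (auto simp: g_def base_def)
  have gb: "(g, 0) \<in> base" and g: "g \<in> rows" "(h, k) = smul (sh m) (g, 0)" using v vg by auto
  have "(h, k) = act m (g, 0) \<otimes>\<^bsub>L\<^esub> inv\<^bsub>L\<^esub> (g, 0)" unfolding g(2) by (rule smul_sh[OF gb])
  then have "(h, k) \<otimes>\<^bsub>L\<^esub> (g, 0) = act m (g, 0)"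
    using gb V_closed[OF gb] by (simp add: L.m_assoc)
  then have "(h, k) \<otimes>\<^bsub>L\<^esub> (g, 0) \<otimes>\<^bsub>L\<^esub> t [^]\<^bsub>L\<^esub> m = t [^]\<^bsub>L\<^esub> m \<otimes>\<^bsub>L\<^esub> (g, 0)"
    using gb V_closed[OF gb] t_closed by (simp add: act_def L.m_assoc)
  then have k: "(\<lambda>j. \<lambda>i\<in>{..<n}. (h j i + g (j - k) i) mod int p, k) \<otimes>\<^bsub>L\<^esub> t [^]\<^bsub>L\<^esub> m = (\<lambda>j. g (j - m), m)"
    unfolding t_pow_conj[OF g(1)] mult_L by simp
  have hk: "h \<in> rows" "k = 0" using assms W_subset[of m] unfolding base_def by auto
  have "(\<lambda>j. \<lambda>i\<in>{..<n}. (h j i + g (j - k) i) mod int p) = (\<lambda>j. g (j - m))"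
    using k t_pow_conj(2)[OF mult_rows[OF hk(1) g(1), of k], of m] hk(2) by simp
  then have *: "(h j i + g j i) mod int p = g (j - m) i" if "i < n" for j i
    using that hk(2) by (metis (no_types, lifting) diff_zero lessThan_iff restrict_apply')
  have "h j i = (g (j - m) i - g j i) mod int p" if "i < n" for j i
    unfolding *[OF that, symmetric] using rows_mod[OF hk(1) that] by (simp add: mod_diff_left_eq)
  then show thesis using that g(1) by blast
qed

lemma L_residually_finite: "residually_finite L"
  unfolding residually_finite_def
proof (intro ballI impI)
  fix x assume x: "x \<in> carrier L" "x \<noteq> \<one>\<^bsub>L\<^esub>"
  obtain h k where hk: "x = (h, k)" "h \<in> rows" using x by (cases x) (auto simp: carrier_L)
  have hb: "(h, 0) \<in> base" using hk by (simp add: base_def)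
  have mem: "x \<in> K m \<Longrightarrow> (h, 0) \<in> W m \<and> m dvd k" for m
    using mem_K_iff[OF hb, of k m] unfolding t_pow_conj[OF hk(2)] hk by simp
  show "\<exists>N\<in>finite_index_normal L. x \<notin> N"
  proof (cases "k = 0")
    case False
    \<comment> \<open>Membership would make the modulus divide the nonzero number \<open>k\<close>
      of smaller absolute value.\<close>
    have "x \<notin> K (\<bar>k\<bar> + 1)"
      using mem False zdvd_imp_le[of "\<bar>k\<bar> + 1" "\<bar>k\<bar>"] by force
    then show ?thesis using K_finite_index[of "\<bar>k\<bar> + 1"] by force
  next
    case True
    let ?T = "\<lambda>h. {j. h j \<noteq> zero_row}"
    have ne: "?T h \<noteq> {}" using x True by (auto simp: hk one_L)
    define a where "a = Max (abs ` ?T h)"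
    have a: "\<bar>j\<bar> \<le> a" if "j \<in> ?T h" for j
      unfolding a_def using that rows_finite[OF hk(2)] by (intro Max_ge) auto
    then have a0: "0 \<le> a" using ne by force
    \<comment> \<open>The support of \<open>h\<close> lies between \<open>-a\<close> and
      \<open>a\<close>, so no two of its points are \<open>2a + 1\<close> apart. If \<open>h\<close>
      came from a nonzero \<open>g\<close>, it would be nonzero at the lowest position of
      \<open>g\<close> and at the highest one plus \<open>?m\<close>, where no cancellation occurs;
      these are at least \<open>?m\<close> apart.\<close>
    let ?m = "2 * a + 1"
    have "x \<notin> K ?m"
    proof
      assume "x \<in> K ?m"
      then obtain g where g: "g \<in> rows" "\<And>j i. i < n \<Longrightarrow> h j i = (g (j - ?m) i - g j i) mod int p"
        using mem mem_W_base by metis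
      have "?T g \<noteq> {}"
      proof
        assume *: "?T g = {}"
        have "h = (\<lambda>j. zero_row)" using g(2) * hk zero_rows by (intro rows_eqI) auto
        then show False using ne by simp
      qed
      then have u: "Max (?T g) \<in> ?T g" and l: "Min (?T g) \<in> ?T g"
        using rows_finite[OF g(1)] Max_in Min_in by blast+
      let ?u = "Max (?T g)" and ?l = "Min (?T g)"
      have le: "?l \<le> ?u" using u rows_finite[OF g(1)] by (intro Min_le) auto
      have nz: "\<exists>i<n. g j i \<noteq> 0" if "j \<in> ?T g" for j
        using that row_eqI[of "g j" "{0..<int p}" zero_row UNIV] g(1) by (auto simp: rows_def)
      have out: "g j i = 0" if "i < n" "j < ?l \<or> ?u < j" for i j
        using that rows_finite[OF g(1)] Max_ge[of "?T g" j] Min_le[of "?T g" j] by fastforce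
      obtain i where i: "i < n" "g ?u i \<noteq> 0" using nz[OF u] by blast
      have "h (?u + ?m) i = g ?u i" using g(2)[OF i(1), of "?u + ?m"] out[OF i(1), of "?u + ?m"] a0 i g(1) by simp
      then have "\<bar>?u + ?m\<bar> \<le> a" using i by (intro a) auto
      moreover obtain i' where i': "i' < n" "g ?l i' \<noteq> 0" using nz[OF l] by blast
      have "h ?l i' = (- g ?l i') mod int p" using g(2)[OF i'(1), of ?l] out[OF i'(1), of "?l - ?m"] a0 by simp
      then have "h ?l i' \<noteq> 0"
        using i' rows_range[OF g(1) i'(1), of ?l] by (auto simp: zmod_zminus1_eq_if)
      then have "\<bar>?l\<bar> \<le> a" using i' by (intro a) auto
      ultimately show False using le a0 by linarith
    qed
    then show ?thesis using K_finite_index[of ?m] a0 by force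
  qed
qed

end

section \<open>Recognizing a lamplighter group from a module basis\<close>

lemma (in torsion_free_module) lincomb_cong_sz:
  assumes "x \<in> I \<rightarrow> carrier M" "\<And>i. i \<in> I \<Longrightarrow> sz (f i - g i) = 0"
  shows "lincomb I f x = lincomb I g x"
  unfolding lincomb_def
proof (rule finprod_cong')
  fix i assume i: "i \<in> I"
  then have xi: "x i \<in> carrier M" using assms(1) by auto
  have "smul (f i) (x i) = smul (f i - g i + g i) (x i)" by simp
  also have "\<dots> = smul (f i - g i) (x i) \<otimes> smul (g i) (x i)" using xi by (rule smul_add)
  also have "\<dots> = smul (g i) (x i)" using sz_0[OF assms(2)[OF i] xi] xi by simp
  finally show "smul (f i) (x i) = smul (g i) (x i)" .
qed (use assms in auto)

context concrete_lamplighter begin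

text \<open>A coordinate of \<open>h\<close> is read as a polynomial in the shift. The guard is
  there because rows are \<open>undefined\<close> beyond \<open>n\<close>, which could make the
  support infinite.\<close>

definition row_poly :: "(int \<Rightarrow> nat \<Rightarrow> int) \<Rightarrow> nat \<Rightarrow> int \<Rightarrow>\<^sub>0 int" where
  "row_poly h i = Abs_poly_mapping (\<lambda>j. if i < n then h j i else 0)"

lemma lookup_row_poly:
  assumes "h \<in> rows" "i < n"
  shows "Poly_Mapping.lookup (row_poly h i) j = h j i"
proof -
  have "finite {j. h j i \<noteq> 0}"
    by (rule finite_subset[OF _ rows_finite[OF assms(1)]]) (use assms in auto)
  then show ?thesis using assms(2) by (simp add: row_poly_def)
qed

end

context lamplighter_like begin

text \<open>Coordinates with respect to a basis of \<open>V\<close> give the isomorphism: spanning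
  makes it surjective, independence makes it injective. The entries of a row are residues between 0
  and \<open>p - 1\<close> while polynomials carry arbitrary integers, so coefficients are compared
  modulo \<open>p\<close> only, through \<open>lincomb_cong_sz\<close>.\<close>

theorem iso_lamplighter: "\<exists>r. lamplighter r p \<cong> G"
proof -
  obtain r :: nat and y where y: "y \<in> {..<r} \<rightarrow> V" "M.lin_span {..<r} y = V" "M.independent {..<r} y"
    by (rule module_basis)
  interpret C: concrete_lamplighter r p by unfold_locales (rule p)
  have yc: "y \<in> {..<r} \<rightarrow> carrier (G\<lparr>carrier := V\<rparr>)" using y by simp
  define lc where "lc h = M.lincomb {..<r} (C.row_poly h) y" for h
  have lcV: "lc h \<in> V" for h using M.lincomb_closed[OF yc] by (simp add: lc_def)
  define \<Phi> where "\<Phi> = (\<lambda>(h, k). lc h \<otimes> s [^] (k::int))"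
  have lc_mult: "lc (\<lambda>j. \<lambda>i\<in>{..<r}. (h j i + h' (j - k) i) mod int p) = lc h \<otimes> act k (lc h')"
    (is "lc ?h = _") if h: "h \<in> C.rows" "h' \<in> C.rows" for h h' k
  proof -
    have "lc ?h = M.lincomb {..<r} (\<lambda>i. C.row_poly h i + Poly_Mapping.single k 1 * C.row_poly h' i) y"
      unfolding lc_def
    proof (rule M.lincomb_cong_sz[OF yc])
      fix i assume "i \<in> {..<r}"
      then show "laurent_width p (C.row_poly ?h i - (C.row_poly h i + Poly_Mapping.single k 1 * C.row_poly h' i)) = 0"
        using h C.mult_rows[OF h, of k]
        by (auto simp: laurent_width_eq_0_iff lookup_minus lookup_add lookup_single_mult C.lookup_row_poly
            mod_eq_dvd_iff[symmetric])
    qed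
    also have "\<dots> = lc h \<otimes> smul (Poly_Mapping.single k 1) (lc h')"
      using M.lincomb_add[OF yc] M.lincomb_smul[OF yc] by (simp add: lc_def)
    finally show ?thesis using act_conv_smul[OF lcV] by simp
  qed
  have hom: "\<Phi> \<in> hom (lamplighter r p) G"
  proof (rule homI)
    fix x assume "x \<in> carrier (lamplighter r p)"
    then show "\<Phi> x \<in> carrier G" using V_closed[OF lcV] by (cases x) (simp add: \<Phi>_def)
  next
    fix x x' assume "x \<in> carrier (lamplighter r p)" "x' \<in> carrier (lamplighter r p)"
    then obtain h k h' k' where *: "x = (h, k)" "x' = (h', k')" "h \<in> C.rows" "h' \<in> C.rows"
      by (cases x; cases x') (auto simp: C.carrier_L)
    show "\<Phi> (x \<otimes>\<^bsub>lamplighter r p\<^esub> x') = \<Phi> x \<otimes> \<Phi> x'"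
      unfolding * C.mult_L \<Phi>_def using lcV by (simp add: twisted_mult lc_mult[OF *(3,4)])
  qed
  interpret \<Phi>: group_hom "lamplighter r p" G \<Phi>
    using hom by (simp add: group_hom_def group_hom_axioms_def C.L_group is_group)
  have "\<Phi> \<in> iso (lamplighter r p) G"
    unfolding \<Phi>.iso_iff
  proof (intro conjI ballI impI subsetI)
    fix g assume "g \<in> carrier G"
    then obtain v k where v: "v \<in> V" "g = v \<otimes> s [^] (k::int)" using decompose by blast
    obtain f where f: "v = M.lincomb {..<r} f y" using v(1) y(2) unfolding M.lin_span_def by blast
    let ?h = "\<lambda>j. \<lambda>i\<in>{..<r}. Poly_Mapping.lookup (f i) j mod int p"
    have h: "?h \<in> C.rows"
    proof (rule C.rowsI)
      show "finite (\<Union>i<r. Poly_Mapping.keys (f i))" by simp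
      show "j \<in> (\<Union>i<r. Poly_Mapping.keys (f i))" if "i < r" "\<not> int p dvd Poly_Mapping.lookup (f i) j" for i j
        using that by (auto simp: in_keys_iff intro!: bexI[of _ i])
    qed
    have "lc ?h = v" unfolding lc_def f
    proof (rule M.lincomb_cong_sz[OF yc])
      fix i assume "i \<in> {..<r}"
      then show "laurent_width p (C.row_poly ?h i - f i) = 0"
        using h by (auto simp: laurent_width_eq_0_iff lookup_minus C.lookup_row_poly mod_eq_dvd_iff[symmetric])
    qed
    then have "g = \<Phi> (?h, k)" by (simp add: \<Phi>_def v)
    then show "g \<in> \<Phi> ` carrier (lamplighter r p)" using h by (auto simp: C.carrier_L)
  next
    fix x assume "x \<in> carrier (lamplighter r p)" and 1: "\<Phi> x = \<one>"
    then obtain h k where x: "x = (h, k)" "h \<in> C.rows" by (cases x) (auto simp: C.carrier_L)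
    have "lc h \<otimes> s [^] k = \<one> \<otimes> s [^] (0::int)" using 1 by (simp add: \<Phi>_def x)
    then have lk: "lc h = \<one>" "k = 0" using decompose_unique[OF lcV V_one] by blast+
    have "h j i = 0" if i: "i < r" for j i
    proof -
      have "laurent_width p (C.row_poly h i) = 0"
        using y(3) lk i by (auto simp: M.independent_def lc_def)
      then have "int p dvd h j i" using C.lookup_row_poly[OF x(2) i] by (simp add: laurent_width_eq_0_iff)
      then show ?thesis using C.rows_mod[OF x(2) i, of j] by (simp add: dvd_eq_mod_eq_0)
    qed
    then have "h = (\<lambda>j. C.zero_row)" using x(2) C.zero_rows by (intro C.rows_eqI) auto
    then show "x = \<one>\<^bsub>lamplighter r p\<^esub>" using x lk by (simp add: C.one_L)
  qed
  then show ?thesis unfolding is_iso_def by blast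
qed

end

section \<open>Rank and elementary abelian quotients\<close>

definition maps_onto :: "('a, 'm) monoid_scheme \<Rightarrow> ('b, 'k) monoid_scheme \<Rightarrow> bool" where
  "maps_onto G H \<longleftrightarrow> (\<exists>f \<in> hom G H. f ` carrier G = carrier H)"

lemma maps_onto_trans:
  assumes "maps_onto G H" "maps_onto H K"
  shows "maps_onto G K"
proof -
  obtain f g where "f \<in> hom G H" "f ` carrier G = carrier H" "g \<in> hom H K" "g ` carrier H = carrier K"
    using assms unfolding maps_onto_def by blast
  then have "g \<circ> f \<in> hom G K" "(g \<circ> f) ` carrier G = carrier K"
    using hom_compose[of f G H g K] by (simp, metis image_comp)
  then show ?thesis unfolding maps_onto_def by blast
qed

lemma is_iso_imp_maps_onto: "G \<cong> H \<Longrightarrow> maps_onto G H"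
  by (auto simp: is_iso_def iso_def maps_onto_def bij_betw_def)

text \<open>The index set has \<open>m + 1\<close> elements: \<open>m\<close> factors for the
  coordinates of the base and one for the infinite cyclic quotient, so this is the largest
  elementary abelian \<open>p\<close>-quotient of the lamplighter group of rank
  \<open>m\<close>.\<close>

abbreviation elementary_group :: "nat \<Rightarrow> nat \<Rightarrow> (nat \<Rightarrow> int) monoid" where
  "elementary_group m p \<equiv> product_group {..m} (\<lambda>_. integer_mod_group p)"

lemma product_group_nat_pow:
  assumes "x \<in> carrier (product_group I G)"
  shows "x [^]\<^bsub>product_group I G\<^esub> (k::nat) = (\<lambda>i\<in>I. x i [^]\<^bsub>G i\<^esub> k)"
  by (induction k) (auto simp: intro!: restrict_ext)

context concrete_lamplighter begin

text \<open>Summing a coordinate over all positions is insensitive to the shift, hence additive on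
  the whole group. The extra coordinate \<open>n\<close> records the power of
  \<open>t\<close>.\<close>

lemma maps_onto_elementary: "maps_onto L (elementary_group n p)"
proof -
  let ?Q = "elementary_group n p" and ?T = "\<lambda>h. {j. h j \<noteq> zero_row}"
  define S where "S h i = (\<Sum>j\<in>?T h. h j i)" for h :: "int \<Rightarrow> nat \<Rightarrow> int" and i
  define f where "f = (\<lambda>(h, k::int). \<lambda>i\<in>{..n}. (if i < n then S h i else k) mod int p)"
  have Ssup: "S h i = (\<Sum>j\<in>T. h j i)" if "finite T" "?T h \<subseteq> T" "i < n" for T h i
    unfolding S_def using that by (intro sum.mono_neutral_left) auto
  have Smult: "S (\<lambda>j. \<lambda>i\<in>{..<n}. (h j i + h' (j - k) i) mod int p) i mod int p = (S h i + S h' i) mod int p"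
    (is "S ?h i mod _ = _") if h: "h \<in> rows" "h' \<in> rows" and i: "i < n" for h h' k i
  proof -
    let ?A = "(\<lambda>j. j + k) ` ?T h'"
    let ?B = "?T h \<union> ?A"
    have fin: "finite ?A" "finite ?B" using h rows_finite by auto
    have sub: "?T ?h \<subseteq> ?B"
    proof
      fix j assume "j \<in> ?T ?h"
      then obtain i where i: "i < n" "?h j i \<noteq> 0"
        using row_eqI[of "?h j" UNIV zero_row UNIV] by auto
      then have "h j i \<noteq> 0 \<or> h' (j - k) i \<noteq> 0" by auto
      then show "j \<in> ?B" using i by (auto simp: image_iff intro!: exI[of _ "j - k"])
    qed
    have "S h' i = (\<Sum>j\<in>?A. h' (j - k) i)" unfolding S_def by (subst sum.reindex) (auto simp: inj_on_def)
    also have "\<dots> = (\<Sum>j\<in>?B. h' (j - k) i)"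
    proof (rule sum.mono_neutral_left)
      show "\<forall>j\<in>?B - ?A. h' (j - k) i = 0"
      proof
        fix j assume "j \<in> ?B - ?A"
        then have "h' (j - k) = zero_row" by (auto simp: image_iff dest: spec[of _ "j - k"])
        then show "h' (j - k) i = 0" using i by simp
      qed
    qed (use fin in auto)
    finally have S': "S h' i = (\<Sum>j\<in>?B. h' (j - k) i)" .
    have "S ?h i = (\<Sum>j\<in>?B. (h j i + h' (j - k) i) mod int p)"
      using Ssup[OF fin(2) sub i] i by simp
    then have "S ?h i mod int p = (\<Sum>j\<in>?B. h j i + h' (j - k) i) mod int p"
      by (simp add: mod_sum_eq)
    then show ?thesis unfolding S' using Ssup[OF fin(2) _ i, of h] by (simp add: sum.distrib)
  qed
  have "f \<in> hom L ?Q"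
  proof (rule homI)
    fix x assume "x \<in> carrier L"
    then show "f x \<in> carrier ?Q" by (cases x) (auto simp: f_def carrier_integer_mod_group)
  next
    fix x x' assume "x \<in> carrier L" "x' \<in> carrier L"
    then obtain h k h' k' where *: "x = (h, k)" "x' = (h', k')" "h \<in> rows" "h' \<in> rows"
      by (cases x; cases x') (auto simp: carrier_L)
    show "f (x \<otimes>\<^bsub>L\<^esub> x') = f x \<otimes>\<^bsub>?Q\<^esub> f x'"
      unfolding * mult_L f_def using Smult[OF *(3,4), of _ k]
      by (auto intro!: restrict_ext simp: mod_add_eq)
  qed
  moreover have "x \<in> f ` carrier L" if x: "x \<in> carrier ?Q" for x
  proof -
    have xr: "0 \<le> x i \<and> x i < int p" if "i \<le> n" for i
    proof -
      have "x i \<in> carrier (integer_mod_group p)" using x that by auto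
      then show ?thesis using p_pos by (simp add: carrier_integer_mod_group del: p_pos)
    qed
    let ?h = "\<lambda>j. \<lambda>i\<in>{..<n}. (if j = 0 then x i else 0) mod int p"
    have h: "?h \<in> rows" by (rule rowsI[of "{0}"]) (auto split: if_splits)
    have T: "?T ?h \<subseteq> {0}" by (auto simp: zero_row_def)
    have "f (?h, x n) = x"
    proof (rule PiE_ext[of _ "{..n}" "\<lambda>_. UNIV"])
      fix i assume i: "i \<in> {..n}"
      have "S ?h i = x i" if "i < n" using Ssup[OF _ T that] that xr[of i] by simp
      then show "f (?h, x n) i = x i" using i xr[of i] by (cases "i = n") (auto simp: f_def)
    qed (use x in \<open>auto simp: f_def PiE_iff\<close>)
    then have "x = f (?h, x n)" ..
    moreover have "(?h, x n) \<in> carrier L" using h by (simp add: carrier_L)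
    ultimately show ?thesis by (rule image_eqI)
  qed
  ultimately show ?thesis unfolding maps_onto_def hom_def by (intro bexI[of _ f]) (auto simp: hom_def)
qed

text \<open>The images of \<open>n + 1\<close> generators produce at most \<open>p^(n+1)\<close>
  elements in a commutative group of exponent \<open>p\<close>, whereas the target has
  \<open>p^(m+1)\<close>.\<close>

lemma elementary_rank_le:
  assumes "maps_onto L (elementary_group m p)"
  shows "m \<le> n"
proof -
  let ?Q = "elementary_group m p"
  obtain f where f: "f \<in> hom L ?Q" "f ` carrier L = carrier ?Q" using assms unfolding maps_onto_def by blast
  interpret Q: comm_group ?Q
    by (rule group.group_comm_groupI) (auto simp: add.commute)
  interpret f: group_hom L ?Q f using f by (simp add: group_hom_def group_hom_axioms_def L_group Q.is_group)
  have gen: "generate ?Q (f ` gens) = carrier ?Q"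
    using f.generate_img[OF gens_closed] generate_gens f(2) by simp
  have "card (carrier ?Q) \<le> p ^ card (f ` gens)"
  proof (rule conjunct2[OF Q.finite_generated_exponent[OF _ _ gen]])
    show "finite (f ` gens)" using card_gens by simp
    show "f ` gens \<subseteq> carrier ?Q" using gens_closed f(2) by blast
    show "x [^]\<^bsub>?Q\<^esub> p = \<one>\<^bsub>?Q\<^esub>" if "x \<in> carrier ?Q" for x
      using product_group_nat_pow[OF that, of p] by simp
  qed simp
  moreover have "card (f ` gens) \<le> Suc n" using card_image_le[of gens f] card_gens by linarith
  moreover have "card (carrier ?Q) = p ^ Suc m" by (simp add: card_PiE carrier_integer_mod_group)
  moreover have "1 < p" using p_prime by (rule prime_gt_1_nat)
  ultimately have "p ^ Suc m \<le> p ^ Suc n" by (metis le_trans p_pos power_increasing Suc_leI One_nat_def)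
  then show ?thesis using \<open>1 < p\<close> by (simp add: power_increasing_iff del: power_Suc)
qed

end

section \<open>Profinite completions\<close>

context group begin

lemma carrier_finite_index_normal: "carrier G \<in> finite_index_normal G"
proof -
  have "rcosets (carrier G) \<subseteq> {carrier G}"
    using coset_join2[OF _ subgroup_self] by (auto simp: RCOSETS_def)
  then show ?thesis using normal_self finite_subset by (auto simp: finite_index_normal_def)
qed

text \<open>The intersection is the kernel of the map into the product of the two finite
  quotients.\<close>

lemma Int_finite_index_normal:
  assumes "N \<in> finite_index_normal G" "M \<in> finite_index_normal G"
  shows "N \<inter> M \<in> finite_index_normal G"
proof -
  have n: "N \<lhd> G" "M \<lhd> G" and fin: "finite (carrier (G Mod N))" "finite (carrier (G Mod M))"
    using assms by (auto simp: finite_index_normal_def FactGroup_def)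
  let ?Q = "(G Mod N) \<times>\<times> (G Mod M)" and ?f = "\<lambda>g. (N #> g, M #> g)"
  have Q: "group ?Q" using n normal.factorgroup_is_group by (blast intro: DirProd_group)
  have f: "?f \<in> hom G ?Q"
    using normal.r_coset_hom_Mod[OF n(1)] normal.r_coset_hom_Mod[OF n(2)]
    by (auto simp: hom_def)
  have "?f ` carrier G \<subseteq> carrier (G Mod N) \<times> carrier (G Mod M)" by (auto simp: carrier_FactGroup)
  then have "kernel G ?Q ?f \<in> finite_index_normal G"
    using finite_index_normalI[OF f Q] fin finite_subset by (metis finite_cartesian_product)
  moreover have "kernel G ?Q ?f = N \<inter> M"
  proof -
    have "N #> g = N \<longleftrightarrow> g \<in> N" "M #> g = M \<longleftrightarrow> g \<in> M" if "g \<in> carrier G" for g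
      using that n coset_join1 coset_join2 normal_imp_subgroup subgroup.subset by metis+
    then show ?thesis using n[THEN normal_imp_subgroup, THEN subgroup.subset]
      by (auto simp: kernel_def)
  qed
  ultimately show ?thesis by simp
qed

lemma Inter_finite_index_normal:
  assumes "finite F" "F \<subseteq> finite_index_normal G"
  obtains M where "M \<in> finite_index_normal G" "\<And>N. N \<in> F \<Longrightarrow> M \<subseteq> N"
  using assms
proof (induction F arbitrary: thesis rule: finite_induct)
  case empty
  then show ?case using carrier_finite_index_normal by blast
next
  case (insert N F)
  then obtain M where M: "M \<in> finite_index_normal G" "\<And>N. N \<in> F \<Longrightarrow> M \<subseteq> N" by auto
  then show ?case using insert.prems(1)[of "N \<inter> M"] insert.prems(2) Int_finite_index_normal by blast
qed

lemma mem_finite_index_normal: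
  assumes "N \<in> finite_index_normal G"
  shows "N \<lhd> G" "subgroup N G"
  using assms normal_imp_subgroup by (auto simp: finite_index_normal_def)

lemma set_mult_r_coset:
  assumes "subgroup N G" "subgroup M G" "N \<subseteq> M" "g \<in> carrier G"
  shows "M <#> (N #> g) = M #> g"
proof -
  have "M <#> N = M"
  proof
    show "M <#> N \<subseteq> M" using assms(2,3) subgroup.m_closed by (fastforce simp: set_mult_def)
    show "M \<subseteq> M <#> N"
    proof
      fix m assume "m \<in> M"
      then have "m = m \<otimes> \<one>" "\<one> \<in> N" using assms(1,2) subgroup.one_closed subgroup.mem_carrier by fastforce+
      then show "m \<in> M <#> N" using \<open>m \<in> M\<close> unfolding set_mult_def by blast
    qed
  qed
  then show ?thesis
    using setmult_rcos_assoc[of M N g] assms subgroup.subset by metis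
qed

end

lemma carrier_profinite_completion:
  "carrier (profinite_completion G) = {x \<in> \<Pi>\<^sub>E N\<in>finite_index_normal G. carrier (G Mod N).
     \<forall>N\<in>finite_index_normal G. \<forall>M\<in>finite_index_normal G. N \<subseteq> M \<longrightarrow> M <#>\<^bsub>G\<^esub> x N = x M}"
  by (simp add: profinite_completion_def)

lemma mult_profinite_completion:
  "N \<in> finite_index_normal G \<Longrightarrow> (x \<otimes>\<^bsub>profinite_completion G\<^esub> y) N = x N <#>\<^bsub>G\<^esub> y N"
  by (simp add: profinite_completion_def)

lemma topspace_profinite_topology: "topspace (profinite_topology G) = carrier (profinite_completion G)"
  by (auto simp: profinite_topology_def carrier_profinite_completion topspace_subtopology)

definition profinite_embed :: "('a, 'm) monoid_scheme \<Rightarrow> 'a \<Rightarrow> 'a set \<Rightarrow> 'a set" where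
  "profinite_embed G g = (\<lambda>N\<in>finite_index_normal G. N #>\<^bsub>G\<^esub> g)"

context group begin

lemma profinite_embed_closed:
  assumes "g \<in> carrier G"
  shows "profinite_embed G g \<in> carrier (profinite_completion G)"
  using assms mem_finite_index_normal(2) set_mult_r_coset
  by (auto simp: carrier_profinite_completion profinite_embed_def carrier_FactGroup)

lemma profinite_coord:
  assumes "x \<in> carrier (profinite_completion G)" "N \<in> finite_index_normal G"
  obtains g where "g \<in> carrier G" "x N = N #> g"
  using assms by (fastforce simp: carrier_profinite_completion PiE_iff carrier_FactGroup)

lemma profinite_coord_mono:
  "x \<in> carrier (profinite_completion G) \<Longrightarrow> N \<in> finite_index_normal G \<Longrightarrow> M \<in> finite_index_normal G
    \<Longrightarrow> N \<subseteq> M \<Longrightarrow> M <#> x N = x M"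
  by (simp add: carrier_profinite_completion)

lemma profinite_mult_closed:
  assumes "x \<in> carrier (profinite_completion G)" "y \<in> carrier (profinite_completion G)"
  shows "x \<otimes>\<^bsub>profinite_completion G\<^esub> y \<in> carrier (profinite_completion G)"
proof -
  have cos: "\<exists>g\<in>carrier G. \<exists>h\<in>carrier G. x N = N #> g \<and> y N = N #> h \<and>
      x N <#> y N = N #> (g \<otimes> h)" if "N \<in> finite_index_normal G" for N
    using profinite_coord[OF assms(1) that] profinite_coord[OF assms(2) that]
      normal.rcos_sum[OF mem_finite_index_normal(1)[OF that]] by metis
  have "M <#> (x N <#> y N) = x M <#> y M"
    if N: "N \<in> finite_index_normal G" and M: "M \<in> finite_index_normal G" and "N \<subseteq> M" for N M
  proof -
    obtain g h where gh: "g \<in> carrier G" "h \<in> carrier G" "x N = N #> g" "y N = N #> h"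
      "x N <#> y N = N #> (g \<otimes> h)" using cos[OF N] by blast
    note s = set_mult_r_coset[OF mem_finite_index_normal(2)[OF N] mem_finite_index_normal(2)[OF M] that(3)]
    have "x M = M #> g" "y M = M #> h"
      using profinite_coord_mono[OF assms(1) N M that(3)] profinite_coord_mono[OF assms(2) N M that(3)] gh s
      by simp_all
    then show ?thesis using gh s normal.rcos_sum[OF mem_finite_index_normal(1)[OF M]] by simp
  qed
  moreover have "x N <#> y N \<in> carrier (G Mod N)" if N: "N \<in> finite_index_normal G" for N
    using cos[OF N] by (auto simp: carrier_FactGroup)
  moreover have "x \<otimes>\<^bsub>profinite_completion G\<^esub> y \<in> extensional (finite_index_normal G)"
    by (simp add: profinite_completion_def)
  ultimately show ?thesis
    by (auto simp: carrier_profinite_completion PiE_iff mult_profinite_completion)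
qed

lemma profinite_embed_mult:
  assumes "g \<in> carrier G" "h \<in> carrier G"
  shows "profinite_embed G (g \<otimes> h) = profinite_embed G g \<otimes>\<^bsub>profinite_completion G\<^esub> profinite_embed G h"
  using assms normal.rcos_sum[OF mem_finite_index_normal(1)]
  by (auto simp: profinite_embed_def profinite_completion_def intro!: restrict_ext)

text \<open>A basic neighbourhood of \<open>y\<close> restricts finitely many coordinates, and all
  of these are determined by the single coordinate at a finite index normal subgroup contained in
  those involved.\<close>

lemma continuous_profinite_coord:
  assumes f: "continuous_map (profinite_topology G) (profinite_topology H) f"
    and y: "y \<in> carrier (profinite_completion G)" and N: "N \<in> finite_index_normal H"
  obtains M where "M \<in> finite_index_normal G"
    "\<And>x. x \<in> carrier (profinite_completion G) \<Longrightarrow> x M = y M \<Longrightarrow> f x N = f y N"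
proof -
  let ?T = "\<lambda>N. discrete_topology (carrier (G Mod N))"
  have "continuous_map (profinite_topology H) (discrete_topology (carrier (H Mod N))) (\<lambda>x. x N)"
    unfolding profinite_topology_def
    by (intro continuous_map_from_subtopology continuous_map_product_coordinates N)
  then have "continuous_map (profinite_topology G) (discrete_topology (carrier (H Mod N))) (\<lambda>x. f x N)"
    using continuous_map_compose[OF f] by (force simp: o_def)
  then have c: "continuous_map (profinite_topology G) (discrete_topology (carrier (H Mod N))) (\<lambda>x. f x N)" .
  have "f y N \<in> carrier (H Mod N)"
    using c y by (auto simp: continuous_map_def topspace_profinite_topology)
  then have "openin (profinite_topology G) {x \<in> topspace (profinite_topology G). f x N \<in> {f y N}}"
    by (intro openin_continuous_map_preimage[OF c]) simp
  then obtain U where U: "openin (product_topology ?T (finite_index_normal G)) U"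
    "{x \<in> carrier (profinite_completion G). f x N = f y N} = U \<inter> carrier (profinite_completion G)"
    unfolding topspace_profinite_topology unfolding profinite_topology_def openin_subtopology by auto
  have yU: "y \<in> U" using U(2) y by blast
  from product_topology_open_contains_basis[OF U(1) yU]
  obtain X where X: "y \<in> Pi\<^sub>E (finite_index_normal G) X"
    "finite {i. X i \<noteq> topspace (?T i)}" "Pi\<^sub>E (finite_index_normal G) X \<subseteq> U"
    by blast
  let ?J = "finite_index_normal G \<inter> {i. X i \<noteq> topspace (?T i)}"
  obtain M where M: "M \<in> finite_index_normal G" "\<And>N. N \<in> ?J \<Longrightarrow> M \<subseteq> N"
    by (rule Inter_finite_index_normal[OF finite_Int[OF disjI2[OF X(2)]] Int_lower1]) (rule that)
  have "f x N = f y N" if x: "x \<in> carrier (profinite_completion G)" "x M = y M" for x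
  proof -
    have "x i \<in> X i" if i: "i \<in> finite_index_normal G" for i
    proof (cases "X i = topspace (?T i)")
      case True
      then show ?thesis using x i by (auto simp: carrier_profinite_completion)
    next
      case False
      then have "M \<subseteq> i" using M(2) i by blast
      then have "x i = y i"
        using profinite_coord_mono[OF x(1) M(1) i] profinite_coord_mono[OF y M(1) i] x(2) by simp
      then show ?thesis using X(1) i by auto
    qed
    moreover have "x \<in> extensional (finite_index_normal G)"
      using x by (auto simp: carrier_profinite_completion PiE_iff)
    ultimately have "x \<in> Pi\<^sub>E (finite_index_normal G) X" by (auto simp: PiE_iff)
    then have "x \<in> U" using X(3) by (rule rev_subsetD)
    then show ?thesis using U(2) x by blast
  qed
  then show thesis using that M(1) by blast
qed

end

text \<open>The relation \<open>rel N d g\<close> says that \<open>g\<close> represents the image of \<open>d\<close> under the map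
  \<open>H \<rightarrow> G/N\<close> obtained from a topological isomorphism of the profinite completions.\<close>

locale quotient_link = G: group G + H: group H
  for G :: "('a, 'm) monoid_scheme" (structure) and H :: "('b, 'k) monoid_scheme" +
  fixes rel :: "'a set \<Rightarrow> 'b \<Rightarrow> 'a \<Rightarrow> bool"
  assumes rel_closed: "rel N d g \<Longrightarrow> d \<in> carrier H \<and> g \<in> carrier G"
    and rel_total: "N \<in> finite_index_normal G \<Longrightarrow> d \<in> carrier H \<Longrightarrow> \<exists>g. rel N d g"
    and rel_surj: "N \<in> finite_index_normal G \<Longrightarrow> g \<in> carrier G \<Longrightarrow> \<exists>d. rel N d g"
    and rel_mult: "N \<in> finite_index_normal G \<Longrightarrow> rel N d g \<Longrightarrow> rel N d' g' \<Longrightarrow> rel N (d \<otimes>\<^bsub>H\<^esub> d') (g \<otimes> g')"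
    and rel_one_iff: "N \<in> finite_index_normal G \<Longrightarrow> rel N \<one>\<^bsub>H\<^esub> g \<longleftrightarrow> g \<in> N"
    and rel_mono: "N \<in> finite_index_normal G \<Longrightarrow> M \<in> finite_index_normal G \<Longrightarrow> N \<subseteq> M \<Longrightarrow> rel N d g \<Longrightarrow> rel M d g"
    and rel_cofinal: "D \<in> finite_index_normal H \<Longrightarrow> \<exists>N\<in>finite_index_normal G. \<forall>d. rel N d \<one> \<longrightarrow> d \<in> D"

text \<open>The map \<open>\<theta>\<close> sends \<open>H\<close> into the completion of
  \<open>G\<close>. Continuity of \<open>\<psi>\<close> shows that \<open>H\<close> reaches every
  coset at each level, which is \<open>rel_surj\<close>; continuity of \<open>\<phi>\<close> gives
  \<open>rel_cofinal\<close>, that is, each finite quotient of \<open>H\<close> is already seen at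
  some level of \<open>G\<close>.\<close>

lemma profinite_completions_iso_link:
  assumes G: "group G" and H: "group H" and iso: "profinite_completions_iso G H"
  obtains rel where "quotient_link G H rel"
proof -
  interpret G: group G by (rule G)
  interpret H: group H by (rule H)
  let ?P = "profinite_completion G" and ?R = "profinite_completion H"
  obtain \<phi> where \<phi>: "\<phi> \<in> iso ?P ?R" "homeomorphic_map (profinite_topology G) (profinite_topology H) \<phi>"
    using iso unfolding profinite_completions_iso_def by blast
  then obtain \<psi> where "homeomorphic_maps (profinite_topology G) (profinite_topology H) \<phi> \<psi>"
    using homeomorphic_map_maps by blast
  then have c: "continuous_map (profinite_topology G) (profinite_topology H) \<phi>"
      "continuous_map (profinite_topology H) (profinite_topology G) \<psi>"
    and \<psi>\<phi>: "\<And>x. x \<in> carrier ?P \<Longrightarrow> \<psi> (\<phi> x) = x" and \<phi>\<psi>: "\<And>y. y \<in> carrier ?R \<Longrightarrow> \<phi> (\<psi> y) = y"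
    unfolding homeomorphic_maps_def topspace_profinite_topology by blast+
  have \<psi>c: "\<psi> y \<in> carrier ?P" if "y \<in> carrier ?R" for y
    using c(2) that by (auto simp: continuous_map_def topspace_profinite_topology)
  have \<phi>c: "\<phi> x \<in> carrier ?R" if "x \<in> carrier ?P" for x
    using c(1) that by (auto simp: continuous_map_def topspace_profinite_topology)
  have \<psi>m: "\<psi> (x \<otimes>\<^bsub>?R\<^esub> y) = \<psi> x \<otimes>\<^bsub>?P\<^esub> \<psi> y" if "x \<in> carrier ?R" "y \<in> carrier ?R" for x y
  proof -
    have "\<phi> (\<psi> x \<otimes>\<^bsub>?P\<^esub> \<psi> y) = x \<otimes>\<^bsub>?R\<^esub> y"
      using \<phi>(1) \<psi>c that \<phi>\<psi> by (simp add: iso_def hom_def)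
    then show ?thesis using \<psi>\<phi>[OF G.profinite_mult_closed[OF \<psi>c \<psi>c]] that by metis
  qed
  define \<theta> where "\<theta> d = \<psi> (profinite_embed H d)" for d
  have \<theta>c: "\<theta> d \<in> carrier ?P" if "d \<in> carrier H" for d
    using \<psi>c H.profinite_embed_closed that by (simp add: \<theta>_def)
  have \<theta>m: "\<theta> (d \<otimes>\<^bsub>H\<^esub> d') N = \<theta> d N <#>\<^bsub>G\<^esub> \<theta> d' N"
    if "d \<in> carrier H" "d' \<in> carrier H" "N \<in> finite_index_normal G" for d d' N
    using that by (simp add: \<theta>_def H.profinite_embed_mult \<psi>m H.profinite_embed_closed mult_profinite_completion)
  have \<theta>1: "\<theta> \<one>\<^bsub>H\<^esub> N = N" if N: "N \<in> finite_index_normal G" for N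
  proof -
    interpret Q: group "G Mod N"
      using normal.factorgroup_is_group[OF G.mem_finite_index_normal(1)[OF N]] .
    have "\<theta> \<one>\<^bsub>H\<^esub> N \<in> carrier (G Mod N)"
      using \<theta>c[of "\<one>\<^bsub>H\<^esub>"] N by (auto simp: carrier_profinite_completion)
    \<comment> \<open>The only idempotent of a group is its neutral element.\<close>
    moreover have "\<theta> \<one>\<^bsub>H\<^esub> N \<otimes>\<^bsub>G Mod N\<^esub> \<theta> \<one>\<^bsub>H\<^esub> N = \<theta> \<one>\<^bsub>H\<^esub> N"
      using \<theta>m[of "\<one>\<^bsub>H\<^esub>" "\<one>\<^bsub>H\<^esub>" N] N by simp
    ultimately show ?thesis using Q.r_cancel_one' one_FactGroup by metis
  qed
  define rel where "rel N d g \<longleftrightarrow> d \<in> carrier H \<and> g \<in> carrier G \<and> \<theta> d N = N #>\<^bsub>G\<^esub> g" for N d g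
  have "quotient_link G H rel"
  proof (intro quotient_link.intro G H quotient_link_axioms.intro)
    fix N d assume "N \<in> finite_index_normal G" "d \<in> carrier H"
    then show "\<exists>g. rel N d g" using G.profinite_coord[OF \<theta>c] unfolding rel_def by metis
  next
    fix N g assume N: "N \<in> finite_index_normal G" and g: "g \<in> carrier G"
    \<comment> \<open>This point of the completion need not come from \<open>H\<close>. It suffices
      to agree with it at the level \<open>M\<close> on which coordinate \<open>N\<close> of its
      image under \<open>\<psi>\<close> depends.\<close>
    let ?y = "\<phi> (profinite_embed G g)"
    have e: "profinite_embed G g \<in> carrier ?P" using G.profinite_embed_closed[OF g] .
    obtain M where M: "M \<in> finite_index_normal H"
      "\<And>x. x \<in> carrier ?R \<Longrightarrow> x M = ?y M \<Longrightarrow> \<psi> x N = \<psi> ?y N"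
      using H.continuous_profinite_coord[OF c(2) \<phi>c[OF e] N] by metis
    obtain d where d: "d \<in> carrier H" "?y M = M #>\<^bsub>H\<^esub> d" using H.profinite_coord[OF \<phi>c[OF e] M(1)] by metis
    have "\<theta> d N = \<psi> ?y N" unfolding \<theta>_def
      by (rule M(2)) (use d M(1) H.profinite_embed_closed in \<open>auto simp: profinite_embed_def\<close>)
    also have "\<dots> = N #>\<^bsub>G\<^esub> g" using \<psi>\<phi>[OF e] N by (simp add: profinite_embed_def)
    finally show "\<exists>d. rel N d g" using d g unfolding rel_def by blast
  next
    fix N d g d' g' assume N: "N \<in> finite_index_normal G" and "rel N d g" "rel N d' g'"
    then show "rel N (d \<otimes>\<^bsub>H\<^esub> d') (g \<otimes>\<^bsub>G\<^esub> g')"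
      using \<theta>m normal.rcos_sum[OF G.mem_finite_index_normal(1)[OF N]] unfolding rel_def by simp
  next
    fix N g assume N: "N \<in> finite_index_normal G"
    show "rel N \<one>\<^bsub>H\<^esub> g \<longleftrightarrow> g \<in> N"
    proof
      assume "rel N \<one>\<^bsub>H\<^esub> g"
      then show "g \<in> N" using \<theta>1[OF N] G.rcos_self G.mem_finite_index_normal(2)[OF N] unfolding rel_def by metis
    next
      assume g: "g \<in> N"
      have gc: "g \<in> carrier G" using g subgroup.mem_carrier G.mem_finite_index_normal(2)[OF N] by metis
      show "rel N \<one>\<^bsub>H\<^esub> g"
        using \<theta>1[OF N] G.coset_join2[OF gc G.mem_finite_index_normal(2)[OF N] g] gc unfolding rel_def by simp
    qed
  next
    fix N M d g assume *: "N \<in> finite_index_normal G" "M \<in> finite_index_normal G" "N \<subseteq> M" "rel N d g"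
    then have "\<theta> d M = M <#>\<^bsub>G\<^esub> (N #>\<^bsub>G\<^esub> g)"
      using G.profinite_coord_mono[OF \<theta>c[of d] *(1,2,3)] unfolding rel_def by simp
    then show "rel M d g"
      using * G.set_mult_r_coset[OF G.mem_finite_index_normal(2)[OF *(1)] G.mem_finite_index_normal(2)[OF *(2)] *(3)]
      unfolding rel_def by simp
  next
    fix M assume M: "M \<in> finite_index_normal H"
    obtain N where N: "N \<in> finite_index_normal G"
      "\<And>x. x \<in> carrier ?P \<Longrightarrow> x N = \<theta> \<one>\<^bsub>H\<^esub> N \<Longrightarrow> \<phi> x M = \<phi> (\<theta> \<one>\<^bsub>H\<^esub>) M"
      using G.continuous_profinite_coord[OF c(1) \<theta>c[OF H.one_closed] M] by metis
    have emb: "\<phi> (\<theta> d) M = M #>\<^bsub>H\<^esub> d" if "d \<in> carrier H" for d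
      using \<phi>\<psi>[OF H.profinite_embed_closed[OF that]] M by (simp add: \<theta>_def profinite_embed_def)
    have "d \<in> M" if r: "rel N d \<one>\<^bsub>G\<^esub>" for d
    proof -
      have d: "d \<in> carrier H" "\<theta> d N = N"
        using r G.coset_mult_one subgroup.subset[OF G.mem_finite_index_normal(2)[OF N(1)]] unfolding rel_def by auto
      have "\<phi> (\<theta> d) M = \<phi> (\<theta> \<one>\<^bsub>H\<^esub>) M" using N(2)[OF \<theta>c[OF d(1)]] d(2) \<theta>1[OF N(1)] by simp
      then have "M #>\<^bsub>H\<^esub> d = M #>\<^bsub>H\<^esub> \<one>\<^bsub>H\<^esub>" using emb[OF d(1)] emb[OF H.one_closed] by simp
      also have "\<dots> = M" using subgroup.subset[OF H.mem_finite_index_normal(2)[OF M]] by simp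
      finally show ?thesis using H.rcos_self[OF d(1) H.mem_finite_index_normal(2)[OF M]] by simp
    qed
    then show "\<exists>N\<in>finite_index_normal G. \<forall>d. rel N d \<one>\<^bsub>G\<^esub> \<longrightarrow> d \<in> M" using N(1) by blast
  qed (auto simp: rel_def)
  then show thesis by (rule that)
qed

section \<open>Transfer of finite quotients along the relation\<close>

lemma maps_ontoI_relation:
  assumes R: "\<And>x q. R x q \<Longrightarrow> x \<in> carrier A \<and> q \<in> carrier Q"
    and tot: "\<And>x. x \<in> carrier A \<Longrightarrow> \<exists>q. R x q"
    and uniq: "\<And>x q q'. R x q \<Longrightarrow> R x q' \<Longrightarrow> q = q'"
    and mult: "\<And>x q y r. R x q \<Longrightarrow> R y r \<Longrightarrow> R (x \<otimes>\<^bsub>A\<^esub> y) (q \<otimes>\<^bsub>Q\<^esub> r)"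
    and surj: "\<And>q. q \<in> carrier Q \<Longrightarrow> \<exists>x. R x q"
  shows "maps_onto A Q"
proof -
  define f where "f x = (THE q. R x q)" for x
  have f: "f x = q" if "R x q" for x q
    unfolding f_def using that uniq by (intro the_equality) auto
  have "f \<in> hom A Q"
  proof (rule homI)
    fix x assume "x \<in> carrier A"
    then show "f x \<in> carrier Q" using tot f R by metis
  next
    fix x y assume "x \<in> carrier A" "y \<in> carrier A"
    then obtain q r where qr: "R x q" "R y r" using tot by blast
    show "f (x \<otimes>\<^bsub>A\<^esub> y) = f x \<otimes>\<^bsub>Q\<^esub> f y" using f[OF qr(1)] f[OF qr(2)] f[OF mult[OF qr]] by simp
  qed
  moreover have "f ` carrier A = carrier Q"
  proof
    show "f ` carrier A \<subseteq> carrier Q" using calculation by (auto simp: hom_def)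
    show "carrier Q \<subseteq> f ` carrier A"
    proof
      fix q assume "q \<in> carrier Q"
      then obtain x where x: "R x q" using surj by blast
      then show "q \<in> f ` carrier A" using f[OF x] R[OF x] by blast
    qed
  qed
  ultimately show ?thesis unfolding maps_onto_def by blast
qed

context quotient_link begin

lemma rel_inv:
  assumes N: "N \<in> finite_index_normal G" and r: "rel N d g"
  shows "rel N (inv\<^bsub>H\<^esub> d) (inv g)"
proof -
  have c: "d \<in> carrier H" "g \<in> carrier G" using rel_closed[OF r] by auto
  obtain g' where g': "rel N (inv\<^bsub>H\<^esub> d) g'" using rel_total[OF N] c by blast
  have g'c: "g' \<in> carrier G" using rel_closed[OF g'] by blast
  have "rel N \<one>\<^bsub>H\<^esub> (g' \<otimes> g)" using rel_mult[OF N g' r] c by simp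
  then have "g' \<otimes> g \<in> N" using rel_one_iff[OF N] by blast
  then have "inv (g' \<otimes> g) \<in> N" using subgroup.m_inv_closed G.mem_finite_index_normal(2)[OF N] by metis
  then have "rel N \<one>\<^bsub>H\<^esub> (inv (g' \<otimes> g))" using rel_one_iff[OF N] by blast
  \<comment> \<open>The arbitrary representative \<open>g'\<close> is corrected by an element of
    \<open>N\<close>, and the product collapses to the inverse of \<open>g\<close>.\<close>
  then have "rel N (\<one>\<^bsub>H\<^esub> \<otimes>\<^bsub>H\<^esub> inv\<^bsub>H\<^esub> d) (inv (g' \<otimes> g) \<otimes> g')" using rel_mult[OF N _ g'] by blast
  then show ?thesis using c g'c by (simp add: G.inv_mult_group G.m_assoc)
qed

lemma rel_diff:
  assumes N: "N \<in> finite_index_normal G" and r: "rel N d g" "rel N d g'"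
  shows "g \<otimes> inv g' \<in> N"
proof -
  have "rel N (d \<otimes>\<^bsub>H\<^esub> inv\<^bsub>H\<^esub> d) (g \<otimes> inv g')" by (rule rel_mult[OF N r(1) rel_inv[OF N r(2)]])
  then show ?thesis using rel_closed[OF r(1)] rel_one_iff[OF N] by simp
qed

lemma rel_one: "N \<in> finite_index_normal G \<Longrightarrow> rel N \<one>\<^bsub>H\<^esub> \<one>"
  using rel_one_iff subgroup.one_closed[OF G.mem_finite_index_normal(2)] by blast

lemma rel_nat_pow:
  assumes "N \<in> finite_index_normal G" "rel N d g"
  shows "rel N (d [^]\<^bsub>H\<^esub> (k::nat)) (g [^] k)"
proof (induction k)
  case (Suc k)
  show ?case using rel_mult[OF assms(1) Suc assms(2)] by simp
qed (simp add: rel_one[OF assms(1)])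

lemma rel_int_pow:
  assumes "N \<in> finite_index_normal G" "rel N d g"
  shows "rel N (d [^]\<^bsub>H\<^esub> (k::int)) (g [^] k)"
proof (cases "k < 0")
  case True
  then show ?thesis
    using rel_inv[OF assms(1) rel_nat_pow[OF assms, of "nat (- k)"]]
    unfolding int_pow_def2[of H d k] int_pow_def2[of G g k] by (simp only: if_True)
next
  case False
  then show ?thesis using rel_nat_pow[OF assms, of "nat k"]
    unfolding int_pow_def2[of H d k] int_pow_def2[of G g k] by (simp only: if_False)
qed

text \<open>The quotient map of \<open>G\<close> has a kernel \<open>N\<close> of finite index;
  following the map from \<open>H\<close> to \<open>G/N\<close> by it gives the quotient of
  \<open>H\<close>.\<close>

lemma maps_onto_transfer:
  assumes Q: "group Q" "finite (carrier Q)" and m: "maps_onto G Q"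
  shows "maps_onto H Q"
proof -
  obtain f where f: "f \<in> hom G Q" "f ` carrier G = carrier Q" using m unfolding maps_onto_def by blast
  interpret f: group_hom G Q f using f Q by (simp add: group_hom_def group_hom_axioms_def G.is_group)
  define N where "N = kernel G Q f"
  have N: "N \<in> finite_index_normal G" unfolding N_def using G.finite_index_normalI[OF f(1) Q(1)] f(2) Q(2) by simp
  show ?thesis
  proof (rule maps_ontoI_relation[where R = "\<lambda>d q. \<exists>g. rel N d g \<and> q = f g"])
    fix d q assume "\<exists>g. rel N d g \<and> q = f g"
    then show "d \<in> carrier H \<and> q \<in> carrier Q" using rel_closed by auto
  next
    fix d assume "d \<in> carrier H"
    then show "\<exists>q. \<exists>g. rel N d g \<and> q = f g" using rel_total[OF N] by blast
  next
    fix d q q' assume "\<exists>g. rel N d g \<and> q = f g" "\<exists>g. rel N d g \<and> q' = f g"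
    then obtain g g' where g: "rel N d g" "rel N d g'" "q = f g" "q' = f g'" by blast
    have gc: "g \<in> carrier G" "g' \<in> carrier G" using rel_closed g by blast+
    have "f (g \<otimes> inv g') = \<one>\<^bsub>Q\<^esub>" using rel_diff[OF N g(1,2)] by (simp add: N_def kernel_def)
    then have "f g \<otimes>\<^bsub>Q\<^esub> inv\<^bsub>Q\<^esub> f g' = \<one>\<^bsub>Q\<^esub>" using gc by simp
    then show "q = q'" using gc g f.H.inv_equality f.H.inv_inv by (metis f.hom_closed f.H.inv_closed)
  next
    fix d q e r assume "\<exists>g. rel N d g \<and> q = f g" "\<exists>g. rel N e g \<and> r = f g"
    then obtain g h where gh: "rel N d g" "rel N e h" "q = f g" "r = f h" by blast
    then have "f (g \<otimes> h) = q \<otimes>\<^bsub>Q\<^esub> r" using rel_closed by (metis f.hom_mult)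
    then show "\<exists>g. rel N (d \<otimes>\<^bsub>H\<^esub> e) g \<and> q \<otimes>\<^bsub>Q\<^esub> r = f g" using rel_mult[OF N gh(1,2)] by metis
  next
    fix q assume "q \<in> carrier Q"
    then obtain g where "g \<in> carrier G" "q = f g" using f(2) by blast
    then show "\<exists>d. \<exists>g. rel N d g \<and> q = f g" using rel_surj[OF N] by blast
  qed
qed

text \<open>Now \<open>g\<close> is sent to \<open>f d\<close> for any \<open>d\<close> related to
  it. Two choices of \<open>d\<close> differ by an element related to the identity, which
  \<open>f\<close> kills at the level given by \<open>rel_cofinal\<close>.\<close>

lemma maps_onto_transfer_back:
  assumes Q: "group Q" "finite (carrier Q)" and m: "maps_onto H Q"
  shows "maps_onto G Q"
proof -
  obtain f where f: "f \<in> hom H Q" "f ` carrier H = carrier Q" using m unfolding maps_onto_def by blast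
  interpret f: group_hom H Q f using f Q by (simp add: group_hom_def group_hom_axioms_def H.is_group)
  have "kernel H Q f \<in> finite_index_normal H" using H.finite_index_normalI[OF f(1) Q(1)] f(2) Q(2) by simp
  then obtain N where N: "N \<in> finite_index_normal G" "\<And>d. rel N d \<one> \<Longrightarrow> f d = \<one>\<^bsub>Q\<^esub>"
    using rel_cofinal[of "kernel H Q f"] by (auto simp: kernel_def)
  show ?thesis
  proof (rule maps_ontoI_relation[where R = "\<lambda>g q. \<exists>d. rel N d g \<and> q = f d"])
    fix g q assume "\<exists>d. rel N d g \<and> q = f d"
    then show "g \<in> carrier G \<and> q \<in> carrier Q" using rel_closed by auto
  next
    fix g assume "g \<in> carrier G"
    then show "\<exists>q. \<exists>d. rel N d g \<and> q = f d" using rel_surj[OF N(1)] by blast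
  next
    fix g q q' assume "\<exists>d. rel N d g \<and> q = f d" "\<exists>d. rel N d g \<and> q' = f d"
    then obtain d d' where d: "rel N d g" "rel N d' g" "q = f d" "q' = f d'" by blast
    have dc: "d \<in> carrier H" "d' \<in> carrier H" "g \<in> carrier G" using rel_closed d by blast+
    have "rel N (d \<otimes>\<^bsub>H\<^esub> inv\<^bsub>H\<^esub> d') \<one>" using rel_mult[OF N(1) d(1) rel_inv[OF N(1) d(2)]] dc by simp
    then have "f d \<otimes>\<^bsub>Q\<^esub> inv\<^bsub>Q\<^esub> f d' = \<one>\<^bsub>Q\<^esub>" using N(2) dc by fastforce
    then show "q = q'" using dc d f.H.inv_equality f.H.inv_inv by (metis f.hom_closed f.H.inv_closed)
  next
    fix g q h r assume "\<exists>d. rel N d g \<and> q = f d" "\<exists>d. rel N d h \<and> r = f d"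
    then obtain d e where de: "rel N d g" "rel N e h" "q = f d" "r = f e" by blast
    then have "f (d \<otimes>\<^bsub>H\<^esub> e) = q \<otimes>\<^bsub>Q\<^esub> r" using rel_closed by (metis f.hom_mult)
    then show "\<exists>d. rel N d (g \<otimes> h) \<and> q \<otimes>\<^bsub>Q\<^esub> r = f d" using rel_mult[OF N(1) de(1,2)] by metis
  next
    fix q assume "q \<in> carrier Q"
    then obtain d where "d \<in> carrier H" "q = f d" using f(2) by blast
    then show "\<exists>g. \<exists>d. rel N d g \<and> q = f d" using rel_total[OF N(1)] by blast
  qed
qed

end

section \<open>The competing group\<close>

text \<open>Division with remainder by absolute value; this lets \<open>exists_basis\<close> provide
  a basis of the quotient of the competing group by \<open>A\<close>.\<close>

lemma (in comm_group) torsion_free_int_module: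
  assumes "\<And>x k. x \<in> carrier G \<Longrightarrow> 0 < k \<Longrightarrow> x [^] (k::nat) = \<one> \<Longrightarrow> x = \<one>"
  shows "torsion_free_module G (\<lambda>(k::int) x. x [^] k) (\<lambda>k. nat \<bar>k\<bar>)"
proof (intro torsion_free_module.intro group_module.intro group_module_axioms.intro
    torsion_free_module_axioms.intro)
  show "comm_group G" by (rule comm_group_axioms)
  show "x [^] (f * g) = (x [^] g) [^] f" if "x \<in> carrier G" for f g :: int and x
    using that by (simp add: int_pow_pow mult.commute)
  show "\<exists>q. nat \<bar>g - q * f\<bar> < nat \<bar>g\<bar>" if "0 < nat \<bar>f\<bar>" "nat \<bar>f\<bar> \<le> nat \<bar>g\<bar>" for f g :: int
  proof -
    have "\<bar>g mod f\<bar> < \<bar>f\<bar>" using that by (intro abs_mod_less) auto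
    moreover have "g - g div f * f = g mod f" by (rule minus_div_mult_eq_mod)
    ultimately show ?thesis using that by (intro exI[of _ "g div f"]) linarith
  qed
  show "x = \<one>" if x: "x [^] f = \<one>" "x \<in> carrier G" and f: "0 < nat \<bar>f\<bar>" for f :: int and x
  proof (rule assms[OF x(2) f])
    show "x [^] nat \<bar>f\<bar> = \<one>"
      using x unfolding int_pow_def2 by (auto split: if_splits simp: abs_if)
  qed
qed (auto simp: int_pow_distrib int_pow_mult)

context lamplighter_like begin

lemma twisted_pow:
  assumes v: "v \<in> V"
  shows "\<exists>w\<in>V. (v \<otimes> s [^] (j::int)) [^] (k::int) = w \<otimes> s [^] (j * k)"
proof -
  have nat: "\<exists>w\<in>V. (v \<otimes> s [^] j) [^] k = w \<otimes> s [^] (j * int k)" for k :: nat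
  proof (induction k)
    case 0
    then show ?case by (intro bexI[of _ \<one>]) auto
  next
    case (Suc k)
    then obtain w where w: "w \<in> V" "(v \<otimes> s [^] j) [^] k = w \<otimes> s [^] (j * int k)" by blast
    have "(v \<otimes> s [^] j) [^] Suc k = (w \<otimes> act (j * int k) v) \<otimes> s [^] (j * int (Suc k))"
      using w v by (simp add: twisted_mult algebra_simps)
    then show ?case using w v act_in_V by blast
  qed
  have c: "v \<otimes> s [^] j \<in> carrier G" using v by simp
  show ?thesis
  proof (cases k rule: int_cases2)
    case (nonneg n)
    then show ?thesis using nat[of n] by (simp add: int_pow_int)
  next
    case (nonpos n)
    obtain w where w: "w \<in> V" "(v \<otimes> s [^] j) [^] n = w \<otimes> s [^] (j * int n)" using nat by blast
    have "(v \<otimes> s [^] j) [^] k = inv (w \<otimes> s [^] (j * int n))"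
      unfolding nonpos int_pow_neg_int[OF c] w(2) ..
    also have "\<dots> = act (j * k) (inv w) \<otimes> s [^] (j * k)" using w nonpos by (simp add: twisted_inv)
    finally show ?thesis using w act_in_V by blast
  qed
qed

lemma twisted_diff:
  assumes "v \<in> V" "w \<in> V"
  shows "\<exists>x\<in>V. (v \<otimes> s [^] (j::int)) \<otimes> inv (w \<otimes> s [^] (k::int)) = x \<otimes> s [^] (j - k)"
proof -
  have "(v \<otimes> s [^] j) \<otimes> inv (w \<otimes> s [^] k) = (v \<otimes> act j (act (- k) (inv w))) \<otimes> s [^] (j - k)"
    using assms by (simp add: twisted_inv twisted_mult)
  then show ?thesis using assms by (metis V_inv V_mult act_in_V)
qed

lemma twisted_diff_in_K:
  assumes "v \<in> V" "w \<in> V" "(v \<otimes> s [^] (j::int)) \<otimes> inv (w \<otimes> s [^] (k::int)) \<in> K m"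
  shows "m dvd j - k"
  using twisted_diff[OF assms(1,2), of j k] assms(3) mem_K_iff by metis

lemma commutator_in_V:
  assumes "g \<in> carrier G" "h \<in> carrier G"
  shows "(g \<otimes> h) \<otimes> inv (h \<otimes> g) \<in> V"
proof -
  obtain v j w k where *: "v \<in> V" "w \<in> V" "g = v \<otimes> s [^] (j::int)" "h = w \<otimes> s [^] (k::int)"
    using decompose assms by metis
  have "g \<otimes> h = (v \<otimes> act j w) \<otimes> s [^] (j + k)" "h \<otimes> g = (w \<otimes> act k v) \<otimes> s [^] (j + k)"
    using * by (simp_all add: twisted_mult add.commute)
  moreover obtain x where "x \<in> V" "((v \<otimes> act j w) \<otimes> s [^] (j + k)) \<otimes> inv ((w \<otimes> act k v) \<otimes> s [^] (j + k)) = x \<otimes> s [^] (j + k - (j + k))"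
    using twisted_diff[of "v \<otimes> act j w" "w \<otimes> act k v" "j + k" "j + k"] * act_in_V by blast
  ultimately show ?thesis by simp
qed

end

locale lamplighter_link = lamplighter_like G p V s + quotient_link G H rel
  for G :: "('a, 'm) monoid_scheme" (structure) and p V s and H :: "('b, 'k) monoid_scheme" and rel +
  assumes H_residually_finite: "residually_finite H"
    and H_finitely_generated: "finitely_generated H"
begin

text \<open>Testing the closure of \<open>V\<close> at the levels \<open>K m\<close> is enough, as
  these are cofinal.\<close>

definition A :: "'b set" where
  "A = {d \<in> carrier H. \<forall>m>0. \<exists>v\<in>V. rel (K m) d v}"

lemma A_closed [simp]: "d \<in> A \<Longrightarrow> d \<in> carrier H" by (simp only: A_def mem_Collect_eq)

lemma A_rel: "d \<in> A \<Longrightarrow> 0 < m \<Longrightarrow> \<exists>v\<in>V. rel (K m) d v"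
  unfolding A_def by (drule CollectD, drule conjunct2, drule spec, erule mp)

lemma A_I: "d \<in> carrier H \<Longrightarrow> (\<And>m. 0 < m \<Longrightarrow> \<exists>v\<in>V. rel (K m) d v) \<Longrightarrow> d \<in> A"
  unfolding A_def by (intro CollectI conjI allI impI)

text \<open>Residual finiteness of \<open>H\<close> enters here: a nontrivial \<open>d\<close>
  survives in a finite quotient of \<open>H\<close>, which is controlled by some level of
  \<open>G\<close> and hence by some \<open>K m\<close>. Identities in \<open>A\<close> can thus be
  checked on representatives in \<open>V\<close>.\<close>

lemma eq_oneI:
  assumes "d \<in> carrier H" "\<And>m. 0 < m \<Longrightarrow> rel (K m) d \<one>"
  shows "d = \<one>\<^bsub>H\<^esub>"
proof (rule ccontr)
  assume "d \<noteq> \<one>\<^bsub>H\<^esub>"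
  then obtain D where D: "D \<in> finite_index_normal H" "d \<notin> D"
    using H_residually_finite assms(1) unfolding residually_finite_def by blast
  then obtain N where N: "N \<in> finite_index_normal G" "rel N d \<one> \<Longrightarrow> d \<in> D" using rel_cofinal by blast
  obtain m where m: "0 < m" "K m \<subseteq> N" using K_cofinal[OF N(1)] by blast
  show False using rel_mono[OF K_finite_index[OF m(1)] N(1) m(2) assms(2)[OF m(1)]] N(2) D(2) by blast
qed

lemma A_subgroup: "subgroup A H"
proof
  show "A \<subseteq> carrier H" using A_closed by (rule subsetI)
  show "\<one>\<^bsub>H\<^esub> \<in> A" 
    using rel_one[OF K_finite_index] V_one by (blast intro: A_I)
next
  fix a b assume a: "a \<in> A" and b: "b \<in> A"
  have "\<exists>v\<in>V. rel (K m) (a \<otimes>\<^bsub>H\<^esub> b) v" if m: "0 < m" for m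
  proof -
    obtain v w where "v \<in> V" "w \<in> V" "rel (K m) a v" "rel (K m) b w" using A_rel[OF a m] A_rel[OF b m] by blast
    then show ?thesis using rel_mult[OF K_finite_index[OF m]] V_mult by blast
  qed
  then show "a \<otimes>\<^bsub>H\<^esub> b \<in> A" using a b by (intro A_I) auto
next
  fix a assume a: "a \<in> A"
  have "\<exists>v\<in>V. rel (K m) (inv\<^bsub>H\<^esub> a) v" if m: "0 < m" for m
  proof -
    obtain v where "v \<in> V" "rel (K m) a v" using A_rel[OF a m] by blast
    then show ?thesis using rel_inv[OF K_finite_index[OF m]] V_inv by blast
  qed
  then show "inv\<^bsub>H\<^esub> a \<in> A" using a by (intro A_I) auto
qed

text \<open>Commutators of representatives lie in \<open>V\<close> because \<open>V\<close> has a
  cyclic quotient. This gives normality of \<open>A\<close> as well as commutativity of the quotient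
  by it.\<close>

lemma A_commutator:
  assumes "x \<in> carrier H" "y \<in> carrier H"
  shows "(x \<otimes>\<^bsub>H\<^esub> y) \<otimes>\<^bsub>H\<^esub> inv\<^bsub>H\<^esub> (y \<otimes>\<^bsub>H\<^esub> x) \<in> A"
proof -
  have "\<exists>v\<in>V. rel (K m) ((x \<otimes>\<^bsub>H\<^esub> y) \<otimes>\<^bsub>H\<^esub> inv\<^bsub>H\<^esub> (y \<otimes>\<^bsub>H\<^esub> x)) v" if m: "0 < m" for m
  proof -
    note N = K_finite_index[OF m]
    obtain g h where gh: "rel (K m) x g" "rel (K m) y h" using rel_total[OF N] assms by blast
    have "rel (K m) ((x \<otimes>\<^bsub>H\<^esub> y) \<otimes>\<^bsub>H\<^esub> inv\<^bsub>H\<^esub> (y \<otimes>\<^bsub>H\<^esub> x)) ((g \<otimes> h) \<otimes> inv (h \<otimes> g))"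
      by (intro rel_mult[OF N] rel_inv[OF N] gh)
    moreover have "(g \<otimes> h) \<otimes> inv (h \<otimes> g) \<in> V"
      using rel_closed[OF gh(1)] rel_closed[OF gh(2)] by (intro commutator_in_V) auto
    ultimately show ?thesis by blast
  qed
  then show ?thesis using assms by (intro A_I) auto
qed

lemma A_normal: "A \<lhd> H"
proof (rule H.normal_invI[OF A_subgroup])
  fix x a assume x: "x \<in> carrier H" and a: "a \<in> A"
  have ac: "a \<in> carrier H" using a by simp
  have "(x \<otimes>\<^bsub>H\<^esub> a) \<otimes>\<^bsub>H\<^esub> inv\<^bsub>H\<^esub> (a \<otimes>\<^bsub>H\<^esub> x) \<otimes>\<^bsub>H\<^esub> a \<in> A"
    using subgroup.m_closed[OF A_subgroup A_commutator[OF x ac] a] .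
  moreover have "(x \<otimes>\<^bsub>H\<^esub> a) \<otimes>\<^bsub>H\<^esub> inv\<^bsub>H\<^esub> (a \<otimes>\<^bsub>H\<^esub> x) \<otimes>\<^bsub>H\<^esub> a = x \<otimes>\<^bsub>H\<^esub> a \<otimes>\<^bsub>H\<^esub> inv\<^bsub>H\<^esub> x"
    using x ac by (simp add: H.inv_mult_group H.m_assoc)
  ultimately show "x \<otimes>\<^bsub>H\<^esub> a \<otimes>\<^bsub>H\<^esub> inv\<^bsub>H\<^esub> x \<in> A" by simp
qed

lemma A_comm:
  assumes "a \<in> A" "b \<in> A"
  shows "a \<otimes>\<^bsub>H\<^esub> b = b \<otimes>\<^bsub>H\<^esub> a"
proof -
  have c: "a \<in> carrier H" "b \<in> carrier H" using assms by auto
  have "(a \<otimes>\<^bsub>H\<^esub> b) \<otimes>\<^bsub>H\<^esub> inv\<^bsub>H\<^esub> (b \<otimes>\<^bsub>H\<^esub> a) = \<one>\<^bsub>H\<^esub>"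
  proof (rule eq_oneI)
    fix m :: int assume m: "0 < m"
    note N = K_finite_index[OF m]
    obtain v w where vw: "v \<in> V" "w \<in> V" "rel (K m) a v" "rel (K m) b w"
      using A_rel[OF assms(1) m] A_rel[OF assms(2) m] by blast
    have "rel (K m) ((a \<otimes>\<^bsub>H\<^esub> b) \<otimes>\<^bsub>H\<^esub> inv\<^bsub>H\<^esub> (b \<otimes>\<^bsub>H\<^esub> a)) ((v \<otimes> w) \<otimes> inv (w \<otimes> v))"
      by (intro rel_mult[OF N] rel_inv[OF N] vw)
    then show "rel (K m) ((a \<otimes>\<^bsub>H\<^esub> b) \<otimes>\<^bsub>H\<^esub> inv\<^bsub>H\<^esub> (b \<otimes>\<^bsub>H\<^esub> a)) \<one>"
      using vw V_comm[OF vw(1,2)] by simp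
  qed (use c in simp)
  then have "a \<otimes>\<^bsub>H\<^esub> b = inv\<^bsub>H\<^esub> (inv\<^bsub>H\<^esub> (b \<otimes>\<^bsub>H\<^esub> a))"
    using c by (intro H.inv_equality[symmetric]) auto
  then show ?thesis using c by simp
qed

lemma A_exponent:
  assumes "a \<in> A"
  shows "a [^]\<^bsub>H\<^esub> p = \<one>\<^bsub>H\<^esub>"
proof (rule eq_oneI)
  fix m :: int assume m: "0 < m"
  obtain v where v: "v \<in> V" "rel (K m) a v" using A_rel[OF assms m] by blast
  show "rel (K m) (a [^]\<^bsub>H\<^esub> p) \<one>" using rel_nat_pow[OF K_finite_index[OF m] v(2), of p] V_exponent[OF v(1)] by simp
qed (use assms in simp)

text \<open>If \<open>d\<close> has a representative with exponent \<open>j\<close> at level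
  \<open>k m\<close>, its \<open>k\<close>-th power has exponent \<open>j k\<close>, which must
  vanish modulo \<open>k m\<close>; hence \<open>m\<close> divides \<open>j\<close>. The level is
  enlarged by \<open>k\<close> to make up for this division.\<close>

lemma A_pure:
  assumes d: "d \<in> carrier H" "0 < k" "d [^]\<^bsub>H\<^esub> (k::nat) \<in> A"
  shows "d \<in> A"
proof -
  have "\<exists>v\<in>V. rel (K m) d v" if m: "0 < m" for m
  proof -
    have km: "0 < int k * m" using m d by simp
    note N = K_finite_index[OF km] and M = K_finite_index[OF m]
    obtain g where g: "rel (K (int k * m)) d g" using rel_total[OF N d(1)] by blast
    obtain v j where v: "v \<in> V" "g = v \<otimes> s [^] (j::int)" using decompose rel_closed[OF g] by blast
    obtain w where w: "w \<in> V" "rel (K (int k * m)) (d [^]\<^bsub>H\<^esub> k) w" using A_rel[OF d(3) km] by blast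
    obtain x where x: "x \<in> V" "(v \<otimes> s [^] j) [^] int k = x \<otimes> s [^] (j * int k)" using twisted_pow[OF v(1)] by blast
    have "rel (K (int k * m)) (d [^]\<^bsub>H\<^esub> k) (x \<otimes> s [^] (j * int k))"
      using rel_nat_pow[OF N g, of k] x(2) unfolding v(2) by (simp add: int_pow_int)
    then have "(x \<otimes> s [^] (j * int k)) \<otimes> inv (w \<otimes> s [^] (0::int)) \<in> K (int k * m)"
      using rel_diff[OF N _ w(2)] w(1) by simp
    then have "int k * m dvd j * int k - 0" by (rule twisted_diff_in_K[OF x(1) w(1)])
    then have "m dvd j" using d(2) by (simp add: mult.commute)
    then have "inv (s [^] j) \<in> K m" using mem_K_iff[of \<one> "- j" m] subgroup.one_closed[OF W_subgroup, of m]
      by (simp add: int_pow_neg)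
    then have "rel (K m) \<one>\<^bsub>H\<^esub> (inv (s [^] j))" using rel_one_iff[OF M] by blast
    moreover have "rel (K m) d g" by (rule rel_mono[OF N M _ g]) (rule K_antimono, simp)
    ultimately have "rel (K m) (d \<otimes>\<^bsub>H\<^esub> \<one>\<^bsub>H\<^esub>) (g \<otimes> inv (s [^] j))" by (intro rel_mult[OF M])
    then show ?thesis using v d(1) by (auto simp: m_assoc)
  qed
  then show ?thesis by (rule A_I[OF d(1)])
qed

section \<open>The quotient by \<open>A\<close> is infinite cyclic\<close>

abbreviation "B \<equiv> H Mod A"
abbreviation \<pi> :: "'b \<Rightarrow> 'b set" where "\<pi> d \<equiv> A #>\<^bsub>H\<^esub> d"

lemma B_comm: "comm_group B"
proof (rule group.group_comm_groupI)
  show "group B" by (rule normal.factorgroup_is_group[OF A_normal])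
  fix X Y assume "X \<in> carrier B" "Y \<in> carrier B"
  then obtain x y where xy: "x \<in> carrier H" "y \<in> carrier H" "X = \<pi> x" "Y = \<pi> y" by (auto simp: carrier_FactGroup)
  have "x \<otimes>\<^bsub>H\<^esub> y = ((x \<otimes>\<^bsub>H\<^esub> y) \<otimes>\<^bsub>H\<^esub> inv\<^bsub>H\<^esub> (y \<otimes>\<^bsub>H\<^esub> x)) \<otimes>\<^bsub>H\<^esub> (y \<otimes>\<^bsub>H\<^esub> x)" using xy by (simp add: H.m_assoc)
  then have "x \<otimes>\<^bsub>H\<^esub> y \<in> \<pi> (y \<otimes>\<^bsub>H\<^esub> x)" using A_commutator[OF xy(1,2)] unfolding r_coset_def by blast
  then have "\<pi> (y \<otimes>\<^bsub>H\<^esub> x) = \<pi> (x \<otimes>\<^bsub>H\<^esub> y)" using H.repr_independence[OF _ _ A_subgroup] xy by simp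
  then show "X \<otimes>\<^bsub>B\<^esub> Y = Y \<otimes>\<^bsub>B\<^esub> X" using xy normal.rcos_sum[OF A_normal] by simp
qed

sublocale B: comm_group B by (rule B_comm)

sublocale \<pi>: group_hom H B \<pi>
  using normal.r_coset_hom_Mod[OF A_normal]
  by (simp add: group_hom_def group_hom_axioms_def H.is_group B.is_group)

lemma \<pi>_eq_one_iff: "d \<in> carrier H \<Longrightarrow> \<pi> d = A \<longleftrightarrow> d \<in> A"
  using H.coset_join1 H.coset_join2 A_subgroup subgroup.subset by metis

lemma \<pi>_cases:
  assumes "X \<in> carrier B"
  obtains d where "d \<in> carrier H" "X = \<pi> d"
  using assms by (auto simp: carrier_FactGroup)

sublocale BM: torsion_free_module B "\<lambda>(k::int) X. X [^]\<^bsub>B\<^esub> k" "\<lambda>k. nat \<bar>k\<bar>"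
proof (rule B.torsion_free_int_module)
  fix X :: "'b set" and k :: nat assume X: "X \<in> carrier B" "0 < k" "X [^]\<^bsub>B\<^esub> k = \<one>\<^bsub>B\<^esub>"
  obtain d where d: "d \<in> carrier H" "X = \<pi> d" using X(1) by (rule \<pi>_cases)
  have "\<pi> (d [^]\<^bsub>H\<^esub> k) = A" using X(3) d \<pi>.hom_nat_pow[of d k] by simp
  then have "d \<in> A" using A_pure[OF d(1) X(2)] \<pi>_eq_one_iff d(1) by simp
  then show "X = \<one>\<^bsub>B\<^esub>" using \<pi>_eq_one_iff d by simp
qed

lemma B_basis:
  obtains J :: "'b set" and y where "finite J" "y \<in> J \<rightarrow> carrier B" "BM.lin_span J y = carrier B" "BM.independent J y"
proof -
  obtain S where S: "S \<subseteq> carrier H" "finite S" "generate H S = carrier H"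
    using H_finitely_generated unfolding finitely_generated_def by blast
  have \<pi>S: "\<pi> \<in> S \<rightarrow> carrier B" using S(1) by auto
  have "carrier B = \<pi> ` carrier H" by (simp add: carrier_FactGroup)
  also have "\<dots> = generate B (\<pi> ` S)" using \<pi>.generate_img[OF S(1)] S(3) by simp
  also have "\<dots> \<subseteq> BM.lin_span S \<pi>"
    by (rule B.generate_subgroup_incl[OF _ BM.lin_span_subgroup[OF \<pi>S]])
      (use BM.lin_span_incl[OF \<pi>S S(2)] in blast)
  finally have "carrier B \<subseteq> BM.lin_span S \<pi>" .
  then have span: "BM.lin_span S \<pi> = carrier B" using BM.lin_span_closed[OF \<pi>S] by (rule subset_antisym[rotated])
  obtain J y where "J \<subseteq> S" "y \<in> J \<rightarrow> carrier B" "BM.lin_span J y = BM.lin_span S \<pi>" "BM.independent J y"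
    by (rule BM.exists_basis[OF S(2) \<pi>S])
  then show thesis using that[of J y] span finite_subset[OF _ S(2)] by simp
qed

text \<open>Modulo \<open>(p + 1)\<close>-th powers the finite quotients of \<open>G\<close> only see the cyclic group generated
  by \<open>s\<close>, because \<open>V\<close> has exponent \<open>p\<close>.\<close>

lemma B_mod_powers_cyclic:
  obtains s0 where "s0 \<in> carrier H"
    "\<And>X. X \<in> carrier B \<Longrightarrow> \<exists>(k::int). \<exists>Z\<in>carrier B. X = \<pi> s0 [^]\<^bsub>B\<^esub> k \<otimes>\<^bsub>B\<^esub> Z [^]\<^bsub>B\<^esub> (int (Suc p))"
proof -
  let ?q = "Suc p"
  define P where "P = (\<lambda>X. X [^]\<^bsub>B\<^esub> ?q) ` carrier B"
  have "(\<lambda>X. X [^]\<^bsub>B\<^esub> ?q) \<in> hom B B"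
    by (rule homI) (simp_all only: B.nat_pow_closed B.nat_pow_distrib)
  then interpret pw: group_hom B B "\<lambda>X. X [^]\<^bsub>B\<^esub> ?q"
    by (simp only: group_hom_def group_hom_axioms_def B.is_group simp_thms)
  have P: "subgroup P B" unfolding P_def by (rule pw.img_is_subgroup)
  interpret Q: comm_group "B Mod P" by (rule B.abelian_FactGroup[OF P])
  let ?h = "\<lambda>X. P #>\<^bsub>B\<^esub> X"
  have hB: "?h \<in> hom B (B Mod P)"
    by (rule normal.r_coset_hom_Mod[OF B.subgroup_imp_normal[OF P]])
  interpret h: group_hom B "B Mod P" ?h
    using hB by (simp only: group_hom_def group_hom_axioms_def B.is_group Q.is_group simp_thms)
  have hone: "?h X = P \<longleftrightarrow> X \<in> P" if "X \<in> carrier B" for X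
    using that B.coset_join1[OF _ that P] B.coset_join2[OF that P] subgroup.subset[OF P] by blast
  have exp: "Y [^]\<^bsub>B Mod P\<^esub> ?q = \<one>\<^bsub>B Mod P\<^esub>" if Y: "Y \<in> carrier (B Mod P)" for Y
  proof -
    obtain X where X: "X \<in> carrier B" "Y = ?h X" using Y by (auto simp: carrier_FactGroup)
    have "Y [^]\<^bsub>B Mod P\<^esub> ?q = ?h (X [^]\<^bsub>B\<^esub> ?q)" unfolding X(2) by (rule h.hom_nat_pow[OF X(1), symmetric])
    also have "\<dots> = P" using hone[OF B.nat_pow_closed[OF X(1), of ?q]] X(1) unfolding P_def by blast
    finally show ?thesis by simp
  qed
  obtain S where S: "S \<subseteq> carrier H" "finite S" "generate H S = carrier H"
    using H_finitely_generated unfolding finitely_generated_def by blast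
  let ?f = "\<lambda>d. ?h (\<pi> d)"
  have f: "?f \<in> hom H (B Mod P)" using Group.hom_compose[OF \<pi>.homh hB] by (simp only: o_def)
  interpret f: group_hom H "B Mod P" ?f
    using f by (simp only: group_hom_def group_hom_axioms_def H.is_group Q.is_group simp_thms)
  have fonto: "?f ` carrier H = carrier (B Mod P)" by (simp add: carrier_FactGroup image_image)
  have "finite (carrier (B Mod P))"
  proof (rule conjunct1[OF Q.finite_generated_exponent[of "?f ` S" ?q]])
    show "generate (B Mod P) (?f ` S) = carrier (B Mod P)" using f.generate_img[OF S(1)] S(3) fonto by simp
    show "?f ` S \<subseteq> carrier (B Mod P)" using S(1) fonto by blast
    show "x [^]\<^bsub>B Mod P\<^esub> ?q = \<one>\<^bsub>B Mod P\<^esub>" if "x \<in> carrier (B Mod P)" for x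
      using that by (rule exp)
  qed (use S in auto)
  then have "kernel H (B Mod P) ?f \<in> finite_index_normal H"
    using H.finite_index_normalI[OF f Q.is_group] fonto by simp
  then obtain N where N: "N \<in> finite_index_normal G" "\<And>d. rel N d \<one> \<Longrightarrow> d \<in> kernel H (B Mod P) ?f"
    using rel_cofinal by blast
  obtain m where m: "0 < m" "K m \<subseteq> N" using K_cofinal[OF N(1)] by blast
  note M = K_finite_index[OF m(1)]
  obtain s0 where s0: "rel (K m) s0 s" using rel_surj[OF M s_closed] by blast
  have s0c: "s0 \<in> carrier H" using rel_closed[OF s0] by blast
  have "\<exists>(k::int). \<exists>Z\<in>carrier B. X = \<pi> s0 [^]\<^bsub>B\<^esub> k \<otimes>\<^bsub>B\<^esub> Z [^]\<^bsub>B\<^esub> (int ?q)" if X: "X \<in> carrier B" for X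
  proof -
    obtain d where d: "d \<in> carrier H" "X = \<pi> d" using X by (rule \<pi>_cases)
    obtain g where g: "rel (K m) d g" using rel_total[OF M d(1)] by blast
    obtain v k where v: "v \<in> V" "g = v \<otimes> s [^] (k::int)" using decompose rel_closed[OF g] by blast
    define x where "x = d \<otimes>\<^bsub>H\<^esub> inv\<^bsub>H\<^esub> (s0 [^]\<^bsub>H\<^esub> k)"
    have xc: "x \<in> carrier H" using d s0c by (simp add: x_def)
    have "rel (K m) x (g \<otimes> inv (s [^] k))"
      unfolding x_def by (intro rel_mult[OF M] g rel_inv[OF M] rel_int_pow[OF M] s0)
    then have "rel (K m) x v" using v by (simp add: m_assoc)
    \<comment> \<open>The image of \<open>x\<close> in \<open>B Mod P\<close> is killed by
      \<open>p\<close> because \<open>v\<close> has exponent \<open>p\<close>, and by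
      \<open>p + 1\<close> by construction, so it is trivial.\<close>
    then have "rel (K m) (x [^]\<^bsub>H\<^esub> p) \<one>" using rel_nat_pow[OF M, of x v p] V_exponent[OF v(1)] by simp
    then have "rel N (x [^]\<^bsub>H\<^esub> p) \<one>" by (rule rel_mono[OF M N(1) m(2)])
    then have "?f (x [^]\<^bsub>H\<^esub> p) = \<one>\<^bsub>B Mod P\<^esub>" using N(2) unfolding kernel_def by blast
    then have "?f x [^]\<^bsub>B Mod P\<^esub> p = \<one>\<^bsub>B Mod P\<^esub>" using f.hom_nat_pow[OF xc, of p] by argo
    moreover have fx: "?f x \<in> carrier (B Mod P)" by (rule f.hom_closed[OF xc])
    moreover have "?f x [^]\<^bsub>B Mod P\<^esub> Suc p = ?f x [^]\<^bsub>B Mod P\<^esub> p \<otimes>\<^bsub>B Mod P\<^esub> ?f x" by (rule Q.nat_pow_Suc)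
    ultimately have "?f x = \<one>\<^bsub>B Mod P\<^esub>" using exp[OF fx] Q.l_one[OF fx] by argo
    then have "\<pi> x \<in> P" using hone[OF \<pi>.hom_closed[OF xc]] by simp
    then obtain Z where Z: "Z \<in> carrier B" "\<pi> x = Z [^]\<^bsub>B\<^esub> ?q" unfolding P_def by blast
    have "d = x \<otimes>\<^bsub>H\<^esub> s0 [^]\<^bsub>H\<^esub> k" using d s0c by (simp add: x_def H.m_assoc)
    then have "X = \<pi> x \<otimes>\<^bsub>B\<^esub> \<pi> (s0 [^]\<^bsub>H\<^esub> k)" using d(2) \<pi>.hom_mult[OF xc, of "s0 [^]\<^bsub>H\<^esub> k"] s0c by simp
    then have "X = \<pi> s0 [^]\<^bsub>B\<^esub> k \<otimes>\<^bsub>B\<^esub> Z [^]\<^bsub>B\<^esub> (int ?q)"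
      using Z B.m_comm[of "\<pi> x" "\<pi> s0 [^]\<^bsub>B\<^esub> k"] \<pi>.hom_int_pow[OF s0c, of k] \<pi>.hom_closed[OF xc] \<pi>.hom_closed[OF s0c]
        int_pow_int[of B Z ?q] B.int_pow_closed by metis
    then show ?thesis using Z(1) by blast
  qed
  then show thesis using that s0c by blast
qed

text \<open>Modulo \<open>p + 1\<close> every basis vector is a multiple of the coordinate vector
  \<open>c\<close> of \<open>\<pi> s0\<close>, which is impossible for two different basis
  vectors.\<close>

lemma B_rank_le_1:
  assumes J: "finite J" "y \<in> J \<rightarrow> carrier B" "BM.lin_span J y = carrier B" "BM.independent J y"
    and ij: "i \<in> J" "j \<in> J"
  shows "i = j"
proof (rule ccontr)
  assume "i \<noteq> j"
  obtain s0 where s0: "s0 \<in> carrier H"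
    "\<And>X. X \<in> carrier B \<Longrightarrow> \<exists>(k::int). \<exists>Z\<in>carrier B. X = \<pi> s0 [^]\<^bsub>B\<^esub> k \<otimes>\<^bsub>B\<^esub> Z [^]\<^bsub>B\<^esub> (int (Suc p))"
    by (rule B_mod_powers_cyclic) (rule that)
  have coord: "\<exists>c. X = BM.lincomb J c y" if "X \<in> carrier B" for X
    using that J(3) unfolding BM.lin_span_def by blast
  obtain c where c: "\<pi> s0 = BM.lincomb J c y" using coord \<pi>.hom_closed[OF s0(1)] by blast
  have rel: "\<exists>k b. \<forall>l\<in>J. (if i' = l then 1 else 0) = k * c l + int (Suc p) * b l" if i': "i' \<in> J" for i'
  proof -
    have yi: "y i' \<in> carrier B" using J(2) i' by blast
    obtain k Z where kZ: "Z \<in> carrier B" "y i' = \<pi> s0 [^]\<^bsub>B\<^esub> (k::int) \<otimes>\<^bsub>B\<^esub> Z [^]\<^bsub>B\<^esub> (int (Suc p))"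
      using s0(2)[OF yi] by blast
    obtain b where b: "Z = BM.lincomb J b y" using coord[OF kZ(1)] by blast
    let ?r = "\<lambda>l. k * c l + int (Suc p) * b l"
    have "BM.lincomb J ?r y = y i'"
      unfolding BM.lincomb_add[OF J(2)] BM.lincomb_smul[OF J(2)] kZ(2) c b ..
    moreover have "BM.lincomb J (\<lambda>l. if i' = l then 1 else 0) y = y i'"
      by (rule BM.lincomb_delta[OF J(2,1) i'])
    ultimately have "BM.lincomb J (\<lambda>l. (if i' = l then 1 else 0) - ?r l) y = \<one>\<^bsub>B\<^esub>"
      unfolding BM.lincomb_diff[OF J(2)] using yi B.r_inv by metis
    then have "\<forall>l\<in>J. nat \<bar>(if i' = l then 1 else 0) - ?r l\<bar> = 0" using J(4) unfolding BM.independent_def by blast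
    then show ?thesis by (intro exI[of _ k] exI[of _ b]) auto
  qed
  obtain k b where kb: "\<forall>l\<in>J. (if i = l then 1 else 0) = k * c l + int (Suc p) * b l" using rel[OF ij(1)] by blast
  obtain k' b' where kb': "\<forall>l\<in>J. (if j = l then 1 else 0) = k' * c l + int (Suc p) * b' l" using rel[OF ij(2)] by blast
  let ?q = "int (Suc p)"
  have 1: "1 = k * c i + ?q * b i" "0 = k * c j + ?q * b j" "1 = k' * c j + ?q * b' j"
    using kb kb' ij \<open>i \<noteq> j\<close> by force+
  \<comment> \<open>Modulo \<open>?q\<close> the relations say \<open>k c_i = 1\<close>,
    \<open>k c_j = 0\<close> and \<open>k' c_j = 1\<close>. The last two give \<open>k = 0\<close>,
    against the first.\<close>
  have "k = k * (k' * c j + ?q * b' j)" unfolding 1(3)[symmetric] by simp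
  also have "\<dots> = k' * (k * c j) + ?q * (k * b' j)" by (simp add: algebra_simps)
  also have "k * c j = - (?q * b j)" using 1(2) by linarith
  finally have "k = ?q * (k * b' j - k' * b j)" by (simp add: algebra_simps)
  then have "?q dvd k" by (rule dvdI)
  then have "?q dvd 1" unfolding 1(1) by (intro dvd_add dvd_mult2 dvd_triv_left)
  then show False using p prime_gt_0_nat[OF p] by simp
qed

lemma cyclic_complement:
  obtains t where "t \<in> carrier H" "\<And>d. d \<in> carrier H \<Longrightarrow> \<exists>a\<in>A. \<exists>k::int. d = a \<otimes>\<^bsub>H\<^esub> t [^]\<^bsub>H\<^esub> k"
    "\<And>k::int. t [^]\<^bsub>H\<^esub> k \<in> A \<Longrightarrow> k = 0"
proof -
  obtain J :: "'b set" and y where J: "finite J" "y \<in> J \<rightarrow> carrier B" "BM.lin_span J y = carrier B" "BM.independent J y"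
    by (rule B_basis)
  have "J \<noteq> {}"
  proof
    assume "J = {}"
    then have triv: "carrier B = {\<one>\<^bsub>B\<^esub>}" using J(3) by (simp add: BM.lin_span_def BM.lincomb_def)
    \<comment> \<open>If \<open>B\<close> were trivial, a partner of \<open>s\<close> would also
      have a representative in \<open>V\<close>. Level 2 already separates the exponents 1 and
      0.\<close>
    note N = K_finite_index[of 2, simplified]
    obtain d where d: "rel (K 2) d s" using rel_surj[OF N s_closed] by blast
    have dc: "d \<in> carrier H" using rel_closed[OF d] by blast
    then have "\<pi> d = A" using triv \<pi>.hom_closed[OF dc] by simp
    then have "d \<in> A" using \<pi>_eq_one_iff dc by blast
    then obtain v where v: "v \<in> V" "rel (K 2) d v" using A_rel[of d 2] by fastforce
    have "(\<one> \<otimes> s [^] (1::int)) \<otimes> inv (v \<otimes> s [^] (0::int)) \<in> K 2" using rel_diff[OF N d v(2)] v(1) by simp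
    then have "2 dvd (1 - 0 :: int)" by (rule twisted_diff_in_K[OF V_one v(1)])
    then show False by simp
  qed
  then obtain i where i: "J = {i}" using B_rank_le_1[OF J] by blast
  have yi: "y i \<in> carrier B" using J(2) i by blast
  obtain t where t: "t \<in> carrier H" "y i = \<pi> t" using yi by (rule \<pi>_cases)
  have rA: "X <#>\<^bsub>H\<^esub> A = X" if "X \<in> carrier B" for X
    using B.r_one[OF that] by simp
  have lc: "BM.lincomb J f y = \<pi> (t [^]\<^bsub>H\<^esub> f i)" for f
    using yi t \<pi>.hom_int_pow[OF t(1), of "f i"] by (simp add: BM.lincomb_def i rA)
  show thesis
  proof (rule that[OF t(1)])
    fix d assume d: "d \<in> carrier H"
    then have "\<pi> d \<in> BM.lin_span J y" using J(3) \<pi>.hom_closed by blast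
    then obtain k :: int where "\<pi> d = \<pi> (t [^]\<^bsub>H\<^esub> k)" unfolding BM.lin_span_def lc by blast
    then have "d \<in> \<pi> (t [^]\<^bsub>H\<^esub> k)" using H.rcos_self[OF d A_subgroup] by simp
    then show "\<exists>a\<in>A. \<exists>k::int. d = a \<otimes>\<^bsub>H\<^esub> t [^]\<^bsub>H\<^esub> k" unfolding r_coset_def by blast
  next
    fix k :: int assume k: "t [^]\<^bsub>H\<^esub> k \<in> A"
    have "BM.lincomb J (\<lambda>_. k) y = \<one>\<^bsub>B\<^esub>" unfolding lc using \<pi>_eq_one_iff k t(1) by simp
    then show "k = 0" using J(4) i unfolding BM.independent_def by fastforce
  qed
qed

text \<open>Represent \<open>t\<close> by \<open>w s^u\<close> and \<open>a\<close> by
  \<open>v\<close>. That \<open>t^c\<close> commutes with \<open>a\<close> says that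
  \<open>t^(cu) - 1\<close>, in the shift of \<open>V\<close>, kills \<open>v\<close> modulo
  \<open>W ?P\<close>; the unknown \<open>u\<close> is invertible modulo \<open>?P\<close>, so
  \<open>centralizing_mod_K\<close> applies.\<close>

lemma A_aperiodic:
  assumes t: "t \<in> carrier H" "\<And>d. d \<in> carrier H \<Longrightarrow> \<exists>a\<in>A. \<exists>k::int. d = a \<otimes>\<^bsub>H\<^esub> t [^]\<^bsub>H\<^esub> k"
    and a: "a \<in> A" and c: "0 < c" "t [^]\<^bsub>H\<^esub> (c::int) \<otimes>\<^bsub>H\<^esub> a = a \<otimes>\<^bsub>H\<^esub> t [^]\<^bsub>H\<^esub> c"
  shows "a = \<one>\<^bsub>H\<^esub>"
proof (rule eq_oneI)
  show "a \<in> carrier H" using a by simp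
  fix m :: int assume m: "0 < m"
  \<comment> \<open>The factor \<open>m\<close> reaches the prescribed level, \<open>c\<close> meets
    the requirement \<open>c dvd M\<close> of \<open>centralizing_mod_K\<close>, and the factor
    \<open>p\<close> of \<open>?P\<close> is what that lemma gives up.\<close>
  let ?M = "c * m"
  let ?P = "int p * ?M"
  have pos: "0 < ?M" "0 < ?P" using m c prime_gt_0_nat[OF p] by auto
  note N = K_finite_index[OF pos(2)]
  obtain v where v: "v \<in> V" "rel (K ?P) a v" using A_rel[OF a pos(2)] by blast
  obtain g where g: "rel (K ?P) t g" using rel_total[OF N t(1)] by blast
  obtain w u where w: "w \<in> V" "g = w \<otimes> s [^] (u::int)" using decompose rel_closed[OF g] by blast
  have tpow: "\<exists>x\<in>V. rel (K ?P) (t [^]\<^bsub>H\<^esub> k) (x \<otimes> s [^] (u * k))" for k :: int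
    using twisted_pow[OF w(1), of u k] rel_int_pow[OF N g, of k] unfolding w(2) by auto
  \<comment> \<open>Invertibility of \<open>u\<close> comes from surjectivity: a partner of
    \<open>s\<close> has the form \<open>a' t^k\<close>, and comparing exponents of \<open>s\<close>
    gives \<open>u k = 1\<close> modulo \<open>?P\<close>.\<close>
  obtain d where d: "rel (K ?P) d s" using rel_surj[OF N s_closed] by blast
  obtain a' k where k: "a' \<in> A" "d = a' \<otimes>\<^bsub>H\<^esub> t [^]\<^bsub>H\<^esub> (k::int)" using t(2) rel_closed[OF d] by blast
  obtain v' where v': "v' \<in> V" "rel (K ?P) a' v'" using A_rel[OF k(1) pos(2)] by blast
  obtain x where x: "x \<in> V" "rel (K ?P) (t [^]\<^bsub>H\<^esub> k) (x \<otimes> s [^] (u * k))" using tpow by blast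
  have "rel (K ?P) d ((v' \<otimes> x) \<otimes> s [^] (u * k))"
    using rel_mult[OF N v'(2) x(2)] v'(1) x(1) unfolding k(2) by (simp add: m_assoc)
  then have "((v' \<otimes> x) \<otimes> s [^] (u * k)) \<otimes> inv s \<in> K ?P" by (rule rel_diff[OF N _ d])
  then have "((v' \<otimes> x) \<otimes> s [^] (u * k)) \<otimes> inv (\<one> \<otimes> s [^] (1::int)) \<in> K ?P"
    by simp
  then have uk: "?P dvd u * k - 1" by (rule twisted_diff_in_K[OF V_mult[OF v'(1) x(1)] V_one])
  obtain z where z: "z \<in> V" "rel (K ?P) (t [^]\<^bsub>H\<^esub> c) (z \<otimes> s [^] (u * c))" using tpow by blast
  let ?e = "u * c"
  have "(z \<otimes> s [^] ?e \<otimes> v) \<otimes> inv (v \<otimes> (z \<otimes> s [^] ?e)) \<in> K ?P"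
    using rel_diff[OF N rel_mult[OF N z(2) v(2)]] rel_mult[OF N v(2) z(2)] unfolding c(2) by blast
  \<comment> \<open>The factor \<open>z\<close> lies in the commutative \<open>V\<close> and drops
    out, so only the power of \<open>s\<close> acts on \<open>v\<close>.\<close>
  moreover have "(z \<otimes> s [^] ?e \<otimes> v) \<otimes> inv (v \<otimes> (z \<otimes> s [^] ?e)) = act ?e v \<otimes> inv v"
  proof -
    have "z \<otimes> s [^] ?e \<otimes> v = z \<otimes> (act ?e v \<otimes> s [^] ?e)"
      using z v by (simp add: act_def m_assoc)
    also have "\<dots> = (act ?e v \<otimes> z) \<otimes> s [^] ?e"
      using z v V_comm[of z "act ?e v"] act_in_V[OF v(1), of ?e] by (simp add: m_assoc[symmetric])
    finally show ?thesis using z v act_in_V[OF v(1), of ?e] by (simp add: inv_mult_group m_assoc)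
  qed
  ultimately have "act ?e v \<otimes> inv v \<in> K ?P" by simp
  then have "smul (sh (c * u)) v \<in> W ?P"
    using V_Int_K[of "act ?e v \<otimes> inv v"] act_in_V[OF v(1)] v(1) by (simp add: smul_sh mult.commute)
  then have "v \<in> W ?M" by (rule centralizing_mod_K[OF v(1) pos(1) dvd_triv_left uk])
  then have "v \<in> K ?M" using W_subset_K by blast
  then have vK: "v \<in> K m" using K_antimono[of m ?M] by auto
  note M = K_finite_index[OF m]
  have "rel (K m) a v" by (rule rel_mono[OF N M _ v(2)]) (rule K_antimono, simp)
  moreover have "rel (K m) \<one>\<^bsub>H\<^esub> (inv v)"
    using rel_one_iff[OF M] subgroup.m_inv_closed[OF K_subgroup vK] by blast
  ultimately have "rel (K m) (a \<otimes>\<^bsub>H\<^esub> \<one>\<^bsub>H\<^esub>) (v \<otimes> inv v)" by (intro rel_mult[OF M])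
  then show "rel (K m) a \<one>" using a v(1) by simp
qed

theorem H_lamplighter_like: "\<exists>t. lamplighter_like H p A t"
proof -
  obtain t where t: "t \<in> carrier H" "\<And>d. d \<in> carrier H \<Longrightarrow> \<exists>a\<in>A. \<exists>k::int. d = a \<otimes>\<^bsub>H\<^esub> t [^]\<^bsub>H\<^esub> k"
    "\<And>k::int. t [^]\<^bsub>H\<^esub> k \<in> A \<Longrightarrow> k = 0"
    by (rule cyclic_complement) (rule that)
  have "lamplighter_like H p A t"
  proof (intro lamplighter_like.intro lamplighter_like_axioms.intro H.is_group p A_normal)
    show "a = \<one>\<^bsub>H\<^esub>" if "a \<in> A" "0 < m" "t [^]\<^bsub>H\<^esub> (m::int) \<otimes>\<^bsub>H\<^esub> a = a \<otimes>\<^bsub>H\<^esub> t [^]\<^bsub>H\<^esub> m" for a m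
      using A_aperiodic[OF t(1,2) that] .
  qed (fact A_comm A_exponent t H_finitely_generated)+
  then show ?thesis ..
qed

end

theorem theorem1p1:
  fixes n p :: nat
  assumes "Factorial_Ring.prime p" and "n \<ge> 1"
  shows "profinitely_rigid TYPE('d) (lamplighter n p)"
  unfolding profinitely_rigid_def
proof (intro conjI allI impI)
  interpret C: concrete_lamplighter n p by unfold_locales (rule assms(1))
  show "group C.L" by (rule C.L_group)
  show "finitely_generated C.L" by (rule C.L_finitely_generated)
  show "residually_finite C.L" by (rule C.L_residually_finite)
  fix \<Delta> :: "'d monoid"
  assume \<Delta>: "group \<Delta> \<and> finitely_generated \<Delta> \<and> residually_finite \<Delta> \<and> profinite_completions_iso C.L \<Delta>"
  obtain rel where "quotient_link C.L \<Delta> rel"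
    using profinite_completions_iso_link[of C.L \<Delta>] \<Delta> C.L_group by blast
  then interpret link: lamplighter_link C.L p C.base C.t \<Delta> rel
    using \<Delta> by (intro lamplighter_link.intro lamplighter_link_axioms.intro C.lamplighter_like_axioms) auto
  obtain t where t: "lamplighter_like \<Delta> p link.A t" using link.H_lamplighter_like by blast
  obtain r where r: "lamplighter r p \<cong> \<Delta>" using lamplighter_like.iso_lamplighter[OF t] by blast
  interpret R: concrete_lamplighter r p by unfold_locales (rule assms(1))
  have E: "group (elementary_group m p)" "finite (carrier (elementary_group m p))" for m
    using C.p_prime
    by (auto simp: finite_product_group carrier_integer_mod_group simp del: carrier_product_group)
  \<comment> \<open>The elementary abelian quotients of both groups are compared in both directions,
    which forces \<open>r = n\<close>.\<close>
  have "maps_onto R.L (elementary_group n p)"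
    using maps_onto_trans[OF is_iso_imp_maps_onto[OF r] link.maps_onto_transfer[OF E C.maps_onto_elementary]] .
  then have "n \<le> r" by (rule R.elementary_rank_le)
  moreover have "maps_onto \<Delta> (elementary_group r p)"
    using maps_onto_trans[OF is_iso_imp_maps_onto[OF R.L.iso_sym[OF r]] R.maps_onto_elementary] .
  then have "maps_onto C.L (elementary_group r p)" by (rule link.maps_onto_transfer_back[OF E])
  then have "r \<le> n" by (rule C.elementary_rank_le)
  ultimately show "C.L \<cong> \<Delta>" using r by simp
qed

end
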